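(* Let $D$ be a based oriented diagram of a knot in $\mathbb{RP}^3$. If $D$ is descending, then $D$ is a diagram of an unknot.
   Context: Diagrams. Represent $\mathbb{RP}^3$ as the closed ball $D^3$ with antipodal points of its boundary sphere identified. A link $L\subset\mathbb{RP}^3$ in general position is lifted to $L'\subset D^3$ (missing the poles) and projected to the equatorial disk $D^2$, each point being moved along the metric circle through it and the two poles. The image is a collection of generically immersed arcs (compact connected 1-manifolds with or without boundary) whose endpoints lie on the boundary circle of the disk and are divided into antipodal pairs; at each double point (crossing) one records which branch is over and which is under (over = closer to the north pole). This is a diagram of $L$; an orientation of $L$ orients all arcs, giving an oriented diagram. A basepoint is a distinguished point of the diagram distinct from crossings and endpoints of arcs; a diagram with a basepoint is called based. Net. The net of a diagram $D$ is obtained by identifying antipodal points of the boundary circle of the disk; it is a collection of generically immersed circles with crossing information in $\mathbb{RP}^2$, and the image of the boundary circle is the line at infinity. Arc distance and first pass. Let $D$ be an oriented knot diagram and let $P,Q$ be points in the interior of arcs of $D$. The arc distance between $P$ and $Q$ is the number of times the line at infinity is crossed when travelling in the net from the image of $P$ to the image of $Q$ following the orientation. For a crossing $X$ of $D$, the first pass of $X$ from $P$ is the branch of $X$ that is passed first when travelling in the net from $P$ following the orientation. Descending. A based oriented diagram $D$ of a knot is descending if for every crossing $X$ of $D$, the first pass of $X$ from the basepoint is an overpass when the arc distance between the basepoint and this first pass is even, and an underpass when this arc distance is odd. Unknots. There are two unknots in $\mathbb{RP}^3$ up to isotopy: a planar circle (contractible, 0-homologous) and a projective line (non contractible). They are the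 knots admitting diagrams without crossings. *)

theory Defs
  imports "HOL-Analysis.Analysis"
begin

section \<open>Projective spaces as balls with antipodal boundary points identified\<close>

definition antipodal :: "'a::real_normed_vector \<Rightarrow> 'a \<Rightarrow> bool" where
  "antipodal x y \<longleftrightarrow> norm x \<le> 1 \<and> norm y \<le> 1 \<and> (x = y \<or> norm x = 1 \<and> y = - x)"

quotient_type (overloaded) 'a rp = "'a::real_normed_vector" / partial: antipodal
  by (rule part_equivpI) (auto simp: antipodal_def symp_def transp_def intro: exI[of _ 0])

text \<open>
  We write three-space as \<open>complex \<times> real\<close> (horizontal coordinate, height), so that the equatorial
  disk is the unit disk of \<open>complex\<close>. The map \<open>abs_rp\<close> sends a point of the closed
  unit ball to its class; its values outside the ball are irrelevant.
\<close>

type_synonym rp2 = "complex rp"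
type_synonym rp3 = "(complex \<times> real) rp"

text \<open>
  The double cover of the projective space by the unit sphere of \<open>'a \<times> real\<close>: the upper hemisphere
  is sent to the ball by stereographic projection from \<open>(0, -1)\<close>, the lower one by that
  of the antipodal point. On the equator \<open>w = 0\<close> both give the class of \<open>v\<close>.
\<close>

definition cover :: "'a::real_normed_vector \<times> real \<Rightarrow> 'a rp" where
  "cover = (\<lambda>(v, w). if w \<ge> 0 then abs_rp (v /\<^sub>R (1 + w)) else abs_rp (- v /\<^sub>R (1 - w)))"

text \<open>
  The smooth structure is the one making \<open>cover\<close> a local diffeomorphism. As the line is simply
  connected, a curve in the projective space is continuously differentiable iff it has a continuously
  differentiable lift to the sphere, and it is immersed iff the lift is.
\<close>

definition immersed_lift :: "(real \<Rightarrow> 'a::real_normed_vector \<times> real) \<Rightarrow> (real \<Rightarrow> 'a rp) \<Rightarrow> bool" where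
  "immersed_lift c f \<longleftrightarrow>
     (\<forall>s. norm (c s) = 1 \<and> f s = cover (c s)) \<and>
     c C1_differentiable_on UNIV \<and>
     (\<forall>s. vector_derivative c (at s) \<noteq> 0)"


section \<open>Knots and isotopy\<close>

text \<open>Embedded closed curves, the circle being the real line modulo the integers.\<close>

definition knot_param :: "(real \<Rightarrow> rp3) \<Rightarrow> bool" where
  "knot_param f \<longleftrightarrow> (\<exists>c. immersed_lift c f) \<and> (\<forall>s t. f s = f t \<longleftrightarrow> s - t \<in> \<int>)"

definition knot :: "rp3 set \<Rightarrow> bool" where
  "knot K \<longleftrightarrow> (\<exists>f. knot_param f \<and> K = range f)"

text \<open>
  An isotopy is a family \<open>F t\<close> of embeddings, jointly continuously differentiable in the curve parameter
  and in \<open>t\<close>; the latter is expressed by the lift \<open>G\<close> to the sphere, with derivative \<open>G'\<close>.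
\<close>

definition isotopic :: "rp3 set \<Rightarrow> rp3 set \<Rightarrow> bool" where
  "isotopic K L \<longleftrightarrow>
     (\<exists>(F :: real \<Rightarrow> real \<Rightarrow> rp3) (G :: real \<times> real \<Rightarrow> (complex \<times> real) \<times> real)
        (G' :: real \<times> real \<Rightarrow> (real \<times> real) \<Rightarrow>\<^sub>L ((complex \<times> real) \<times> real)).
        (\<forall>t\<in>{0..1}. knot_param (F t)) \<and> range (F 0) = K \<and> range (F 1) = L \<and>
        (\<forall>s. \<forall>t\<in>{0..1}. norm (G (s, t)) = 1 \<and> F t s = cover (G (s, t))) \<and>
        (\<forall>p \<in> UNIV \<times> {0..1}. (G has_derivative blinfun_apply (G' p)) (at p within UNIV \<times> {0..1})) \<and>
        continuous_on (UNIV \<times> {0..1}) G')"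

definition planar_circle :: "rp3 set" where
  "planar_circle = (\<lambda>h. abs_rp (h, 0)) ` sphere 0 (1/2)"

text \<open>A diameter of the ball; its two end points are identified.\<close>

definition projective_line :: "rp3 set" where
  "projective_line = (\<lambda>r. abs_rp (complex_of_real r, 0)) ` {-1..1}"

definition unknot :: "rp3 set \<Rightarrow> bool" where
  "unknot K \<longleftrightarrow> isotopic K planar_circle \<or> isotopic K projective_line"


section \<open>Projection to the equatorial disk\<close>

definition north :: "complex \<times> real" where "north = (0, 1)"
definition south :: "complex \<times> real" where "south = (0, -1)"

definition metric_circle :: "(complex \<times> real) set \<Rightarrow> bool" where
  "metric_circle C \<longleftrightarrow>
     (\<exists>P a r. affine P \<and> aff_dim P = 2 \<and> a \<in> P \<and> r > 0 \<and> C = P \<inter> sphere a r)"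

text \<open>
  A point \<open>x\<close> of the ball that is not a pole is moved to the equatorial disk along the circle through
  \<open>x\<close> and both poles, staying on its side of the axis (this matters when \<open>x\<close> is on the
  boundary sphere, where the circle meets the disk in two points). For \<open>x\<close> on the axis
  the circle degenerates to the axis.
\<close>

definition proj :: "complex \<times> real \<Rightarrow> complex" where
  "proj x = (if fst x = 0 then 0 else
     (THE y. y \<in> cball 0 1 \<and> (\<exists>l>0. y = l *\<^sub>R fst x) \<and>
             (\<exists>C. metric_circle C \<and> {north, south, x, (y, 0)} \<subseteq> C)))"


section \<open>Based oriented diagrams of knots\<close>

text \<open>
  A based oriented knot diagram is encoded by a journey along it. \<open>traj D s\<close> is the point of the disk
  reached at time \<open>s\<close> when starting at the basepoint \<open>traj D 0\<close> and following the
  orientation; on arriving at an end point of an arc one continues from the antipodal point,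
  and a full turn takes time 1. The arcs are thus the pieces of the journey between consecutive visits to the
  boundary circle (where \<open>traj D s\<close> may be either of the two antipodal end points), or the
  whole journey if there are no such visits. If \<open>traj D s\<close> is a crossing, \<open>over D s\<close> tells
  whether the branch followed at time \<open>s\<close> is the upper one; elsewhere it has no meaning.
\<close>

record diagram =
  traj :: "real \<Rightarrow> complex"
  over :: "real \<Rightarrow> bool"

definition net :: "diagram \<Rightarrow> real \<Rightarrow> rp2" where
  "net D s = abs_rp (traj D s)"

text \<open>
  The net is generically immersed: it is transverse to the line at infinity (the equator \<open>w = 0\<close> of the
  sphere), and its multiple points are transverse double points away from that line.
\<close>

definition generic_immersion :: "diagram \<Rightarrow> bool" where
  "generic_immersion D \<longleftrightarrow>
     (\<exists>c. immersed_lift c (net D) \<and>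
        (\<forall>s. norm (traj D s) = 1 \<longrightarrow> snd (vector_derivative c (at s)) \<noteq> 0) \<and>
        (\<forall>s t. net D s = net D t \<and> s - t \<notin> \<int> \<longrightarrow>
            norm (traj D s) < 1 \<and>
            \<not> collinear {0, vector_derivative c (at s), vector_derivative c (at t)})) \<and>
     (\<forall>r s t. net D r = net D s \<and> net D s = net D t \<longrightarrow> r - s \<in> \<int> \<or> s - t \<in> \<int> \<or> r - t \<in> \<int>)"

definition crossing :: "diagram \<Rightarrow> complex \<Rightarrow> bool" where
  "crossing D X \<longleftrightarrow> (\<exists>s t. s - t \<notin> \<int> \<and> traj D s = X \<and> traj D t = X)"

definition based_oriented_diagram :: "diagram \<Rightarrow> bool" where
  "based_oriented_diagram D \<longleftrightarrow>
     (\<forall>s. norm (traj D s) \<le> 1 \<and> traj D (s + 1) = traj D s \<and> over D (s + 1) = over D s) \<and>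
     generic_immersion D \<and>
     (\<forall>s t. s - t \<notin> \<int> \<and> traj D s = traj D t \<longrightarrow> over D s \<noteq> over D t) \<and>
     norm (traj D 0) < 1 \<and> \<not> crossing D (traj D 0)"

text \<open>
  Here \<open>g\<close> is a journey along the preimage of the knot in the ball, avoiding the poles.
\<close>

definition is_diagram_of :: "diagram \<Rightarrow> rp3 set \<Rightarrow> bool" where
  "is_diagram_of D K \<longleftrightarrow> based_oriented_diagram D \<and>
     (\<exists>g. (\<forall>s. g s \<in> cball 0 1 - {north, south} \<and> traj D s = proj (g s)) \<and>
        knot_param (\<lambda>s. abs_rp (g s)) \<and> K = range (\<lambda>s. abs_rp (g s)) \<and>
        (\<forall>s t. s - t \<notin> \<int> \<and> traj D s = traj D t \<longrightarrow>
           (over D s \<longleftrightarrow> dist (g s) north < dist (g t) north)))"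


section \<open>Descending diagrams\<close>

text \<open>
  Points of the diagram are given by times of the journey, so that the two branches at a crossing are
  distinguished. The distance is meant for times \<open>p \<le> q\<close> of interior points of arcs, less than one turn apart.
\<close>

definition arc_distance :: "diagram \<Rightarrow> real \<Rightarrow> real \<Rightarrow> nat" where
  "arc_distance D p q = card {t. p < t \<and> t < q \<and> norm (traj D t) = 1}"

text \<open>The time at which \<open>X\<close> is passed first when starting at time \<open>p\<close>.\<close>

definition first_pass :: "diagram \<Rightarrow> real \<Rightarrow> complex \<Rightarrow> real" where
  "first_pass D p X = (LEAST s. p \<le> s \<and> traj D s = X)"

definition descending :: "diagram \<Rightarrow> bool" where
  "descending D \<longleftrightarrow>
     (\<forall>X. crossing D X \<longrightarrow>
        (over D (first_pass D 0 X) \<longleftrightarrow> even (arc_distance D 0 (first_pass D 0 X))))"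

end

theory Submission
  imports Defs
begin

text \<open>
  Through \<open>cover\<close>, points of the projective space are pairs of opposite unit vectors \<open>((h, z), w)\<close>,
  so a knot is given up to scale by a closed curve \<open>c = ((h, z), w)\<close> of nonzero vectors
  with \<open>c (s + 1) = \<sigma> c s\<close>, \<open>\<sigma> = \<plusminus>1\<close>. Both poles of the ball represent the
  direction of the \<open>z\<close>-axis, and moving a point along the circle through the poles forgets \<open>z\<close>
  (\<open>proj_stereo\<close>). Thus the net is the shadow \<open>p = (h, w)\<close>, the line at infinity is \<open>w = 0\<close>,
  and a crossing is a relation \<open>p s = l p t\<close>. Passing from the sphere to the disk reverses the direction of
  height where \<open>w < 0\<close>, and \<open>w\<close> changes sign exactly when the line at infinity is crossed, so the
  parity in the definition of descending diagrams cancels: a diagram is descending iff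
  \<open>z s > l z t\<close> whenever \<open>p s = l p t\<close> with \<open>0 \<le> s < t < 1\<close>, the basepoint being at time \<open>0\<close>
  (\<open>descending_curve_of_descending_diagram\<close>).

  This condition is convex in \<open>z\<close>. Hence \<open>z\<close> may be replaced, by a linear homotopy, by any other
  height satisfying it. Parametrise the curve so that all crossings occur in the half \<open>[1/4, 3/4]\<close> of the
  time, the other half being the return to the basepoint. Then \<open>height \<sigma> s * norm (p s)\<close> is such a
  height, for an explicit function \<open>height \<sigma>\<close> whose absolute value decreases strictly on
  \<open>[1/4, 3/4]\<close> and increases strictly on the return. As scaling a vector by \<open>l\<close> scales \<open>norm (p s)\<close> by
  \<open>\<bar>l\<bar>\<close>, two times in the same half never give proportional vectors, whatever the shadow is. So the shadow
  may be deformed freely as long as the two halves do not meet.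

  The halves are kept apart by a cone. After a linear map putting the basepoint on the \<open>w\<close>-axis, a
  thin cone around that axis contains only a short embedded arc of the shadow, because the basepoint is not a
  crossing. The parametrisation is chosen so that this arc is the return half (\<open>separating_cone\<close>,
  \<open>isotopic_curves_cone_knot_reparametrised\<close>). From then on the condition is just that the shadow \<open>(X, Y)\<close> be inside
  the cone during the return and outside otherwise, crossing it transversally (\<open>cone_curve\<close>). Inside the cone the
  shadow can be pushed to the axis; outside of it \<open>X\<close> does not vanish and its winding around
  the axis can be undone, since the two halves are joined at a place where \<open>X = 0\<close>
  (\<open>isotopic_curves_to_real_cone_curve\<close>). The remaining shadows lie in a half-plane and form a convex set
  (\<open>cone_curve_convex\<close>). This leaves one knot for each \<open>\<sigma>\<close>, which is a planar circle for
  \<open>\<sigma> = 1\<close> and a projective line for \<open>\<sigma> = -1\<close> (\<open>unknot_cone_knot\<close>).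
\<close>

section \<open>Continuously differentiable maps\<close>

text \<open>
  The domains below have finite dimension, where continuity of the derivative is continuity in every fixed
  direction; the latter is preserved by the usual rules without any computation with operator norms.
\<close>

definition C1_on :: "'a::real_normed_vector set \<Rightarrow> ('a \<Rightarrow> 'b::real_normed_vector) \<Rightarrow> bool" where
  "C1_on S f \<longleftrightarrow> (\<exists>f'. (\<forall>x\<in>S. (f has_derivative f' x) (at x)) \<and> (\<forall>v. continuous_on S (\<lambda>x. f' x v)))"

lemma C1_onE:
  assumes "C1_on S f"
  obtains f' where "\<And>x. x \<in> S \<Longrightarrow> (f has_derivative f' x) (at x)" "\<And>v. continuous_on S (\<lambda>x. f' x v)"
  using assms unfolding C1_on_def by blast

lemma C1_onI:
  assumes "\<And>x. x \<in> S \<Longrightarrow> (f has_derivative f' x) (at x)" "\<And>v. continuous_on S (\<lambda>x. f' x v)"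
  shows "C1_on S f"
  using assms unfolding C1_on_def by blast

lemma C1_on_subset: "C1_on S f \<Longrightarrow> T \<subseteq> S \<Longrightarrow> C1_on T f"
  unfolding C1_on_def by (meson continuous_on_subset subsetD)

lemma C1_on_imp_continuous_on: "C1_on S f \<Longrightarrow> continuous_on S f"
  unfolding C1_on_def
  by (meson continuous_at_imp_continuous_on has_derivative_continuous)

lemma C1_on_cong:
  assumes "C1_on S f" "open S" "\<And>x. x \<in> S \<Longrightarrow> f x = g x"
  shows "C1_on S g"
proof -
  obtain f' where f': "\<And>x. x \<in> S \<Longrightarrow> (f has_derivative f' x) (at x)" "\<And>v. continuous_on S (\<lambda>x. f' x v)"
    using assms(1) by (rule C1_onE) blast
  show ?thesis
  proof (rule C1_onI)
    show "(g has_derivative f' x) (at x)" if "x \<in> S" for x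
      using has_derivative_transform_within_open[OF f'(1)[OF that] assms(2) that assms(3)] by simp
  qed (fact f')
qed

text \<open>
  Homotopies are glued, and functions on the circle are assembled from functions on intervals, along
  open covers.
\<close>

lemma C1_on_local:
  assumes "\<And>x. x \<in> S \<Longrightarrow> \<exists>U. open U \<and> x \<in> U \<and> C1_on U f"
  shows "C1_on S f"
proof (rule C1_onI)
  show "(f has_derivative frechet_derivative f (at x)) (at x)" if "x \<in> S" for x
    using assms[OF that] unfolding C1_on_def by (metis frechet_derivative_at)
  show "continuous_on S (\<lambda>x. frechet_derivative f (at x) v)" for v
  proof (rule continuous_at_imp_continuous_on, rule ballI)
    fix x assume "x \<in> S"
    then obtain U where U: "open U" "x \<in> U" "C1_on U f" using assms by blast
    obtain f' where f': "\<And>x. x \<in> U \<Longrightarrow> (f has_derivative f' x) (at x)" "\<And>v. continuous_on U (\<lambda>x. f' x v)"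
      using U(3) by (rule C1_onE) blast
    have "continuous_on U (\<lambda>x. frechet_derivative f (at x) v)"
      using f'(2)[of v] by (rule continuous_on_eq) (metis f'(1) frechet_derivative_at)
    then show "isCont (\<lambda>x. frechet_derivative f (at x) v) x"
      using U continuous_on_eq_continuous_at by blast
  qed
qed

named_theorems C1_intros

lemma C1_on_const [C1_intros]: "C1_on S (\<lambda>x. k)"
  by (rule C1_onI[where f'="\<lambda>x v. 0"]) auto

lemma C1_on_linear:
  assumes "bounded_linear L" "C1_on S f"
  shows "C1_on S (\<lambda>x. L (f x))"
proof -
  obtain f' where f': "\<And>x. x \<in> S \<Longrightarrow> (f has_derivative f' x) (at x)" "\<And>v. continuous_on S (\<lambda>x. f' x v)"
    using assms(2) by (rule C1_onE) blast
  show ?thesis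
    by (rule C1_onI[where f'="\<lambda>x v. L (f' x v)"])
      (auto intro: bounded_linear.has_derivative[OF assms(1)] f' bounded_linear.continuous_on[OF assms(1)])
qed

lemma C1_on_id [C1_intros]: "C1_on S (\<lambda>x. x)"
  by (rule C1_onI[where f'="\<lambda>x v. v"]) auto

lemmas C1_on_fst [C1_intros] = C1_on_linear[OF bounded_linear_fst]
lemmas C1_on_snd [C1_intros] = C1_on_linear[OF bounded_linear_snd]
lemmas C1_on_of_real [C1_intros] = C1_on_linear[OF bounded_linear_of_real]
lemmas C1_on_minus [C1_intros] = C1_on_linear[OF bounded_linear_minus[OF bounded_linear_ident]]

lemma C1_on_add [C1_intros]:
  assumes "C1_on S f" "C1_on S g"
  shows "C1_on S (\<lambda>x. f x + g x)"
proof -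
  obtain f' where f': "\<And>x. x \<in> S \<Longrightarrow> (f has_derivative f' x) (at x)" "\<And>v. continuous_on S (\<lambda>x. f' x v)"
    using assms(1) by (rule C1_onE) blast
  obtain g' where g': "\<And>x. x \<in> S \<Longrightarrow> (g has_derivative g' x) (at x)" "\<And>v. continuous_on S (\<lambda>x. g' x v)"
    using assms(2) by (rule C1_onE) blast
  show ?thesis
    by (rule C1_onI[where f'="\<lambda>x v. f' x v + g' x v"]) (auto intro!: derivative_intros continuous_intros f' g')
qed

lemma C1_on_diff [C1_intros]:
  assumes "C1_on S f" "C1_on S g"
  shows "C1_on S (\<lambda>x. f x - g x)"
  using C1_on_add[OF assms(1) C1_on_minus[OF assms(2)]] by simp

lemma C1_on_Pair [C1_intros]:
  assumes "C1_on S f" "C1_on S g"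
  shows "C1_on S (\<lambda>x. (f x, g x))"
proof -
  obtain f' where f': "\<And>x. x \<in> S \<Longrightarrow> (f has_derivative f' x) (at x)" "\<And>v. continuous_on S (\<lambda>x. f' x v)"
    using assms(1) by (rule C1_onE) blast
  obtain g' where g': "\<And>x. x \<in> S \<Longrightarrow> (g has_derivative g' x) (at x)" "\<And>v. continuous_on S (\<lambda>x. g' x v)"
    using assms(2) by (rule C1_onE) blast
  show ?thesis
    by (rule C1_onI[where f'="\<lambda>x v. (f' x v, g' x v)"])
      (auto intro!: has_derivative_Pair continuous_intros f' g')
qed

lemma C1_on_bilinear:
  assumes "bounded_bilinear B" "C1_on S f" "C1_on S g"
  shows "C1_on S (\<lambda>x. B (f x) (g x))"
proof -
  interpret bounded_bilinear B by fact
  obtain f' where f': "\<And>x. x \<in> S \<Longrightarrow> (f has_derivative f' x) (at x)" "\<And>v. continuous_on S (\<lambda>x. f' x v)"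
    using assms(2) by (rule C1_onE) blast
  obtain g' where g': "\<And>x. x \<in> S \<Longrightarrow> (g has_derivative g' x) (at x)" "\<And>v. continuous_on S (\<lambda>x. g' x v)"
    using assms(3) by (rule C1_onE) blast
  show ?thesis
    by (rule C1_onI[where f'="\<lambda>x v. B (f x) (g' x v) + B (f' x v) (g x)"])
      (auto intro!: FDERIV continuous_on continuous_intros f' g'
         C1_on_imp_continuous_on[OF assms(2)] C1_on_imp_continuous_on[OF assms(3)])
qed

lemmas C1_on_mult [C1_intros] = C1_on_bilinear[OF bounded_bilinear_mult]
lemmas C1_on_scaleR [C1_intros] = C1_on_bilinear[OF bounded_bilinear_scaleR]
lemmas C1_on_inner [C1_intros] = C1_on_bilinear[OF bounded_bilinear_inner]

lemma C1_on_realI: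
  fixes f :: "real \<Rightarrow> 'b::real_normed_vector"
  assumes "\<And>x. x \<in> S \<Longrightarrow> (f has_vector_derivative f' x) (at x)" "continuous_on S f'"
  shows "C1_on S f"
  by (rule C1_onI[where f'="\<lambda>x v. v *\<^sub>R f' x"])
    (use assms in \<open>auto simp: has_vector_derivative_def intro!: continuous_intros\<close>)

lemma C1_on_realE:
  fixes f :: "real \<Rightarrow> 'b::real_normed_vector"
  assumes "C1_on S f"
  obtains f' where "\<And>x. x \<in> S \<Longrightarrow> (f has_vector_derivative f' x) (at x)" "continuous_on S f'"
proof -
  obtain f' where f': "\<And>x. x \<in> S \<Longrightarrow> (f has_derivative f' x) (at x)" "\<And>v. continuous_on S (\<lambda>x. f' x v)"
    using assms by (rule C1_onE) blast
  have "(f has_vector_derivative f' x 1) (at x)" if "x \<in> S" for x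
  proof -
    interpret linear "f' x" using f'(1)[OF that] has_derivative_linear by blast
    have "f' x = (\<lambda>h. h *\<^sub>R f' x 1)"
    proof
      show "f' x h = h *\<^sub>R f' x 1" for h using scale[of h 1] by simp
    qed
    then show ?thesis using f'(1)[OF that] unfolding has_vector_derivative_def by simp
  qed
  then show ?thesis by (rule that) (use f'(2) in auto)
qed

lemma C1_on_compose:
  fixes f :: "real \<Rightarrow> 'b::real_normed_vector"
  assumes "C1_on T f" "C1_on S g" "g ` S \<subseteq> T"
  shows "C1_on S (\<lambda>x. f (g x))"
proof -
  obtain f' where f': "\<And>x. x \<in> T \<Longrightarrow> (f has_vector_derivative f' x) (at x)" "continuous_on T f'"
    using assms(1) by (rule C1_on_realE) blast
  obtain g' where g': "\<And>x. x \<in> S \<Longrightarrow> (g has_derivative g' x) (at x)" "\<And>v. continuous_on S (\<lambda>x. g' x v)"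
    using assms(2) by (rule C1_onE) blast
  show ?thesis
  proof (rule C1_onI[where f'="\<lambda>x v. g' x v *\<^sub>R f' (g x)"])
    show "((\<lambda>x. f (g x)) has_derivative (\<lambda>v. g' x v *\<^sub>R f' (g x))) (at x)" if "x \<in> S" for x
      using has_derivative_compose[OF g'(1)[OF that], of f "\<lambda>v. v *\<^sub>R f' (g x)"] f'(1)[of "g x"] that assms(3)
      unfolding has_vector_derivative_def by auto
    have "continuous_on S (\<lambda>x. f' (g x))"
      using continuous_on_compose2[OF f'(2) C1_on_imp_continuous_on[OF assms(2)] assms(3)] .
    then show "continuous_on S (\<lambda>x. g' x v *\<^sub>R f' (g x))" for v
      by (intro continuous_intros g')
  qed
qed

lemma C1_compose:
  fixes f :: "real \<Rightarrow> 'b::real_normed_vector"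
  assumes "C1_on UNIV f" "C1_on S g"
  shows "C1_on S (\<lambda>x. f (g x))"
  using C1_on_compose[OF assms] by simp

text \<open>
  The derivative of \<open>f\<close> is expanded in a basis, because it is only known to be continuous in fixed directions.
\<close>

lemma C1_on_compose_any:
  fixes f :: "'b::euclidean_space \<Rightarrow> 'c::real_normed_vector"
  assumes "C1_on UNIV f" "C1_on S g"
  shows "C1_on S (\<lambda>x. f (g x))"
proof -
  obtain f' where f': "\<And>x. (f has_derivative f' x) (at x)" "\<And>v. continuous_on UNIV (\<lambda>x. f' x v)"
    using assms(1) by (rule C1_onE) auto
  obtain g' where g': "\<And>x. x \<in> S \<Longrightarrow> (g has_derivative g' x) (at x)" "\<And>v. continuous_on S (\<lambda>x. g' x v)"
    using assms(2) by (rule C1_onE) blast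
  show ?thesis
  proof (rule C1_onI[where f'="\<lambda>x v. f' (g x) (g' x v)"])
    show "((\<lambda>x. f (g x)) has_derivative (\<lambda>v. f' (g x) (g' x v))) (at x)" if "x \<in> S" for x
      using has_derivative_compose[OF g'(1)[OF that] f'(1)] .
    have "f' (g x) (g' x v) = (\<Sum>b\<in>Basis. (g' x v \<bullet> b) *\<^sub>R f' (g x) b)" for x v
    proof -
      interpret linear "f' (g x)" using f'(1) has_derivative_linear by blast
      have "f' (g x) (g' x v) = f' (g x) (\<Sum>b\<in>Basis. (g' x v \<bullet> b) *\<^sub>R b)"
        by (simp only: euclidean_representation)
      then show ?thesis by (simp add: sum scale)
    qed
    moreover have "continuous_on S (\<lambda>x. f' (g x) b)" for b
      using continuous_on_compose2[OF f'(2) C1_on_imp_continuous_on[OF assms(2)]] by simp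
    ultimately show "continuous_on S (\<lambda>x. f' (g x) (g' x v))" for v
      by (simp only:) (intro continuous_intros g')
  qed
qed

lemma C1_real_functions: "C1_on UNIV (sin :: real \<Rightarrow> real)" "C1_on UNIV (cos :: real \<Rightarrow> real)" "C1_on UNIV cis"
  "C1_on UNIV arctan"
  "C1_on {0<..} sqrt" "C1_on (-{0}) (inverse :: real \<Rightarrow> real)"
proof -
  show "C1_on UNIV (sin :: real \<Rightarrow> real)"
    by (rule C1_on_realI[where f'=cos]) (auto intro!: continuous_intros derivative_eq_intros
        simp: has_real_derivative_iff_has_vector_derivative[symmetric])
  show "C1_on UNIV (cos :: real \<Rightarrow> real)"
    by (rule C1_on_realI[where f'="\<lambda>x. - sin x"]) (auto intro!: continuous_intros derivative_eq_intros
        simp: has_real_derivative_iff_has_vector_derivative[symmetric])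
  show "C1_on UNIV arctan"
    by (rule C1_on_realI[where f'="\<lambda>x. 1 / (1 + x\<^sup>2)"]) (auto intro!: continuous_intros derivative_eq_intros
        simp: has_real_derivative_iff_has_vector_derivative[symmetric] divide_inverse add_nonneg_eq_0_iff)
  show "C1_on {0<..} sqrt"
    by (rule C1_on_realI[where f'="\<lambda>x. inverse (sqrt x) / 2"]) (auto intro!: continuous_intros derivative_eq_intros
        simp: has_real_derivative_iff_has_vector_derivative[symmetric])
  show "C1_on (-{0}) (inverse :: real \<Rightarrow> real)"
    by (rule C1_on_realI[where f'="\<lambda>x. - (inverse x * inverse x)"]) (auto intro!: continuous_intros derivative_eq_intros
        simp: has_real_derivative_iff_has_vector_derivative[symmetric])
  show "C1_on UNIV cis"
    by (rule C1_on_realI[where f'="\<lambda>x. \<i> * cis x"])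
      (auto intro!: continuous_intros derivative_eq_intros simp: has_vector_derivative_def)
qed

lemmas C1_on_sin [C1_intros] = C1_compose[OF C1_real_functions(1)]
lemmas C1_on_cos [C1_intros] = C1_compose[OF C1_real_functions(2)]
lemmas C1_on_cis [C1_intros] = C1_compose[OF C1_real_functions(3)]
lemmas C1_on_arctan [C1_intros] = C1_compose[OF C1_real_functions(4)]

lemma C1_on_sqrt [C1_intros]:
  "C1_on S f \<Longrightarrow> (\<And>x. x \<in> S \<Longrightarrow> f x > 0) \<Longrightarrow> C1_on S (\<lambda>x. sqrt (f x))"
  by (rule C1_on_compose[OF C1_real_functions(5)]) auto

lemma C1_on_inverse [C1_intros]:
  fixes f :: "'a::real_normed_vector \<Rightarrow> real"
  shows "C1_on S f \<Longrightarrow> (\<And>x. x \<in> S \<Longrightarrow> f x \<noteq> 0) \<Longrightarrow> C1_on S (\<lambda>x. inverse (f x))"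
  by (rule C1_on_compose[OF C1_real_functions(6)]) auto

lemma C1_on_divide [C1_intros]:
  fixes f :: "'a::real_normed_vector \<Rightarrow> real"
  shows "C1_on S f \<Longrightarrow> C1_on S g \<Longrightarrow> (\<And>x. x \<in> S \<Longrightarrow> g x \<noteq> 0) \<Longrightarrow> C1_on S (\<lambda>x. f x / g x)"
  unfolding divide_inverse by (intro C1_intros)

lemma C1_on_norm [C1_intros]:
  fixes f :: "'a::real_normed_vector \<Rightarrow> 'b::real_inner"
  shows "C1_on S f \<Longrightarrow> (\<And>x. x \<in> S \<Longrightarrow> f x \<noteq> 0) \<Longrightarrow> C1_on S (\<lambda>x. norm (f x))"
  unfolding norm_eq_sqrt_inner by (intro C1_intros) auto

lemma C1_positive_part_square: "C1_on UNIV (\<lambda>t::real. (max 0 t)\<^sup>2)"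
proof (rule C1_on_realI[where f'="\<lambda>t. 2 * max 0 t"])
  fix t :: real
  consider "t < 0" | "t > 0" | "t = 0" by linarith
  then have "((\<lambda>t. (max 0 t)\<^sup>2) has_real_derivative 2 * max 0 t) (at t)"
  proof cases
    case 1
    have "((\<lambda>t::real. 0) has_real_derivative 2 * max 0 t) (at t)" using 1 by simp
    then show ?thesis
      by (rule has_field_derivative_transform_within_open[where S="{..<0}"]) (use 1 in auto)
  next
    case 2
    have "((\<lambda>t::real. t\<^sup>2) has_real_derivative 2 * max 0 t) (at t)"
      using 2 by (auto intro!: derivative_eq_intros)
    then show ?thesis
      by (rule has_field_derivative_transform_within_open[where S="{0<..}"]) (use 2 in auto)
  next
    case 3
    have "((\<lambda>h::real. max 0 h) \<longlongrightarrow> 0) (at 0)" by (auto intro!: tendsto_eq_intros)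
    moreover have "\<forall>\<^sub>F h::real in at 0. max 0 h = (max 0 h)\<^sup>2 / h"
      by (rule always_eventually) (auto simp: max_def power2_eq_square)
    ultimately have "((\<lambda>h::real. (max 0 h)\<^sup>2 / h) \<longlongrightarrow> 0) (at 0)"
      by (rule Lim_transform_eventually)
    then show ?thesis using 3 by (simp add: DERIV_def)
  qed
  then show "((\<lambda>t. (max 0 t)\<^sup>2) has_vector_derivative 2 * max 0 t) (at t)"
    by (simp add: has_real_derivative_iff_has_vector_derivative)
qed (intro continuous_intros)

text \<open>
  Composing the time of a homotopy with this function makes the homotopy stationary near both ends, so
  that homotopies can be concatenated without loss of differentiability. It also supplies cut-off functions.
\<close>

definition step :: "real \<Rightarrow> real" where
  "step t = (max 0 t)\<^sup>2 / ((max 0 t)\<^sup>2 + (max 0 (1 - t))\<^sup>2)"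

lemma step_denominator_pos: "(max 0 t)\<^sup>2 + (max 0 (1 - t))\<^sup>2 > (0::real)"
proof (cases "t > 0")
  case True
  then have "(max 0 t)\<^sup>2 > 0" by simp
  then show ?thesis by (rule add_pos_nonneg) simp
next
  case False
  then have "(max 0 (1 - t))\<^sup>2 > 0" by simp
  then show ?thesis by (intro add_nonneg_pos) simp
qed

lemma step_simps [simp]: "t \<le> 0 \<Longrightarrow> step t = 0" "t \<ge> 1 \<Longrightarrow> step t = 1"
  by (auto simp: step_def)

lemma step_bounds [simp]: "0 \<le> step t" "step t \<le> 1"
  using step_denominator_pos[of t] by (auto simp: step_def divide_simps)

lemma C1_step: "C1_on UNIV step"
proof -
  have a: "C1_on UNIV (\<lambda>t::real. (max 0 (1 - t))\<^sup>2)"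
    by (rule C1_compose[OF C1_positive_part_square]) (intro C1_intros)
  show ?thesis unfolding step_def[abs_def]
    by (rule C1_on_divide) (intro C1_on_add C1_positive_part_square a | use step_denominator_pos in \<open>simp add: less_imp_neq[symmetric]\<close>)+
qed

lemmas C1_on_step [C1_intros] = C1_compose[OF C1_step]

section \<open>Knots and isotopies in homogeneous coordinates\<close>

type_synonym r4 = "(complex \<times> real) \<times> real"

lemma abs_rp_eq_iff: 
  assumes "norm x \<le> 1" "norm y \<le> 1" 
  shows "abs_rp x = abs_rp y \<longleftrightarrow> x = y \<or> norm x = 1 \<and> y = - x"
proof -
  have "antipodal x x" "antipodal y y" using assms by (auto simp: antipodal_def)
  then have "abs_rp x = abs_rp y \<longleftrightarrow> antipodal x y"
    using Quotient3_rel[OF Quotient3_rp] by blast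
  then show ?thesis using assms by (auto simp: antipodal_def)
qed

text \<open>
  The representative of the class \<open>cover x\<close> in the ball. Equalities of classes are thus reduced to
  equalities of vectors.
\<close>

definition stereo :: "'a::real_normed_vector \<times> real \<Rightarrow> 'a" where
  "stereo x = (if snd x \<ge> 0 then fst x /\<^sub>R (1 + snd x) else - fst x /\<^sub>R (1 - snd x))"

lemma cover_eq: "cover x = abs_rp (stereo x)"
  by (cases x) (auto simp: cover_def stereo_def)

lemma norm_stereo_power2:
  fixes x :: "'a::real_normed_vector \<times> real"
  assumes "norm x = 1" 
  shows "(norm (stereo x))\<^sup>2 = (1 - \<bar>snd x\<bar>) / (1 + \<bar>snd x\<bar>)"
proof -
  obtain v w where x: "x = (v, w)" by (cases x)
  have n: "(norm v)\<^sup>2 = (1 - w) * (1 + w)"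
    using assms by (simp add: x norm_Pair power2_eq_square algebra_simps)
  have "(norm (stereo x))\<^sup>2 = (norm v)\<^sup>2 / (1 + \<bar>w\<bar>)\<^sup>2"
    by (auto simp: x stereo_def power_divide divide_inverse power_mult_distrib power_inverse mult.commute)
  also have "\<dots> = (1 - \<bar>w\<bar>) / (1 + \<bar>w\<bar>)"
    unfolding n by (auto simp: abs_if power2_eq_square divide_simps)
  finally show ?thesis by (simp add: x)
qed

lemma norm_stereo_le: 
  fixes x :: "'a::real_normed_vector \<times> real"
  assumes "norm x = 1" shows "norm (stereo x) \<le> 1"
proof (rule power2_le_imp_le)
  show "(norm (stereo x))\<^sup>2 \<le> 1\<^sup>2" unfolding norm_stereo_power2[OF assms] by simp
qed simp

lemma norm_stereo_eq_1: 
  fixes x :: "'a::real_normed_vector \<times> real"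
  assumes "norm x = 1" shows "norm (stereo x) = 1 \<longleftrightarrow> snd x = 0"
proof -
  have "norm (stereo x) = 1 \<longleftrightarrow> (norm (stereo x))\<^sup>2 = 1"
    by (metis norm_ge_zero one_power2 power2_eq_imp_eq zero_le_one)
  also have "\<dots> \<longleftrightarrow> snd x = 0" unfolding norm_stereo_power2[OF assms]
    by (auto simp: divide_simps abs_if)
  finally show ?thesis .
qed

text \<open>
  Stereographic projection is inverted up to the height of the point, which
  \<open>norm_stereo_power2\<close> determines up to sign.
\<close>

lemma fst_eq_stereo:
  "fst x = (if snd x \<ge> 0 then 1 + \<bar>snd x\<bar> else - (1 + \<bar>snd x\<bar>)) *\<^sub>R stereo x"
proof (cases "snd x \<ge> 0")
  case False
  then have "(snd x - 1) * inverse (1 - snd x) = - 1" by (simp add: field_simps)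
  then show ?thesis using False by (simp add: stereo_def)
qed (simp add: stereo_def)

lemma cover_eq_iff:
  fixes x y :: "'a::real_normed_vector \<times> real"
  assumes "norm x = 1" "norm y = 1"
  shows "cover x = cover y \<longleftrightarrow> x = y \<or> x = - y"
proof
  assume "cover x = cover y"
  then have *: "stereo x = stereo y \<or> snd x = 0 \<and> stereo y = - stereo x"
    using assms by (simp add: cover_eq abs_rp_eq_iff norm_stereo_le norm_stereo_eq_1)
  then have "norm (stereo x) = norm (stereo y)" by (metis norm_minus_cancel)
  then have "(1 - \<bar>snd x\<bar>) / (1 + \<bar>snd x\<bar>) = (1 - \<bar>snd y\<bar>) / (1 + \<bar>snd y\<bar>)"
    using norm_stereo_power2[OF assms(1)] norm_stereo_power2[OF assms(2)] by metis
  moreover have "1 + \<bar>snd x\<bar> > 0" "1 + \<bar>snd y\<bar> > 0" by auto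
  ultimately have eq: "\<bar>snd x\<bar> = \<bar>snd y\<bar>"
    by (simp add: divide_simps algebra_simps split: if_splits)
  show "x = y \<or> x = - y"
  proof (cases "stereo x = stereo y")
    case True
    consider "snd x \<ge> 0 \<longleftrightarrow> snd y \<ge> 0" | "snd x \<ge> 0" "\<not> snd y \<ge> 0" | "\<not> snd x \<ge> 0" "snd y \<ge> 0" by blast
    then show ?thesis
    proof cases
      case 1
      then have "snd x = snd y" using eq by (simp add: abs_if split: if_splits)
      moreover from this have "fst x = fst y" using fst_eq_stereo[of x] fst_eq_stereo[of y] True by simp
      ultimately show ?thesis by (simp add: prod_eq_iff)
    next
      case 2
      then have "snd x = - snd y" using eq by simp
      moreover have "fst x = - fst y" unfolding fst_eq_stereo[of x] fst_eq_stereo[of y] True eq using 2 by (simp add: algebra_simps)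
      ultimately show ?thesis by (simp add: prod_eq_iff)
    next
      case 3
      then have "snd x = - snd y" using eq by simp
      moreover have "fst x = - fst y" unfolding fst_eq_stereo[of x] fst_eq_stereo[of y] True eq using 3 by (simp add: algebra_simps)
      ultimately show ?thesis by (simp add: prod_eq_iff)
    qed
  next
    case False
    then have "snd x = 0" "stereo y = - stereo x" using * by auto
    moreover from this have "snd y = 0" using eq by simp
    ultimately show ?thesis using fst_eq_stereo[of x] fst_eq_stereo[of y] by (simp add: prod_eq_iff)
  qed
next
  assume a: "x = y \<or> x = - y"
  have "stereo x = stereo (- x) \<or> snd x = 0 \<and> stereo (- x) = - stereo x"
    by (simp add: stereo_def)
  then have "cover x = cover (- x)"
    using assms by (simp add: cover_eq abs_rp_eq_iff norm_stereo_le norm_stereo_eq_1)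
  then show "cover x = cover y" using a by (metis minus_minus)
qed

text \<open>
  Knots in homogeneous coordinates. Values at different times are not proportional, so the curve of
  lines is injective, and the derivative is not proportional to the value, so it is immersed. The factor
  \<open>\<sigma>\<close>, which is \<open>1\<close> or \<open>-1\<close>, is the homology class of the knot.
\<close>

definition embedded_curve :: "real \<Rightarrow> (real \<Rightarrow> 'a::real_normed_vector) \<Rightarrow> bool" where
  "embedded_curve \<sigma> c \<longleftrightarrow> C1_on UNIV c \<and> (\<forall>s. c (s + 1) = \<sigma> *\<^sub>R c s) \<and> (\<forall>s. c s \<noteq> 0) \<and>
     (\<forall>s t l. c s = l *\<^sub>R c t \<longrightarrow> s - t \<in> \<int>) \<and>
     (\<forall>s v l. (c has_vector_derivative v) (at s) \<longrightarrow> v \<noteq> l *\<^sub>R c s)"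

lemma embedded_curveD:
  assumes "embedded_curve \<sigma> c"
  shows "C1_on UNIV c" "c (s + 1) = \<sigma> *\<^sub>R c s" "c s \<noteq> 0"
    "c s = l *\<^sub>R c t \<Longrightarrow> s - t \<in> \<int>"
    "(c has_vector_derivative v) (at s) \<Longrightarrow> v \<noteq> l *\<^sub>R c s"
proof -
  have 1: "C1_on UNIV c" and 2: "\<forall>s. c (s + 1) = \<sigma> *\<^sub>R c s" and 3: "\<forall>s. c s \<noteq> 0"
    and 4: "\<forall>s t l. c s = l *\<^sub>R c t \<longrightarrow> s - t \<in> \<int>"
    and 5: "\<forall>s v l. (c has_vector_derivative v) (at s) \<longrightarrow> v \<noteq> l *\<^sub>R c s"
    using assms unfolding embedded_curve_def by simp_all
  show "C1_on UNIV c" by (rule 1)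
  show "c (s + 1) = \<sigma> *\<^sub>R c s" by (rule 2[rule_format])
  show "c s \<noteq> 0" by (rule 3[rule_format])
  show "c s = l *\<^sub>R c t \<Longrightarrow> s - t \<in> \<int>" by (rule 4[rule_format])
  show "(c has_vector_derivative v) (at s) \<Longrightarrow> v \<noteq> l *\<^sub>R c s" by (rule 5[rule_format])
qed

definition knot_of :: "(real \<Rightarrow> r4) \<Rightarrow> rp3 set" where
  "knot_of c = range (\<lambda>s. cover (sgn (c s)))"

lemma shift_by_int:
  fixes c :: "real \<Rightarrow> 'a::real_vector"
  assumes "\<And>s. c (s + 1) = \<sigma> *\<^sub>R c s" "\<bar>\<sigma>\<bar> = 1"
  shows "\<exists>e\<in>{1,-1}. \<forall>s. c (s + of_int k) = e *\<^sub>R c s"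
proof (induction k rule: int_induct[where k=0])
  case base
  then show ?case by (intro bexI[of _ 1]) auto
next
  case (step1 i)
  then obtain e where e: "e \<in> {1,-1}" "\<And>s. c (s + of_int i) = e *\<^sub>R c s" by blast
  have "c (s + of_int (i + 1)) = (\<sigma> * e) *\<^sub>R c s" for s
    using assms(1)[of "s + of_int i"] by (simp add: e algebra_simps)
  then show ?case by (intro bexI[of _ "\<sigma> * e"]) (use e assms(2) in auto)
next
  case (step2 i)
  then obtain e where e: "e \<in> {1,-1}" "\<And>s. c (s + of_int i) = e *\<^sub>R c s" by blast
  have "c (s + of_int (i - 1)) = (\<sigma> * e) *\<^sub>R c s" for s
  proof -
    have "\<sigma> * \<sigma> = 1" using assms(2) by (metis abs_mult_self_eq mult_1)
    moreover have "e *\<^sub>R c s = \<sigma> *\<^sub>R c (s + of_int (i - 1))"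
      using assms(1)[of "s + of_int (i - 1)"] e(2)[of s] by (simp add: algebra_simps)
    ultimately show ?thesis by (metis scaleR_scaleR scaleR_one)
  qed
  then show ?case by (intro bexI[of _ "\<sigma> * e"]) (use e assms(2) in auto)
qed

text \<open>
  The normalised curve is a lift to the sphere. Its derivative cannot vanish: writing the curve as its norm times the
  normalised curve, its derivative would be a multiple of its value.
\<close>

lemma knot_param_of_embedded_curve:
  fixes c :: "real \<Rightarrow> r4"
  assumes c: "embedded_curve \<sigma> c" and \<sigma>: "\<bar>\<sigma>\<bar> = 1"
  shows "knot_param (\<lambda>s. cover (sgn (c s)))"
proof -
  note C1 = embedded_curveD(1)[OF c] and per = embedded_curveD(2)[OF c] and nz = embedded_curveD(3)[OF c]
    and inj = embedded_curveD(4)[OF c] and imm = embedded_curveD(5)[OF c]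
  have n1: "norm (sgn (c s)) = 1" for s using nz by (simp add: norm_sgn)
  have C1n: "C1_on UNIV (\<lambda>s. norm (c s))"
    by (intro C1_intros C1 nz)
  have C1s: "C1_on UNIV (\<lambda>s. sgn (c s))"
    unfolding sgn_div_norm by (intro C1_intros C1 C1n) (use nz in auto)
  obtain n' where n': "\<And>s. ((\<lambda>s. norm (c s)) has_vector_derivative n' s) (at s)"
    using C1n by (rule C1_on_realE) auto
  obtain e' where e': "\<And>s. ((\<lambda>s. sgn (c s)) has_vector_derivative e' s) (at s)" "continuous_on UNIV e'"
    using C1s by (rule C1_on_realE) auto
  have e'nz: "e' s \<noteq> 0" for s
  proof
    assume "e' s = 0"
    then have z: "((\<lambda>s. sgn (c s)) has_vector_derivative 0) (at s)" using e'(1)[of s] by simp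
    have "((\<lambda>s. norm (c s) *\<^sub>R sgn (c s)) has_vector_derivative
        norm (c s) *\<^sub>R 0 + n' s *\<^sub>R sgn (c s)) (at s)"
      by (rule has_vector_derivative_scaleR[OF _ z])
        (use n' in \<open>simp add: has_real_derivative_iff_has_vector_derivative\<close>)
    moreover have "(\<lambda>s. norm (c s) *\<^sub>R sgn (c s)) = c"
      using nz by (simp add: sgn_div_norm fun_eq_iff)
    moreover have "norm (c s) *\<^sub>R 0 + n' s *\<^sub>R sgn (c s) = (n' s / norm (c s)) *\<^sub>R c s"
      by (simp add: sgn_div_norm divide_inverse)
    ultimately show False using imm by metis
  qed
  have "immersed_lift (\<lambda>s. sgn (c s)) (\<lambda>s. cover (sgn (c s)))"
    unfolding immersed_lift_def C1_differentiable_on_def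
    using n1 e' e'nz vector_derivative_at[OF e'(1)] by auto
  moreover have "cover (sgn (c s)) = cover (sgn (c t)) \<longleftrightarrow> s - t \<in> \<int>" for s t
  proof
    assume "cover (sgn (c s)) = cover (sgn (c t))"
    then have "sgn (c s) = 1 *\<^sub>R sgn (c t) \<or> sgn (c s) = (- 1) *\<^sub>R sgn (c t)" using cover_eq_iff[OF n1 n1] by simp
    then obtain e where "sgn (c s) = e *\<^sub>R sgn (c t)" by blast
    then have "norm (c s) *\<^sub>R sgn (c s) = (norm (c s) * e) *\<^sub>R sgn (c t)" by simp
    then have "c s = (norm (c s) * e / norm (c t)) *\<^sub>R c t"
      using nz[of s] by (simp add: sgn_div_norm divide_inverse)
    then show "s - t \<in> \<int>" by (rule inj)
  next
    assume "s - t \<in> \<int>"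
    then obtain k where k: "s = t + of_int k" by (metis Ints_cases add.commute diff_add_cancel)
    obtain e where e: "e \<in> {1,-1}" "\<forall>s. c (s + of_int k) = e *\<^sub>R c s"
      using shift_by_int[where c=c, OF per \<sigma>, of k] by blast
    then have "c s = e *\<^sub>R c t" using k by simp
    then have "sgn (c s) = sgn (c t) \<or> sgn (c s) = - sgn (c t)" using e(1) by (auto simp: sgn_minus)
    then show "cover (sgn (c s)) = cover (sgn (c t))" by (simp add: cover_eq_iff[OF n1 n1])
  qed
  ultimately show ?thesis unfolding knot_param_def by blast
qed

text \<open>
  Isotopies in homogeneous coordinates; being constant before time \<open>0\<close> and after time \<open>1\<close>
  makes this relation transitive.
\<close>

definition isotopic_curves :: "real \<Rightarrow> (real \<Rightarrow> r4) \<Rightarrow> (real \<Rightarrow> r4) \<Rightarrow> bool" where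
  "isotopic_curves \<sigma> c d \<longleftrightarrow> (\<exists>H::real \<times> real \<Rightarrow> r4. C1_on UNIV H \<and>
     (\<forall>t. embedded_curve \<sigma> (\<lambda>s. H (s, t))) \<and>
     (\<forall>s t. t \<le> 0 \<longrightarrow> H (s, t) = c s) \<and> (\<forall>s t. t \<ge> 1 \<longrightarrow> H (s, t) = d s))"

lemma isotopic_curvesI:
  assumes "C1_on UNIV (\<lambda>x. K (fst x) (step (snd x)))"
    and "\<And>u. 0 \<le> u \<Longrightarrow> u \<le> 1 \<Longrightarrow> embedded_curve \<sigma> (\<lambda>s. K s u)"
    and "\<And>s. K s 0 = c s" "\<And>s. K s 1 = d s"
  shows "isotopic_curves \<sigma> c d"
  unfolding isotopic_curves_def
proof (intro exI conjI allI impI)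
  show "C1_on UNIV (\<lambda>x. K (fst x) (step (snd x)))" by (rule assms(1))
qed (simp_all add: assms)

lemma isotopic_curvesE:
  assumes "isotopic_curves \<sigma> c d"
  obtains H :: "real \<times> real \<Rightarrow> r4" where "C1_on UNIV H" "\<And>t. embedded_curve \<sigma> (\<lambda>s. H (s, t))"
     "\<And>s t. t \<le> 0 \<Longrightarrow> H (s, t) = c s" "\<And>s t. t \<ge> 1 \<Longrightarrow> H (s, t) = d s"
proof -
  from assms obtain H :: "real \<times> real \<Rightarrow> r4" where H: "C1_on UNIV H \<and> (\<forall>t. embedded_curve \<sigma> (\<lambda>s. H (s, t))) \<and>
     (\<forall>s t. t \<le> 0 \<longrightarrow> H (s, t) = c s) \<and> (\<forall>s t. t \<ge> 1 \<longrightarrow> H (s, t) = d s)"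
    unfolding isotopic_curves_def by (elim exE)
  show thesis by (rule that[of H]) (simp_all add: H)
qed

lemma isotopic_curves_trans:
  assumes "isotopic_curves \<sigma> c d" "isotopic_curves \<sigma> d e"
  shows "isotopic_curves \<sigma> c e"
proof -
  obtain H :: "real \<times> real \<Rightarrow> r4" where H: "C1_on UNIV H" "\<And>t. embedded_curve \<sigma> (\<lambda>s. H (s, t))"
     "\<And>s t. t \<le> 0 \<Longrightarrow> H (s, t) = c s" "\<And>s t. t \<ge> 1 \<Longrightarrow> H (s, t) = d s"
    by (rule isotopic_curvesE[OF assms(1)]) (rule that)
  obtain I :: "real \<times> real \<Rightarrow> r4" where I: "C1_on UNIV I" "\<And>t. embedded_curve \<sigma> (\<lambda>s. I (s, t))"
     "\<And>s t. t \<le> 0 \<Longrightarrow> I (s, t) = d s" "\<And>s t. t \<ge> 1 \<Longrightarrow> I (s, t) = e s"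
    by (rule isotopic_curvesE[OF assms(2)]) (rule that)
  \<comment> \<open>The two homotopies run at triple speed; between the times \<open>1/3\<close> and \<open>2/3\<close> both are at rest at \<open>d\<close>.\<close>
  define J where "J = (\<lambda>x::real\<times>real. if snd x < 1/2 then H (fst x, 3 * snd x) else I (fst x, 3 * snd x - 2))"
  have JH: "J x = H (fst x, 3 * snd x)" if "snd x < 2/3" for x
    using that by (simp add: J_def H(4) I(3))
  have JI: "J x = I (fst x, 3 * snd x - 2)" if "snd x > 1/3" for x
    using that by (simp add: J_def H(4) I(3))
  have o: "open {x::real\<times>real. snd x < 2/3}" "open {x::real\<times>real. snd x > 1/3}"
    by (auto intro!: open_Collect_less continuous_intros)
  have 1: "C1_on {x. snd x < 2/3} J"
  proof (rule C1_on_cong[OF _ o(1)])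
    show "C1_on {x. snd x < 2/3} (\<lambda>x. H (fst x, 3 * snd x))"
      by (rule C1_on_compose_any[OF H(1)]) (intro C1_intros)
  qed (simp add: JH)
  have 2: "C1_on {x. snd x > 1/3} J"
  proof (rule C1_on_cong[OF _ o(2)])
    show "C1_on {x. snd x > 1/3} (\<lambda>x. I (fst x, 3 * snd x - 2))"
      by (rule C1_on_compose_any[OF I(1)]) (intro C1_intros)
  qed (simp add: JI)
  have "C1_on UNIV J"
  proof (rule C1_on_local)
    fix x :: "real \<times> real"
    have "x \<in> {x. snd x < 2/3} \<or> x \<in> {x. snd x > 1/3}" by auto
    then show "\<exists>U. open U \<and> x \<in> U \<and> C1_on U J" using o 1 2 by blast
  qed
  moreover have "embedded_curve \<sigma> (\<lambda>s. J (s, t))" for t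
    by (cases "t < 1/2") (simp_all add: J_def H(2) I(2))
  moreover have "J (s, t) = c s" if "t \<le> 0" for s t using that by (simp add: J_def H(3))
  moreover have "J (s, t) = e s" if "t \<ge> 1" for s t using that by (simp add: J_def I(4))
  ultimately show ?thesis unfolding isotopic_curves_def by (intro exI[of _ J] conjI allI impI) simp_all
qed

lemma isotopic_knot_of:
  assumes "isotopic_curves \<sigma> c d" "\<bar>\<sigma>\<bar> = 1"
  shows "isotopic (knot_of c) (knot_of d)"
proof -
  obtain H :: "real \<times> real \<Rightarrow> r4" where H: "C1_on UNIV H" "\<And>t. embedded_curve \<sigma> (\<lambda>s. H (s, t))"
     "\<And>s t. t \<le> 0 \<Longrightarrow> H (s, t) = c s" "\<And>s t. t \<ge> 1 \<Longrightarrow> H (s, t) = d s"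
    by (rule isotopic_curvesE[OF assms(1)]) (rule that)
  have nz: "H x \<noteq> 0" for x using embedded_curveD(3)[OF H(2), of "fst x" "snd x"] by simp
  have C1: "C1_on UNIV (\<lambda>x. sgn (H x))"
    unfolding sgn_div_norm by (intro C1_intros H(1)) (use nz in auto)
  obtain G' where G': "\<And>x. ((\<lambda>x. sgn (H x)) has_derivative G' x) (at x)"
    "\<And>v. continuous_on UNIV (\<lambda>x. G' x v)"
    using C1 by (rule C1_onE) auto
  have bl: "blinfun_apply (Blinfun (G' x)) = G' x" for x
    by (rule bounded_linear_Blinfun_apply) (use G'(1) has_derivative_bounded_linear in blast)
  have c: "continuous_on UNIV (\<lambda>x. Blinfun (G' x))"
    by (rule continuous_on_blinfun_componentwise) (simp add: bl G'(2))
  show ?thesis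
    unfolding isotopic_def
  proof (intro exI conjI ballI allI)
    show "knot_param (\<lambda>s. cover (sgn (H (s, t))))" for t
      by (rule knot_param_of_embedded_curve[OF H(2) assms(2)])
    show "range (\<lambda>s. cover (sgn (H (s, 0)))) = knot_of c" "range (\<lambda>s. cover (sgn (H (s, 1)))) = knot_of d"
      by (auto simp: knot_of_def H)
    show "norm (sgn (H (s, t))) = 1" for s t using nz by (simp add: norm_sgn)
    show "((\<lambda>x. sgn (H x)) has_derivative blinfun_apply (Blinfun (G' p))) (at p within UNIV \<times> {0..1})" for p
      unfolding bl using G'(1) has_derivative_at_withinI by blast
    show "continuous_on (UNIV \<times> {0..1}) (\<lambda>x. Blinfun (G' x))"
      using c continuous_on_subset by blast
  qed simp
qed

section \<open>Curves around a cone\<close>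

text \<open>
  The sign of \<open>cos (2 * pi * s)\<close> tells in which half of the period \<open>s\<close> lies: it is positive during
  the return to the basepoint, \<open>\<bar>s\<bar> < 1/4\<close> modulo the integers, and negative
  during the complementary half.
\<close>

lemma cos_two_pi_shift: "cos (2 * pi * (s + of_int k)) = cos (2 * pi * s)" "sin (2 * pi * (s + of_int k)) = sin (2 * pi * s)"
proof -
  have "cos (2 * pi * of_int k) = 1" "sin (2 * pi * of_int k) = 0"
    using cos_int_2pin[of k] sin_int_2pin[of k] by (simp_all add: mult_ac)
  then show "cos (2 * pi * (s + of_int k)) = cos (2 * pi * s)" "sin (2 * pi * (s + of_int k)) = sin (2 * pi * s)"
    by (simp_all add: distrib_left cos_add sin_add)
qed

lemma cos_two_pi_pos: "\<bar>s\<bar> < 1/4 \<Longrightarrow> cos (2 * pi * s) > 0"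
  using mult_strict_left_mono[of "-1/4" s "2*pi"] mult_strict_left_mono[of s "1/4" "2*pi"]
  by (intro cos_gt_zero_pi) (auto simp: abs_less_iff)

lemma cos_two_pi_neg: 
  assumes "1/4 < s" "s < 3/4" shows "cos (2 * pi * s) < 0"
proof -
  have "cos (2 * pi * (s - 1/2)) > 0" using assms by (intro cos_two_pi_pos) (unfold abs_less_iff, linarith)
  moreover have "2 * pi * (s - 1/2) = 2 * pi * s - pi" by (simp add: algebra_simps)
  ultimately show ?thesis by simp
qed

lemma cos_sin_two_pi_quarter:
  "cos (2 * pi * (1/4)) = 0" "sin (2 * pi * (1/4)) = 1" "cos (2 * pi * (3/4)) = 0" "sin (2 * pi * (3/4)) = -1"
proof -
  have "2 * pi * (3/4) = 3/2 * pi" "2 * pi * (1/4) = pi/2" by simp_all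
  then show "cos (2 * pi * (1/4)) = 0" "sin (2 * pi * (1/4)) = 1" "cos (2 * pi * (3/4)) = 0" "sin (2 * pi * (3/4)) = -1"
    by (simp_all only: cos_3over2_pi sin_3over2_pi cos_pi_half sin_pi_half)
qed

lemma ex_shift_quarters:
  fixes s :: real
  obtains k where "-1/4 \<le> s - of_int k" "s - of_int k < 3/4"
proof
  show "-1/4 \<le> s - of_int \<lfloor>s + 1/4\<rfloor>" by linarith
  show "s - of_int \<lfloor>s + 1/4\<rfloor> < 3/4" by linarith
qed

text \<open>
  A height adapted to the class \<open>\<sigma>\<close>: its absolute value is strictly decreasing on \<open>[1/4, 3/4]\<close>
  and strictly increasing on \<open>[-1/4, 1/4]\<close>, from \<open>3\<close> to \<open>1\<close> and back if \<open>\<sigma> = 1\<close>, from \<open>1\<close> to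
  \<open>0\<close> and back if \<open>\<sigma> = -1\<close>.
\<close>

definition height :: "real \<Rightarrow> real \<Rightarrow> real" where
  "height \<sigma> s = (if \<sigma> = 1 then 2 + sin (2 * pi * s) else cos (pi * (s - 1/4)))"

lemma abs_eq_1_cases: "\<bar>\<sigma>::real\<bar> = 1 \<Longrightarrow> (\<sigma> = 1 \<Longrightarrow> P) \<Longrightarrow> (\<sigma> = -1 \<Longrightarrow> P) \<Longrightarrow> P"
  by linarith

lemma C1_height: "C1_on S (height \<sigma>)"
  unfolding height_def[abs_def] by (cases "\<sigma> = 1") (simp_all, (intro C1_intros)+)

lemmas C1_on_height [C1_intros] = C1_compose[OF C1_height]

lemma height_plus_1: "\<bar>\<sigma>\<bar> = 1 \<Longrightarrow> height \<sigma> (s + 1) = \<sigma> * height \<sigma> s"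
proof (erule abs_eq_1_cases)
  show "\<sigma> = 1 \<Longrightarrow> height \<sigma> (s + 1) = \<sigma> * height \<sigma> s"
    using cos_two_pi_shift(2)[of s 1] by (simp add: height_def)
  have "pi * (s + 1 - 1/4) = pi * (s - 1/4) + pi" by (simp add: algebra_simps)
  then show "\<sigma> = -1 \<Longrightarrow> height \<sigma> (s + 1) = \<sigma> * height \<sigma> s"
    by (simp add: height_def del: distrib_left)
qed

text \<open>
  On this half of the period the height is positive but possibly at the very end. The absolute value on
  the left accounts for crossings at which the two lifted branches are opposite.
\<close>

lemma height_descends:
  assumes "1/4 \<le> s" "s < t" "t \<le> 3/4" "\<bar>\<sigma>\<bar> = 1"
  shows "\<bar>height \<sigma> t\<bar> < height \<sigma> s"
  using assms(4)
proof (rule abs_eq_1_cases)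
  assume "\<sigma> = 1"
  have sc: "sin (2 * pi * x) = cos (2 * pi * x - pi / 2)" for x
    by (simp add: cos_diff)
  have "cos (2 * pi * t - pi / 2) < cos (2 * pi * s - pi / 2)"
  proof (rule cos_monotone_0_pi)
    have "2 * pi * (1/4) \<le> 2 * pi * s" "2 * pi * s < 2 * pi * t" "2 * pi * t \<le> 2 * pi * (3/4)"
      using assms(1-3) by (intro mult_left_mono mult_strict_left_mono; simp)+
    then show "0 \<le> 2 * pi * s - pi / 2" "2 * pi * s - pi / 2 < 2 * pi * t - pi / 2" "2 * pi * t - pi / 2 \<le> pi"
      by linarith+
  qed
  then have "\<bar>2 + sin (2 * pi * t)\<bar> < 2 + sin (2 * pi * s)"
    unfolding sc[symmetric] using sin_ge_minus_one[of "2 * pi * t"] by linarith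
  then show ?thesis using \<open>\<sigma> = 1\<close> by (simp add: height_def)
next
  assume "\<sigma> = -1"
  have "cos (pi * (t - 1/4)) < cos (pi * (s - 1/4))"
    using assms(1-3) mult_left_mono[of "t - 1/4" 1 pi]
    by (intro cos_monotone_0_pi) auto
  moreover have "cos (pi * (t - 1/4)) \<ge> 0"
  proof (rule cos_ge_zero)
    have "pi * 0 \<le> pi * (t - 1/4)" "pi * (t - 1/4) \<le> pi * (1/2)"
      using assms(1-3) by (intro mult_left_mono; simp)+
    then show "- (pi / 2) \<le> pi * (t - 1/4)" "pi * (t - 1/4) \<le> pi / 2" using pi_gt_zero by linarith+
  qed
  ultimately show ?thesis using \<open>\<sigma> = -1\<close> by (simp add: height_def)
qed

lemma abs_height_ascends:
  assumes "-1/4 \<le> s" "s < t" "t \<le> 1/4" "\<bar>\<sigma>\<bar> = 1"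
  shows "\<bar>height \<sigma> s\<bar> < \<bar>height \<sigma> t\<bar>"
  using assms(4)
proof (rule abs_eq_1_cases)
  assume "\<sigma> = 1"
  have "sin (2 * pi * s) < sin (2 * pi * t)"
    using assms(1-3) mult_left_mono[of "-1/4" s "2*pi"] mult_left_mono[of t "1/4" "2*pi"]
    by (intro sin_monotone_2pi) auto
  then have "\<bar>2 + sin (2 * pi * s)\<bar> < \<bar>2 + sin (2 * pi * t)\<bar>"
    using sin_ge_minus_one[of "2 * pi * s"] by linarith
  then show ?thesis using \<open>\<sigma> = 1\<close> by (simp add: height_def)
next
  assume "\<sigma> = -1"
  have cm: "cos (pi * (x - 1/4)) = cos (pi * (1/4 - x))" for x
    by (metis cos_minus minus_diff_eq mult_minus_right)
  have "cos (pi * (1/4 - s)) < cos (pi * (1/4 - t))"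
    using assms(1-3) mult_left_mono[of "1/4 - s" 1 pi]
    by (intro cos_monotone_0_pi) auto
  moreover have "cos (pi * (1/4 - s)) \<ge> 0"
  proof (rule cos_ge_zero)
    have "pi * 0 \<le> pi * (1/4 - s)" "pi * (1/4 - s) \<le> pi * (1/2)"
      using assms(1-3) by (intro mult_left_mono; simp)+
    then show "- (pi / 2) \<le> pi * (1/4 - s)" "pi * (1/4 - s) \<le> pi / 2" using pi_gt_zero by linarith+
  qed
  ultimately show ?thesis using \<open>\<sigma> = -1\<close> by (simp add: height_def cm)
qed

text \<open>
  The hypothesis on the cosines says that both times belong to the same closed half of the period.
\<close>

lemma abs_height_inj:
  assumes eq: "\<bar>height \<sigma> s\<bar> = \<bar>height \<sigma> t\<bar>" and c: "0 \<le> cos (2 * pi * s) * cos (2 * pi * t)"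
    and \<sigma>: "\<bar>\<sigma>\<bar> = 1"
  shows "s - t \<in> \<int>"
proof -
  obtain k where k: "-1/4 \<le> s - of_int k" "s - of_int k < 3/4" by (rule ex_shift_quarters)
  obtain m where m: "-1/4 \<le> t - of_int m" "t - of_int m < 3/4" by (rule ex_shift_quarters)
  define s' where "s' = s - of_int k" 
  define t' where "t' = t - of_int m" 
  have sh: "\<bar>height \<sigma> (x - of_int n)\<bar> = \<bar>height \<sigma> x\<bar>" for x n
    using shift_by_int[where c="height \<sigma>" and k="-n", OF _ \<sigma>] height_plus_1[OF \<sigma>] by auto
  have eq': "\<bar>height \<sigma> s'\<bar> = \<bar>height \<sigma> t'\<bar>" using eq by (simp add: sh s'_def t'_def)
  have c': "0 \<le> cos (2 * pi * s') * cos (2 * pi * t')"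
    using c cos_two_pi_shift(1)[of s "-k"] cos_two_pi_shift(1)[of t "-m"] by (simp add: s'_def t'_def)
  have r: "-1/4 \<le> s'" "s' < 3/4" "-1/4 \<le> t'" "t' < 3/4" using k m by (auto simp: s'_def t'_def)
  have "s' \<le> 1/4 \<and> t' \<le> 1/4 \<or> 1/4 \<le> s' \<and> 1/4 \<le> t' \<or> s' = -1/4 \<and> 1/4 < t' \<or> t' = -1/4 \<and> 1/4 < s'"
  proof (rule ccontr)
    assume "\<not> ?thesis"
    then consider "\<bar>s'\<bar> < 1/4" "1/4 < t'" "t' < 3/4" | "\<bar>t'\<bar> < 1/4" "1/4 < s'" "s' < 3/4"
      using r by (auto simp: abs_less_iff not_le)
    then show False
    proof cases
      case 1
      then show False using mult_pos_neg[OF cos_two_pi_pos cos_two_pi_neg, of s' t'] c' by linarith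
    next
      case 2
      then show False using mult_neg_pos[OF cos_two_pi_neg cos_two_pi_pos, of s' t'] c' by linarith
    qed
  qed
  moreover have "\<bar>height \<sigma> (3/4)\<bar> = \<bar>height \<sigma> (-1/4)\<bar>" using sh[of "3/4" 1] by simp
  moreover have "\<bar>height \<sigma> y\<bar> < \<bar>height \<sigma> x\<bar>" if "1/4 \<le> x" "x < y" "y \<le> 3/4" for x y
    using height_descends[OF that \<sigma>] by linarith
  ultimately have "s' = t'"
    using abs_height_ascends[OF _ _ _ \<sigma>] eq' r
    by (metis less_eq_real_def linorder_neqE_linordered_idom order_less_irrefl)
  then have "s - t = of_int (k - m)" by (simp add: s'_def t'_def)
  then show ?thesis by (metis Ints_of_int)
qed

lemma height_critical:
  assumes "(height \<sigma> has_real_derivative 0) (at s)" "\<bar>\<sigma>\<bar> = 1"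
  shows "cos (2 * pi * s) = 0"
  using assms(2)
proof (rule abs_eq_1_cases)
  assume "\<sigma> = 1"
  have "((\<lambda>s. 2 + sin (2 * pi * s)) has_real_derivative cos (2 * pi * s) * (2 * pi)) (at s)"
    by (auto intro!: derivative_eq_intros)
  moreover have "height \<sigma> = (\<lambda>s. 2 + sin (2 * pi * s))" using \<open>\<sigma> = 1\<close> by (simp add: height_def fun_eq_iff)
  ultimately have "cos (2 * pi * s) * (2 * pi) = 0" using assms(1) DERIV_unique by metis
  then show ?thesis by simp
next
  assume "\<sigma> = -1"
  have "((\<lambda>s. cos (pi * (s - 1/4))) has_real_derivative - sin (pi * (s - 1/4)) * pi) (at s)"
    by (auto intro!: derivative_eq_intros)
  moreover have "height \<sigma> = (\<lambda>s. cos (pi * (s - 1/4)))" using \<open>\<sigma> = -1\<close> by (simp add: height_def fun_eq_iff)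
  ultimately have "- sin (pi * (s - 1/4)) * pi = 0" using assms(1) DERIV_unique by metis
  then have z: "sin (pi * (s - 1/4)) = 0" by simp
  have e: "2 * pi * s = pi / 2 + 2 * (pi * (s - 1/4))" by (simp add: algebra_simps)
  have "cos (2 * pi * s) = - sin (2 * (pi * (s - 1/4)))" unfolding e by (simp add: cos_add)
  also have "\<dots> = 0" unfolding sin_double z by simp
  finally show ?thesis .
qed

definition cone_form :: "(real \<Rightarrow> complex) \<Rightarrow> (real \<Rightarrow> real) \<Rightarrow> real \<Rightarrow> real" where
  "cone_form X Y s = (cmod (X s))\<^sup>2 - (Y s)\<^sup>2"

text \<open>
  A shadow that is inside the cone \<open>cmod X = \<bar>Y\<bar>\<close> for \<open>\<bar>s\<bar> < 1/4\<close>, outside of it for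
  \<open>1/4 < s < 3/4\<close>, and that crosses it transversally at the times in between, all modulo the integers.
  Written with sine and cosine, the condition is visibly invariant under \<open>s \<mapsto> s + 1\<close>.
\<close>

definition cone_curve :: "real \<Rightarrow> (real \<Rightarrow> complex) \<Rightarrow> (real \<Rightarrow> real) \<Rightarrow> bool" where
  "cone_curve \<sigma> X Y \<longleftrightarrow> C1_on UNIV X \<and> C1_on UNIV Y \<and> (\<forall>s. X (s + 1) = \<sigma> *\<^sub>R X s) \<and> (\<forall>s. Y (s + 1) = \<sigma> * Y s) \<and>
     (\<forall>s. sgn (cone_form X Y s) = - sgn (cos (2 * pi * s))) \<and>
     (\<forall>s. cos (2 * pi * s) = 0 \<longrightarrow> (\<exists>d. (cone_form X Y has_real_derivative d) (at s) \<and> d * sin (2 * pi * s) > 0))"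

lemma cone_curveD:
  assumes "cone_curve \<sigma> X Y"
  shows "C1_on UNIV X" "C1_on UNIV Y" "X (s + 1) = \<sigma> *\<^sub>R X s" "Y (s + 1) = \<sigma> * Y s"
     "sgn (cone_form X Y s) = - sgn (cos (2 * pi * s))"
     "cos (2 * pi * s) = 0 \<Longrightarrow> \<exists>d. (cone_form X Y has_real_derivative d) (at s) \<and> d * sin (2 * pi * s) > 0"
  using assms unfolding cone_curve_def by simp_all

definition cone_knot :: "real \<Rightarrow> (real \<Rightarrow> complex) \<Rightarrow> (real \<Rightarrow> real) \<Rightarrow> real \<Rightarrow> r4" where
  "cone_knot \<sigma> X Y s = ((X s, height \<sigma> s * norm (X s, Y s)), Y s)"

lemma cone_form_eq: "cone_form X Y s = X s \<bullet> X s - Y s * Y s"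
  unfolding cone_form_def power2_norm_eq_inner by (simp add: power2_eq_square)

lemma inner_self_derivative:
  fixes X :: "real \<Rightarrow> 'a::real_inner"
  assumes "(X has_vector_derivative X') (at s)"
  shows "((\<lambda>s. X s \<bullet> X s) has_real_derivative 2 * (X s \<bullet> X')) (at s)"
  using has_derivative_inner[OF assms[unfolded has_vector_derivative_def] assms[unfolded has_vector_derivative_def]]
  unfolding has_field_derivative_def
  by (rule has_derivative_eq_rhs) (simp add: fun_eq_iff inner_commute)

lemma cone_form_derivative:
  assumes "(X has_vector_derivative X') (at s)" "(Y has_real_derivative Y') (at s)"
  shows "(cone_form X Y has_real_derivative 2 * (X s \<bullet> X' - Y s * Y')) (at s)"
proof -
  from DERIV_diff[OF inner_self_derivative[OF assms(1)] DERIV_mult[OF assms(2) assms(2)]]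
  show ?thesis
    unfolding cone_form_eq[abs_def] by (simp add: algebra_simps)
qed

text \<open>
  At the apex of the cone the quadratic form vanishes together with its derivative, against transversality.
\<close>

lemma cone_curve_nonzero:
  assumes "cone_curve \<sigma> X Y"
  shows "(X s, Y s) \<noteq> 0"
proof
  assume "(X s, Y s) = 0"
  then have z: "X s = 0" "Y s = 0" by (auto simp: zero_prod_def)
  obtain X' Y' where "(X has_vector_derivative X') (at s)" "(Y has_vector_derivative Y') (at s)"
    using cone_curveD(1,2)[OF assms] by (metis C1_on_realE UNIV_I)
  then have d: "(cone_form X Y has_real_derivative 0) (at s)"
    using cone_form_derivative[of X X' s Y Y'] z by (simp add: has_real_derivative_iff_has_vector_derivative)
  have "cone_form X Y s = 0" using z by (simp add: cone_form_def)
  then have "cos (2 * pi * s) = 0" using cone_curveD(5)[OF assms, of s] by (simp add: sgn_0_0)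
  then show False using cone_curveD(6)[OF assms, of s] DERIV_unique[OF d] by force
qed

text \<open>
  A vector that moves in its own direction changes its norm at the same relative rate.
\<close>

lemma norm_Pair_derivative:
  assumes "(X has_vector_derivative l *\<^sub>R X s) (at s)" "(Y has_real_derivative l * Y s) (at s)" "(X s, Y s) \<noteq> (0::complex\<times>real)"
  shows "((\<lambda>s. norm (X s, Y s)) has_real_derivative l * norm (X s, Y s)) (at s)"
proof -
  have n: "norm (X s, Y s) = sqrt (X s \<bullet> X s + Y s * Y s)" for s
    by (simp add: norm_eq_sqrt_inner)
  have p: "X s \<bullet> X s + Y s * Y s > 0"
    using assms(3) by (metis inner_Pair inner_gt_zero_iff inner_real_def)
  have "((\<lambda>s. X s \<bullet> X s + Y s * Y s) has_real_derivative 2 * l * (X s \<bullet> X s + Y s * Y s)) (at s)"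
    using DERIV_add[OF inner_self_derivative[OF assms(1)] DERIV_mult[OF assms(2) assms(2)]]
    by (simp add: algebra_simps)
  from DERIV_chain2[OF DERIV_real_sqrt[OF p] this]
  have "((\<lambda>s. sqrt (X s \<bullet> X s + Y s * Y s)) has_real_derivative
     inverse (sqrt (X s \<bullet> X s + Y s * Y s)) / 2 * (2 * l * (X s \<bullet> X s + Y s * Y s))) (at s)" .
  also have "inverse (sqrt (X s \<bullet> X s + Y s * Y s)) / 2 * (2 * l * (X s \<bullet> X s + Y s * Y s)) = 
     l * ((X s \<bullet> X s + Y s * Y s) / sqrt (X s \<bullet> X s + Y s * Y s))"
    by (simp only: divide_inverse) (simp add: mult_ac)
  also have "(X s \<bullet> X s + Y s * Y s) / sqrt (X s \<bullet> X s + Y s * Y s) = sqrt (X s \<bullet> X s + Y s * Y s)"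
    by (rule real_div_sqrt[OF less_imp_le[OF p]])
  finally show ?thesis unfolding n .
qed

lemma has_vector_derivative_r4D:
  fixes c :: "real \<Rightarrow> r4"
  assumes "(c has_vector_derivative v) (at s)"
  shows "((\<lambda>s. fst (fst (c s))) has_vector_derivative fst (fst v)) (at s)"
    "((\<lambda>s. snd (fst (c s))) has_real_derivative snd (fst v)) (at s)"
    "((\<lambda>s. snd (c s)) has_real_derivative snd v) (at s)"
  unfolding has_real_derivative_iff_has_vector_derivative
  by (intro bounded_linear.has_vector_derivative[OF bounded_linear_fst] 
      bounded_linear.has_vector_derivative[OF bounded_linear_snd] assms)+

text \<open>
  If two values are proportional with factor \<open>l\<close>, the norms of the shadows differ by \<open>\<bar>l\<bar>\<close>, so the heights agree in
  absolute value; and the quadratic form only changes by \<open>l\<^sup>2\<close>, so both times lie in the same half of the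
  period, on which the absolute height is injective. Likewise a derivative proportional to the value forces a critical
  point of the height, that is, a time at which the cone is crossed, and tangency to the cone there.
\<close>

lemma embedded_cone_knot:
  assumes c: "cone_curve \<sigma> X Y" and \<sigma>: "\<bar>\<sigma>\<bar> = 1"
  shows "embedded_curve \<sigma> (cone_knot \<sigma> X Y)"
  unfolding embedded_curve_def
proof (intro conjI allI impI)
  note nz = cone_curve_nonzero[OF c]
  show "C1_on UNIV (cone_knot \<sigma> X Y)"
    unfolding cone_knot_def[abs_def] by (intro C1_intros cone_curveD(1,2)[OF c] nz)
  show "cone_knot \<sigma> X Y (s + 1) = \<sigma> *\<^sub>R cone_knot \<sigma> X Y s" for s
  proof -
    have "norm (X (s + 1), Y (s + 1)) = norm (\<sigma> *\<^sub>R (X s, Y s))"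
      using cone_curveD(3,4)[OF c] by simp
    also have "\<dots> = norm (X s, Y s)" using \<sigma> by (simp only: norm_scaleR)
    finally show ?thesis by (simp add: cone_knot_def height_plus_1[OF \<sigma>] cone_curveD(3,4)[OF c])
  qed
  show "cone_knot \<sigma> X Y s \<noteq> 0" for s
    using nz[of s] by (simp add: cone_knot_def zero_prod_def)
  show "s - t \<in> \<int>" if eq: "cone_knot \<sigma> X Y s = l *\<^sub>R cone_knot \<sigma> X Y t" for s t l
  proof (rule abs_height_inj[OF _ _ \<sigma>])
    from eq have X: "X s = l *\<^sub>R X t" and Y: "Y s = l * Y t"
      and H: "height \<sigma> s * norm (X s, Y s) = l * (height \<sigma> t * norm (X t, Y t))"
      unfolding cone_knot_def scaleR_Pair prod.inject real_scaleR_def by blast+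
    have n: "norm (X s, Y s) = \<bar>l\<bar> * norm (X t, Y t)" 
      using norm_scaleR[of l "(X t, Y t)"] by (simp add: X Y)
    have l: "l \<noteq> 0" using X Y nz[of s] by (auto simp: zero_prod_def)
    have "\<bar>height \<sigma> s\<bar> * norm (X s, Y s) = \<bar>height \<sigma> t\<bar> * (\<bar>l\<bar> * norm (X t, Y t))"
      using arg_cong[OF H, of abs] by (simp add: abs_mult mult_ac)
    then show "\<bar>height \<sigma> s\<bar> = \<bar>height \<sigma> t\<bar>"
      unfolding n[symmetric] using nz[of s] by simp
    have q: "cone_form X Y s = l\<^sup>2 * cone_form X Y t"
      by (simp add: cone_form_def X Y power_mult_distrib algebra_simps)
    have "sgn (cos (2 * pi * s)) = sgn (cos (2 * pi * t))"
    proof -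
      have "sgn (l\<^sup>2) = 1" using l by (intro sgn_pos) simp
      then show ?thesis using q
          cone_curveD(5)[OF c, of s] cone_curveD(5)[OF c, of t] by (simp only: sgn_mult)
    qed
    then show "0 \<le> cos (2 * pi * s) * cos (2 * pi * t)"
      by (metis linorder_linear mult_nonneg_nonneg mult_nonpos_nonpos sgn_less sgn_greater less_eq_real_def not_less)
  qed
  show "v \<noteq> l *\<^sub>R cone_knot \<sigma> X Y s" if v: "(cone_knot \<sigma> X Y has_vector_derivative v) (at s)" for s v l
  proof
    assume veq: "v = l *\<^sub>R cone_knot \<sigma> X Y s"
    have dX: "(X has_vector_derivative l *\<^sub>R X s) (at s)"
      and dH: "((\<lambda>s. height \<sigma> s * norm (X s, Y s)) has_real_derivative l * (height \<sigma> s * norm (X s, Y s))) (at s)"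
      and dY: "(Y has_real_derivative l * Y s) (at s)"
      using has_vector_derivative_r4D[OF v] unfolding veq by (simp_all add: cone_knot_def)
    obtain h where h: "(height \<sigma> has_real_derivative h) (at s)"
      using C1_on_realE[OF C1_height[of UNIV \<sigma>]]
      by (metis UNIV_I has_real_derivative_iff_has_vector_derivative)
    have "((\<lambda>s. height \<sigma> s * norm (X s, Y s)) has_real_derivative 
        h * norm (X s, Y s) + l * norm (X s, Y s) * height \<sigma> s) (at s)"
      by (rule DERIV_mult[OF h norm_Pair_derivative[OF dX dY nz]])
    with dH have "l * (height \<sigma> s * norm (X s, Y s)) = h * norm (X s, Y s) + l * norm (X s, Y s) * height \<sigma> s"
      by (rule DERIV_unique)
    then have "h = 0" using nz[of s] by simp
    then have cs: "cos (2 * pi * s) = 0" using height_critical h \<sigma> by blast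
    then have "cone_form X Y s = 0" using cone_curveD(5)[OF c, of s] by (simp add: sgn_0_0)
    then have z: "2 * (X s \<bullet> (l *\<^sub>R X s) - Y s * (l * Y s)) = 0"
      by (simp add: cone_form_eq algebra_simps)
    have "(cone_form X Y has_real_derivative 0) (at s)"
      using cone_form_derivative[OF dX dY] unfolding z .
    then show False using cone_curveD(6)[OF c cs] DERIV_unique by force
  qed
qed

lemma isotopic_curves_cone_knot:
  assumes \<sigma>: "\<bar>\<sigma>\<bar> = 1" 
    and "C1_on UNIV (\<lambda>x. X (fst x) (step (snd x)))" "C1_on UNIV (\<lambda>x. Y (fst x) (step (snd x)))"
    and c: "\<And>u. 0 \<le> u \<Longrightarrow> u \<le> 1 \<Longrightarrow> cone_curve \<sigma> (\<lambda>s. X s u) (\<lambda>s. Y s u)"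
  shows "isotopic_curves \<sigma> (cone_knot \<sigma> (\<lambda>s. X s 0) (\<lambda>s. Y s 0)) (cone_knot \<sigma> (\<lambda>s. X s 1) (\<lambda>s. Y s 1))"
proof (rule isotopic_curvesI[where K="\<lambda>s u. cone_knot \<sigma> (\<lambda>s. X s u) (\<lambda>s. Y s u) s"])
  have nz: "(X s (step t), Y s (step t)) \<noteq> 0" for s t
    using cone_curve_nonzero[OF c[OF step_bounds]] .
  show "C1_on UNIV (\<lambda>x. cone_knot \<sigma> (\<lambda>s. X s (step (snd x))) (\<lambda>s. Y s (step (snd x))) (fst x))"
    unfolding cone_knot_def by (intro C1_intros assms(2,3) nz)
qed (use embedded_cone_knot[OF c \<sigma>] in simp_all)

section \<open>Deforming curves around a cone\<close>

lemma cone_form_eq_0: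
  assumes "cone_curve \<sigma> X Y" "cos (2 * pi * s) = 0"
  shows "cmod (X s) = \<bar>Y s\<bar>"
proof -
  have "cone_form X Y s = 0" using cone_curveD(5)[OF assms(1), of s] assms(2) by (simp add: sgn_0_0)
  then have "(cmod (X s))\<^sup>2 = \<bar>Y s\<bar>\<^sup>2" by (simp add: cone_form_def)
  then show ?thesis by (rule power2_eq_imp_eq) simp_all
qed

lemma cone_form_neg:
  assumes "cone_curve \<sigma> X Y" "cos (2 * pi * s) > 0"
  shows "cmod (X s) < \<bar>Y s\<bar>"
proof -
  have "cone_form X Y s < 0" using cone_curveD(5)[OF assms(1), of s] assms(2)
    by (simp add: sgn_if split: if_splits)
  then have "(cmod (X s))\<^sup>2 < \<bar>Y s\<bar>\<^sup>2" by (simp add: cone_form_def)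
  then show ?thesis by (rule power2_less_imp_less) simp
qed

lemma cone_form_pos:
  assumes "cone_curve \<sigma> X Y" "cos (2 * pi * s) < 0"
  shows "\<bar>Y s\<bar> < cmod (X s)"
proof -
  have "cone_form X Y s > 0" using cone_curveD(5)[OF assms(1), of s] assms(2)
    by (simp add: sgn_if split: if_splits)
  then have "\<bar>Y s\<bar>\<^sup>2 < (cmod (X s))\<^sup>2" by (simp add: cone_form_def)
  then show ?thesis by (rule power2_less_imp_less) simp
qed

lemma cone_form_sgnI:
  assumes "cos (2 * pi * s) = 0 \<Longrightarrow> cmod (X s) = \<bar>Y s\<bar>"
    "cos (2 * pi * s) > 0 \<Longrightarrow> cmod (X s) < \<bar>Y s\<bar>"
    "cos (2 * pi * s) < 0 \<Longrightarrow> \<bar>Y s\<bar> < cmod (X s)"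
  shows "sgn (cone_form X Y s) = - sgn (cos (2 * pi * s))"
proof -
  consider "cos (2 * pi * s) = 0" | "cos (2 * pi * s) > 0" | "cos (2 * pi * s) < 0" by linarith
  then show ?thesis
  proof cases
    case 1
    then show ?thesis using assms(1) by (simp add: cone_form_def)
  next
    case 2
    then have "(cmod (X s))\<^sup>2 < \<bar>Y s\<bar>\<^sup>2" using assms(2) by (intro power_strict_mono) auto
    then have "cone_form X Y s < 0" by (simp add: cone_form_def)
    then show ?thesis using 2 by (simp add: sgn_if)
  next
    case 3
    then have "\<bar>Y s\<bar>\<^sup>2 < (cmod (X s))\<^sup>2" using assms(3) by (intro power_strict_mono) auto
    then have "cone_form X Y s > 0" by (simp add: cone_form_def)
    then show ?thesis using 3 by (simp add: sgn_if)
  qed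
qed

text \<open>
  Shrinking \<open>X\<close> inside the cone leaves the shadow inside; nothing changes near the times where the
  cone is crossed, so transversality survives.
\<close>

lemma cone_curve_scale:
  assumes c: "cone_curve \<sigma> X Y" and m: "C1_on UNIV m" "\<And>s. m (s + 1) = m s" "\<And>s. 0 \<le> m s" "\<And>s. m s \<le> 1"
    and a: "a > 0" "\<And>s. cos (2 * pi * s) \<le> a \<Longrightarrow> m s = 1"
  shows "cone_curve \<sigma> (\<lambda>s. m s *\<^sub>R X s) Y"
  unfolding cone_curve_def
proof (intro conjI allI impI)
  let ?X = "\<lambda>s. m s *\<^sub>R X s"
  show "C1_on UNIV ?X" by (intro C1_intros m(1) cone_curveD(1)[OF c])
  show "C1_on UNIV Y" by (rule cone_curveD(2)[OF c])
  show "?X (s + 1) = \<sigma> *\<^sub>R ?X s" for s using m(2) cone_curveD(3)[OF c] by simp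
  show "Y (s + 1) = \<sigma> * Y s" for s by (rule cone_curveD(4)[OF c])
  show "sgn (cone_form ?X Y s) = - sgn (cos (2 * pi * s))" for s
  proof (rule cone_form_sgnI)
    show "cmod (?X s) = \<bar>Y s\<bar>" if "cos (2 * pi * s) = 0"
      using that a cone_form_eq_0[OF c that] by simp
    show "\<bar>Y s\<bar> < cmod (?X s)" if "cos (2 * pi * s) < 0"
      using that a cone_form_pos[OF c that] by simp
    show "cmod (?X s) < \<bar>Y s\<bar>" if "cos (2 * pi * s) > 0"
    proof -
      have "cmod (?X s) \<le> cmod (X s)" using m(3,4)[of s] by (simp add: mult_left_le_one_le)
      then show ?thesis using cone_form_neg[OF c that] by linarith
    qed
  qed
  show "\<exists>d. (cone_form ?X Y has_real_derivative d) (at s) \<and> 0 < d * sin (2 * pi * s)" 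
    if z: "cos (2 * pi * s) = 0" for s
  proof -
    obtain d where d: "(cone_form X Y has_real_derivative d) (at s)" "0 < d * sin (2 * pi * s)"
      using cone_curveD(6)[OF c z] by blast
    have "(cone_form ?X Y has_real_derivative d) (at s)"
    proof (rule has_field_derivative_transform_within_open[OF d(1)])
      show "open {s. cos (2 * pi * s) < a}" by (intro open_Collect_less continuous_intros)
    qed (use z a in \<open>auto simp: cone_form_def\<close>)
    then show ?thesis using d(2) by blast
  qed
qed

lemma cone_curve_rotate:
  assumes c: "cone_curve \<sigma> X Y" and m: "C1_on UNIV \<theta>" "\<And>s. \<theta> (s + 1) = \<theta> s"
  shows "cone_curve \<sigma> (\<lambda>s. X s * cis (\<theta> s)) Y"
proof -
  have q: "cone_form (\<lambda>s. X s * cis (\<theta> s)) Y = cone_form X Y"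
    by (simp add: cone_form_def fun_eq_iff norm_mult)
  show ?thesis
    using c m unfolding cone_curve_def q by (auto intro!: C1_intros)
qed

text \<open>
  Outside the open cone \<open>X\<close> cannot vanish; by compactness the same holds slightly beyond the crossing times.
\<close>

lemma zero_free_margin:
  assumes c: "cone_curve \<sigma> X Y" and \<sigma>: "\<bar>\<sigma>\<bar> = 1"
  obtains a where "0 < a" "a < 1" "\<And>s. cos (2 * pi * s) \<le> a \<Longrightarrow> X s \<noteq> 0"
proof -
  have nz: "X s \<noteq> 0" if "cos (2 * pi * s) \<le> 0" for s
  proof (cases "cos (2 * pi * s) = 0")
    case True
    then show ?thesis using cone_form_eq_0[OF c True] cone_curve_nonzero[OF c, of s] by (auto simp: zero_prod_def)
  next
    case False
    then show ?thesis using cone_form_pos[OF c, of s] that by auto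
  qed
  define Z where "Z = {s\<in>{0..1}. X s = 0}"
  have cX: "continuous_on UNIV X" using C1_on_imp_continuous_on[OF cone_curveD(1)[OF c]] .
  have "closed Z" unfolding Z_def
    by (rule continuous_closed_preimage_constant[OF continuous_on_subset[OF cX]]) auto
  moreover have "bounded Z" by (rule bounded_subset[of "{0..1}"]) (auto simp: Z_def)
  ultimately have "compact Z" by (simp add: compact_eq_bounded_closed)
  have per: "frac s \<in> Z \<and> cos (2 * pi * frac s) = cos (2 * pi * s)" if "X s = 0" for s
  proof -
    have "\<exists>e. X (s + of_int (- \<lfloor>s\<rfloor>)) = e *\<^sub>R X s" 
      using shift_by_int[where c=X and k="- \<lfloor>s\<rfloor>", OF cone_curveD(3)[OF c] \<sigma>] by blast
    then have "X (frac s) = 0" using that by (auto simp: frac_def)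
    moreover have "frac s \<le> 1" using frac_lt_1[of s] by simp
    ultimately show ?thesis using cos_two_pi_shift(1)[of s "- \<lfloor>s\<rfloor>"] by (simp add: Z_def frac_def)
  qed
  show ?thesis
  proof (cases "Z = {}")
    case True
    then show ?thesis using per by (intro that[of "1/2"]) auto
  next
    case False
    have "continuous_on Z (\<lambda>s. cos (2 * pi * s))" by (intro continuous_intros)
    from continuous_attains_inf[OF \<open>compact Z\<close> False this]
    obtain z where z: "z \<in> Z" "\<And>y. y \<in> Z \<Longrightarrow> cos (2 * pi * z) \<le> cos (2 * pi * y)" by blast
    have pos: "cos (2 * pi * z) > 0" using z(1) nz[of z] by (force simp: Z_def not_le[symmetric])
    show ?thesis
    proof (rule that[of "cos (2 * pi * z) / 2"])
      show "cos (2 * pi * z) / 2 < 1" using cos_le_one[of "2 * pi * z"] by linarith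
      show "X s \<noteq> 0" if "cos (2 * pi * s) \<le> cos (2 * pi * z) / 2" for s
        using per[of s] z(2)[of "frac s"] that pos by force
    qed (use pos in simp)
  qed
qed

text \<open>
  The logarithm of \<open>X\<close> is obtained as a primitive of \<open>X' / X\<close>.
\<close>

lemma C1_argument:
  fixes X :: "real \<Rightarrow> complex"
  assumes X: "C1_on UNIV X" and nz: "\<And>s. s \<in> {a..b} \<Longrightarrow> X s \<noteq> 0" and ab: "a < b"
  obtains \<theta> where "C1_on {a<..<b} \<theta>" "\<And>s. s \<in> {a<..<b} \<Longrightarrow> X s = of_real (cmod (X s)) * cis (\<theta> s)"
proof -
  obtain X' where X': "\<And>s. (X has_vector_derivative X' s) (at s)" "continuous_on UNIV X'"
    using X by (rule C1_on_realE) auto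
  have "continuous_on {a..b} (\<lambda>s. X' s / X s)"
    using nz continuous_on_subset[OF C1_on_imp_continuous_on[OF X]] continuous_on_subset[OF X'(2)]
    by (intro continuous_on_divide) auto
  then obtain F where F: "\<And>s. s \<in> {a..b} \<Longrightarrow> (F has_vector_derivative X' s / X s) (at s within {a..b})"
    using antiderivative_continuous by blast
  have F': "(F has_vector_derivative X' s / X s) (at s)" if "s \<in> {a<..<b}" for s
  proof -
    have "{a<..<b} \<subseteq> {a..b}" by auto
    then have "(F has_vector_derivative X' s / X s) (at s within {a<..<b})"
      using has_vector_derivative_within_subset[OF F[of s]] that by auto
    then show ?thesis using that at_within_open[of s "{a<..<b}"] by simp
  qed
  have "\<exists>C. \<forall>s\<in>{a<..<b}. X s * exp (- F s) = C"
  proof (rule has_vector_derivative_zero_constant)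
    show "((\<lambda>s. X s * exp (- F s)) has_vector_derivative 0) (at s within {a<..<b})" if "s \<in> {a<..<b}" for s
    proof -
      have "((\<lambda>s. exp (- F s)) has_vector_derivative (- (X' s / X s)) * exp (- F s)) (at s)"
        using field_vector_diff_chain_at[OF has_vector_derivative_minus[OF F'[OF that]] DERIV_exp]
        by (simp add: o_def)
      from has_vector_derivative_mult[OF X'(1)[of s] this]
      have "((\<lambda>s. X s * exp (- F s)) has_vector_derivative 0) (at s)"
        using nz[of s] that by (simp add: field_simps)
      then show ?thesis by (rule has_vector_derivative_at_within)
    qed
  qed auto
  then obtain C where C: "\<And>s. s \<in> {a<..<b} \<Longrightarrow> X s * exp (- F s) = C" by blast
  then have XF: "X s = C * exp (F s)" if "s \<in> {a<..<b}" for s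
    using C[OF that] by (simp add: exp_minus field_simps)
  define \<theta> where "\<theta> s = Arg C + Im (F s)" for s
  show ?thesis
  proof (rule that)
    have "C1_on {a<..<b} F"
      by (rule C1_on_realI[where f'="\<lambda>s. X' s / X s"])
        (use F' \<open>continuous_on {a..b} (\<lambda>s. X' s / X s)\<close> in \<open>auto intro: continuous_on_subset\<close>)
    then show "C1_on {a<..<b} \<theta>"
      unfolding \<theta>_def by (intro C1_intros C1_on_linear[OF bounded_linear_Im])
    show "X s = of_real (cmod (X s)) * cis (\<theta> s)" if "s \<in> {a<..<b}" for s
    proof -
      have "C = of_real (cmod C) * cis (Arg C)" by (metis rcis_cmod_Arg rcis_def)
      moreover have "exp (F s) = of_real (exp (Re (F s))) * cis (Im (F s))"
        by (simp add: exp_eq_polar)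
      ultimately have "X s = of_real (cmod C * exp (Re (F s))) * cis (\<theta> s)"
        unfolding XF[OF that] \<theta>_def by (simp add: cis_mult[symmetric] mult_ac)
      moreover have "cmod (X s) = cmod C * exp (Re (F s))"
        unfolding XF[OF that] by (simp add: norm_mult)
      ultimately show ?thesis by simp
    qed
  qed
qed

lemma cos_two_pi_arccos:
  assumes "0 \<le> s" "s \<le> 1" "0 < a" "a < 1"
  shows "cos (2 * pi * s) < a \<longleftrightarrow> arccos a / (2 * pi) < s \<and> s < 1 - arccos a / (2 * pi)"
    "cos (2 * pi * s) \<le> a \<longleftrightarrow> arccos a / (2 * pi) \<le> s \<and> s \<le> 1 - arccos a / (2 * pi)"
proof -
  have *: "(cos (2 * pi * s) < a \<longleftrightarrow> arccos a / (2 * pi) < s) \<and> (cos (2 * pi * s) \<le> a \<longleftrightarrow> arccos a / (2 * pi) \<le> s)"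
    if "0 \<le> s" "s \<le> 1/2" for s
  proof -
    have "arccos (cos (2 * pi * s)) = 2 * pi * s" using that by (intro arccos_cos) auto
    moreover have "cos (2 * pi * s) < a \<longleftrightarrow> arccos a < arccos (cos (2 * pi * s))"
      using assms by (subst arccos_less_mono) (auto simp: abs_le_iff)
    moreover have "cos (2 * pi * s) \<le> a \<longleftrightarrow> arccos a \<le> arccos (cos (2 * pi * s))"
      using assms by (subst arccos_le_mono) (auto simp: abs_le_iff)
    ultimately show ?thesis by (simp add: field_simps)
  qed
  have "arccos a < pi / 2" using arccos_less_arccos[of 0 a] assms by simp
  then have j: "arccos a / (2 * pi) < 1/4" by (simp add: field_simps)
  show "cos (2 * pi * s) < a \<longleftrightarrow> arccos a / (2 * pi) < s \<and> s < 1 - arccos a / (2 * pi)"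
    "cos (2 * pi * s) \<le> a \<longleftrightarrow> arccos a / (2 * pi) \<le> s \<and> s \<le> 1 - arccos a / (2 * pi)"
  proof -
    have e: "cos (2 * pi * (1 - s)) = cos (2 * pi * s)"
      by (simp add: right_diff_distrib cos_diff)
    show "cos (2 * pi * s) < a \<longleftrightarrow> arccos a / (2 * pi) < s \<and> s < 1 - arccos a / (2 * pi)"
      "cos (2 * pi * s) \<le> a \<longleftrightarrow> arccos a / (2 * pi) \<le> s \<and> s \<le> 1 - arccos a / (2 * pi)"
      using *[of s] *[of "1 - s"] assms j unfolding e by (cases "s \<le> 1/2"; force)+
  qed
qed

text \<open>
  On one period the argument of \<open>X\<close> in general does not close up. It is cut off near the integers, which gives a
  periodic function that is an argument of \<open>X\<close> at all times with \<open>cos (2 * pi * s) \<le> b\<close>.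
\<close>

lemma periodic_argument:
  assumes X: "C1_on UNIV X" "\<And>s. X (s + 1) = \<sigma> *\<^sub>R X s" and \<sigma>: "\<bar>\<sigma>\<bar> = 1"
    and a: "0 < a" "a < 1" "\<And>s. cos (2 * pi * s) \<le> a \<Longrightarrow> X s \<noteq> 0"
    and b: "b < a"
  obtains \<theta> where "C1_on UNIV \<theta>" "\<And>s. \<theta> (s + 1) = \<theta> s"
    "\<And>s. 0 \<le> s \<Longrightarrow> s < 1 \<Longrightarrow> cos (2 * pi * s) \<le> b \<Longrightarrow> X s * cis (- \<theta> s) = of_real (cmod (X s))"
proof -
  define j where "j = arccos a / (2 * pi)"
  have "arccos a < pi / 2" using arccos_less_arccos[of 0 a] a by simp
  moreover have "0 < arccos a" using arccos_less_arccos[of a 1] a by simp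
  ultimately have j: "0 < j" "j < 1/4" by (simp_all add: field_simps j_def)
  have "X s \<noteq> 0" if "s \<in> {j..1-j}" for s
    using that j a(3)[of s] cos_two_pi_arccos(2)[of s a] a unfolding j_def by auto
  then obtain \<theta>0 where \<theta>0: "C1_on {j<..<1-j} \<theta>0" 
    "\<And>s. s \<in> {j<..<1-j} \<Longrightarrow> X s = of_real (cmod (X s)) * cis (\<theta>0 s)"
    using C1_argument[OF X(1), of j "1-j"] j by auto
  \<comment> \<open>The cut-off \<open>\<mu>\<close> is \<open>1\<close> where the cosine is at most \<open>b\<close> and \<open>0\<close> where it is at least \<open>b'\<close>, well inside
    the set where \<open>\<theta>0\<close> is defined.\<close>
  define b' where "b' = (a + b) / 2"
  define \<mu> where "\<mu> s = step ((b' - cos (2 * pi * s)) / (b' - b))" for s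
  have b': "b < b'" "b' < a" using b by (auto simp: b'_def)
  have \<mu>0: "\<mu> s = 0" if "cos (2 * pi * s) \<ge> b'" for s
    using that b' by (simp add: \<mu>_def divide_nonpos_pos)
  have \<mu>1: "\<mu> s = 1" if "cos (2 * pi * s) \<le> b" for s
    using that b' by (simp add: \<mu>_def)
  have \<mu>per: "\<mu> (s + of_int k) = \<mu> s" for s k
    by (simp add: \<mu>_def cos_two_pi_shift)
  have C\<mu>: "C1_on S \<mu>" for S
    unfolding \<mu>_def[abs_def] by (intro C1_intros) (use b' in auto)
  define \<theta> where "\<theta> s = \<mu> s * \<theta>0 (frac s)" for s
  show ?thesis
  proof (rule that)
    show "\<theta> (s + 1) = \<theta> s" for s
      using \<mu>per[of s 1] by (simp add: \<theta>_def frac_def)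
    show "X s * cis (- \<theta> s) = of_real (cmod (X s))" if "0 \<le> s" "s < 1" "cos (2 * pi * s) \<le> b" for s
    proof -
      have "s \<in> {j<..<1-j}" using that b' cos_two_pi_arccos(1)[of s a] a unfolding j_def by auto
      moreover have "\<theta> s = \<theta>0 s" using that \<mu>1 by (simp add: \<theta>_def frac_eq)
      ultimately show ?thesis 
        by (subst \<theta>0(2)) (simp_all add: mult.assoc cis_mult)
    qed
    show "C1_on UNIV \<theta>"
    proof (rule C1_on_local)
      fix s :: real
      show "\<exists>U. open U \<and> s \<in> U \<and> C1_on U \<theta>"
      proof (cases "cos (2 * pi * s) > b'")
        case True
        let ?U = "{s. b' < cos (2 * pi * s)}"
        have o: "open ?U" by (intro open_Collect_less continuous_intros)
        have "C1_on ?U \<theta>"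
          by (rule C1_on_cong[OF C1_on_const[where k=0] o]) (simp add: \<theta>_def \<mu>0)
        then show ?thesis using o True by blast
      next
        case False
        define n where "n = \<lfloor>s\<rfloor>"
        let ?U = "{of_int n + j<..<of_int n + (1 - j)}"
        have "cos (2 * pi * frac s) \<le> b'" using False cos_two_pi_shift(1)[of s "- n"] by (simp add: frac_def n_def)
        then have "j < frac s \<and> frac s < 1 - j"
          using cos_two_pi_arccos(1)[of "frac s" a] a b' frac_lt_1[of s] unfolding j_def by auto
        then have "s \<in> ?U" by (auto simp: n_def frac_def)
        moreover have "C1_on ?U \<theta>"
        proof (rule C1_on_cong)
          show "C1_on ?U (\<lambda>x. \<mu> x * \<theta>0 (x - of_int n))"
            by (intro C1_intros C\<mu> C1_on_compose[OF \<theta>0(1)]) auto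
          show "\<mu> x * \<theta>0 (x - of_int n) = \<theta> x" if "x \<in> ?U" for x
          proof -
            have "\<lfloor>x\<rfloor> = n" using that j by (intro floor_unique) auto
            then show ?thesis by (simp add: \<theta>_def frac_def)
          qed
        qed simp
        ultimately show ?thesis by (intro exI[of _ ?U]) simp
      qed
    qed
  qed
qed

text \<open>
  First \<open>X\<close> is made to vanish near the integers, by the function \<open>m\<close>. The curve then runs along the axis of the
  cone for a while, so it can be rotated by a different angle before and after, and \<open>X\<close> is turned
  back to the real axis by its argument. Rotations preserve the quadratic form. However often
  \<open>X\<close> turns around the axis outside the cone, this is undone by spinning the curve while it runs along the axis.
\<close>

lemma isotopic_curves_to_real_cone_curve:
  assumes c: "cone_curve \<sigma> X Y" and \<sigma>: "\<bar>\<sigma>\<bar> = 1"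
  obtains x where "cone_curve \<sigma> (\<lambda>s. of_real (x s)) Y" 
    "isotopic_curves \<sigma> (cone_knot \<sigma> X Y) (cone_knot \<sigma> (\<lambda>s. of_real (x s)) Y)"
    "\<And>s. s \<in> {1/4..3/4} \<Longrightarrow> x s \<ge> 0"
proof -
  obtain a where a: "0 < a" "a < 1" "\<And>s. cos (2 * pi * s) \<le> a \<Longrightarrow> X s \<noteq> 0"
    using zero_free_margin[OF c \<sigma>] by blast
  define m where "m s = step ((a/2 - cos (2 * pi * s)) / (a/4))" for s
  have m0: "m s = 0" if "cos (2 * pi * s) \<ge> a/2" for s
    using that a by (simp add: m_def divide_nonpos_pos)
  have m1: "m s = 1" if "cos (2 * pi * s) \<le> a/4" for s
    using that a by (simp add: m_def)
  have mper: "m (s + 1) = m s" for s using cos_two_pi_shift(1)[of s 1] by (simp add: m_def)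
  have Cm: "C1_on S m" for S
    unfolding m_def[abs_def] by (intro C1_intros) (use a in auto)
  have mb: "0 \<le> m s" "m s \<le> 1" for s by (simp_all add: m_def)
  obtain \<theta> where \<theta>: "C1_on UNIV \<theta>" "\<And>s. \<theta> (s + 1) = \<theta> s"
    "\<And>s. 0 \<le> s \<Longrightarrow> s < 1 \<Longrightarrow> cos (2 * pi * s) \<le> a/2 \<Longrightarrow> X s * cis (- \<theta> s) = of_real (cmod (X s))"
    using periodic_argument[OF cone_curveD(1,3)[OF c] \<sigma> a, of "a/2"] a by auto
  note C = C1_intros C1_compose[OF cone_curveD(1)[OF c]] C1_compose[OF cone_curveD(2)[OF c]] 
    C1_compose[OF \<theta>(1)] C1_compose[OF Cm]
  let ?X1 = "\<lambda>s. m s *\<^sub>R X s"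
  let ?X2 = "\<lambda>s. ?X1 s * cis (- \<theta> s)"
  have c1: "cone_curve \<sigma> (\<lambda>s. (1 - u + u * m s) *\<^sub>R X s) Y" if "0 \<le> u" "u \<le> 1" for u
  proof (rule cone_curve_scale[OF c])
    show "C1_on UNIV (\<lambda>s. 1 - u + u * m s)" by (intro C1_intros Cm)
    show "1 - u + u * m (s + 1) = 1 - u + u * m s" for s by (simp add: mper)
    show "0 \<le> 1 - u + u * m s" for s using that mb by simp
    show "1 - u + u * m s \<le> 1" for s using that mb[of s] mult_left_mono[of "m s" 1 u] by simp
    show "1 - u + u * m s = 1" if "cos (2 * pi * s) \<le> a/4" for s using m1[OF that] by simp
  qed (use a in simp)
  have "isotopic_curves \<sigma> (cone_knot \<sigma> (\<lambda>s. (1 - 0 + 0 * m s) *\<^sub>R X s) Y) (cone_knot \<sigma> (\<lambda>s. (1 - 1 + 1 * m s) *\<^sub>R X s) Y)"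
    by (rule isotopic_curves_cone_knot[OF \<sigma>, where X="\<lambda>s u. (1 - u + u * m s) *\<^sub>R X s"]) (intro C | rule c1; assumption)+
  then have h1: "isotopic_curves \<sigma> (cone_knot \<sigma> X Y) (cone_knot \<sigma> ?X1 Y)" by simp
  have c2: "cone_curve \<sigma> (\<lambda>s. ?X1 s * cis (u * - \<theta> s)) Y" for u
    by (rule cone_curve_rotate) (use c1[of 1] \<theta> in \<open>auto intro!: C1_intros\<close>)
  have "isotopic_curves \<sigma> (cone_knot \<sigma> (\<lambda>s. ?X1 s * cis (0 * - \<theta> s)) Y) (cone_knot \<sigma> (\<lambda>s. ?X1 s * cis (1 * - \<theta> s)) Y)"
    by (rule isotopic_curves_cone_knot[OF \<sigma>, where X="\<lambda>s u. ?X1 s * cis (u * - \<theta> s)"]) (intro C | rule c2)+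
  then have h2: "isotopic_curves \<sigma> (cone_knot \<sigma> ?X1 Y) (cone_knot \<sigma> ?X2 Y)" by simp
  have r: "?X2 s = of_real (m s * cmod (X s))" if "0 \<le> s" "s < 1" for s
    using \<theta>(3)[OF that] m0[of s] by (cases "cos (2 * pi * s) \<le> a/2") (auto simp: scaleR_conv_of_real mult.assoc)
  define x where "x s = Re (?X2 s)" for s
  have real: "?X2 s = of_real (x s)" for s
  proof -
    have per: "?X2 (s + 1) = \<sigma> *\<^sub>R ?X2 s" for s
      by (simp add: mper \<theta>(2) cone_curveD(3)[OF c])
    obtain e where e: "\<forall>t. ?X2 (t + of_int \<lfloor>s\<rfloor>) = e *\<^sub>R ?X2 t"
      using shift_by_int[where c="?X2" and k="\<lfloor>s\<rfloor>", OF per \<sigma>] by blast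
    have "?X2 s = e *\<^sub>R ?X2 (frac s)" using e[rule_format, of "frac s"] by (simp add: frac_def)
    also have "\<dots> = of_real (e * (m (frac s) * cmod (X (frac s))))"
      unfolding r[OF frac_ge_0 frac_lt_1] by (simp add: scaleR_conv_of_real)
    finally have "?X2 s \<in> \<real>" by (metis Reals_of_real)
    then show ?thesis unfolding x_def by (rule of_real_Re[symmetric])
  qed
  show ?thesis
  proof (rule that)
    show "cone_curve \<sigma> (\<lambda>s. of_real (x s)) Y"
      using c2[of 1] by (simp add: real[symmetric])
    show "isotopic_curves \<sigma> (cone_knot \<sigma> X Y) (cone_knot \<sigma> (\<lambda>s. of_real (x s)) Y)"
      using isotopic_curves_trans[OF h1 h2] unfolding real .
    show "x s \<ge> 0" if "s \<in> {1/4..3/4}" for s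
      using r[of s] that mb(1)[of s] by (simp add: x_def)
  qed
qed

text \<open>
  Inside the cone \<open>Y\<close> does not vanish, so it keeps the sign that it has at \<open>0\<close>.
\<close>

lemma cone_curve_positive_near_0:
  assumes c: "cone_curve \<sigma> X Y" and Y0: "Y 0 > 0" and s: "\<bar>s\<bar> \<le> 1/4"
  shows "Y s > 0"
proof (rule ccontr)
  assume "\<not> Y s > 0"
  have cY: "continuous_on T Y" for T
    using C1_on_imp_continuous_on[OF cone_curveD(2)[OF c]] continuous_on_subset by blast
  obtain r where r: "\<bar>r\<bar> \<le> 1/4" "Y r = 0"
  proof (cases "s \<ge> 0")
    case True
    obtain x where "0 \<le> x" "x \<le> s" "Y x = 0"
      using IVT2'[of Y s 0 0, OF _ _ True cY] Y0 \<open>\<not> Y s > 0\<close> by (auto simp: not_less)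
    then show ?thesis using that[of x] s by simp
  next
    case False
    obtain x where "s \<le> x" "x \<le> 0" "Y x = 0"
      using IVT'[of Y s 0 0, OF _ _ _ cY] Y0 \<open>\<not> Y s > 0\<close> False by (auto simp: not_less)
    then show ?thesis using that[of x] s by simp
  qed
  have "cmod (X r) \<le> \<bar>Y r\<bar>"
  proof (cases "\<bar>r\<bar> = 1/4")
    case True
    then have "r = 1/4 \<or> r = -(1/4)" by (auto simp: abs_if split: if_splits)
    then have "cos (2 * pi * r) = 0" using cos_sin_two_pi_quarter(1) by (metis cos_minus mult_minus_right)
    then show ?thesis using cone_form_eq_0[OF c] by force
  next
    case False
    then show ?thesis using cone_form_neg[OF c cos_two_pi_pos, of r] r by simp
  qed
  then show False using r cone_curve_nonzero[OF c, of r] by (auto simp: zero_prod_def)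
qed

lemma sgn_cos_fundamental:
  assumes "-1/4 \<le> s" "s < 3/4"
  obtains "s = -1/4" | "\<bar>s\<bar> < 1/4" "cos (2 * pi * s) > 0" | "s = 1/4" | "1/4 < s" "s < 3/4" "cos (2 * pi * s) < 0"
proof -
  consider "s = -1/4" | "\<bar>s\<bar> < 1/4" | "s = 1/4" | "1/4 < s" using assms by linarith
  then show thesis using assms(2) cos_two_pi_pos[of s] cos_two_pi_neg[of s] that by cases auto
qed

text \<open>
  By periodicity it suffices to look at one period.
\<close>

lemma cone_curveI_fundamental:
  assumes \<sigma>: "\<bar>\<sigma>\<bar> = 1" and X: "C1_on UNIV X" "\<And>s. X (s + 1) = \<sigma> *\<^sub>R X s" and Y: "C1_on UNIV Y" "\<And>s. Y (s + 1) = \<sigma> * Y s"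
    and inner: "\<And>s. \<bar>s\<bar> < 1/4 \<Longrightarrow> cmod (X s) < \<bar>Y s\<bar>"
    and outer: "\<And>s. 1/4 < s \<Longrightarrow> s < 3/4 \<Longrightarrow> \<bar>Y s\<bar> < cmod (X s)"
    and b1: "cmod (X (1/4)) = \<bar>Y (1/4)\<bar>" "(cone_form X Y has_real_derivative d1) (at (1/4))" "d1 > 0"
    and b2: "cmod (X (3/4)) = \<bar>Y (3/4)\<bar>" "(cone_form X Y has_real_derivative d2) (at (3/4))" "d2 < 0"
  shows "cone_curve \<sigma> X Y"
proof -
  have q1: "cone_form X Y (s + of_int k) = cone_form X Y s" for s k
  proof -
    obtain e where "e \<in> {1,-1}" "\<forall>s. X (s + of_int k) = e *\<^sub>R X s"
      using shift_by_int[where c=X, OF X(2) \<sigma>] by blast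
    then have "cmod (X (s + of_int k)) = cmod (X s)" by auto
    moreover obtain e where "e \<in> {1,-1}" "\<forall>s. Y (s + of_int k) = e *\<^sub>R Y s"
      using shift_by_int[where c=Y, OF _ \<sigma>, of k] Y(2) by (metis real_scaleR_def)
    then have "(Y (s + of_int k))\<^sup>2 = (Y s)\<^sup>2" by auto
    ultimately show ?thesis by (simp add: cone_form_def)
  qed
  have q2: "(cone_form X Y has_real_derivative d) (at (s + of_int k))" 
    if "(cone_form X Y has_real_derivative d) (at s)" for s d k
  proof -
    have "((\<lambda>x. cone_form X Y (x + of_int k)) has_real_derivative d) (at s)" using that unfolding q1 .
    then show ?thesis by (simp add: DERIV_shift)
  qed
  have "sgn (cone_form X Y s) = - sgn (cos (2 * pi * s))" for s
  proof -
    obtain k where k: "-1/4 \<le> s - of_int k" "s - of_int k < 3/4" by (rule ex_shift_quarters)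
    define t where "t = s - of_int k"
    have "sgn (cone_form X Y t) = - sgn (cos (2 * pi * t))"
      using k unfolding t_def[symmetric]
    proof (rule sgn_cos_fundamental)
      assume t: "t = -1/4"
      have "cone_form X Y t = cone_form X Y (3/4)" using q1[of t 1] t by simp
      moreover have "cos (2 * pi * t) = 0" using cos_two_pi_shift(1)[of t 1] cos_sin_two_pi_quarter(3) t by simp
      ultimately show ?thesis using b2 by (simp add: cone_form_def)
    next
      assume t: "t = 1/4"
      show ?thesis unfolding t using cos_sin_two_pi_quarter(1) b1(1) by (simp add: cone_form_def)
    qed (rule cone_form_sgnI; use inner[of t] outer[of t] in simp)+
    moreover have "cone_form X Y t = cone_form X Y s" "cos (2 * pi * t) = cos (2 * pi * s)"
      using q1[of t k] cos_two_pi_shift(1)[of t k] by (simp_all add: t_def)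
    ultimately show ?thesis by simp
  qed
  moreover have "\<exists>d. (cone_form X Y has_real_derivative d) (at s) \<and> 0 < d * sin (2 * pi * s)" if "cos (2 * pi * s) = 0" for s
  proof -
    obtain k where k: "-1/4 \<le> s - of_int k" "s - of_int k < 3/4" by (rule ex_shift_quarters)
    define t where "t = s - of_int k"
    have c0: "cos (2 * pi * t) = 0" using that cos_two_pi_shift(1)[of t k] by (simp add: t_def)
    have "\<exists>d. (cone_form X Y has_real_derivative d) (at t) \<and> 0 < d * sin (2 * pi * t)"
      using k unfolding t_def[symmetric]
    proof (rule sgn_cos_fundamental)
      assume t: "t = -1/4"
      have "(cone_form X Y has_real_derivative d2) (at t)" using q2[OF b2(2), of "-1"] t by simp
      moreover have "sin (2 * pi * t) = -1" using cos_two_pi_shift(2)[of t 1] cos_sin_two_pi_quarter(4) t by simp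
      ultimately show ?thesis using b2(3) by (intro exI[of _ d2]) simp
    next
      assume t: "t = 1/4"
      show ?thesis unfolding t cos_sin_two_pi_quarter(2) using b1 by auto
    qed (use c0 in simp_all)
    then obtain d where d: "(cone_form X Y has_real_derivative d) (at t)" "0 < d * sin (2 * pi * t)" by blast
    have "(cone_form X Y has_real_derivative d) (at s)" using q2[OF d(1), of k] by (simp add: t_def)
    moreover have "sin (2 * pi * s) = sin (2 * pi * t)" using cos_two_pi_shift(2)[of t k] by (simp add: t_def)
    ultimately show ?thesis using d(2) by (intro exI[of _ d]) simp
  qed
  ultimately show ?thesis unfolding cone_curve_def using X Y by blast
qed

lemma real_cone_curve_boundary:
  assumes \<sigma>: "\<bar>\<sigma>\<bar> = 1" and c: "cone_curve \<sigma> (\<lambda>s. of_real (x s)) Y" 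
    and x: "x (1/4) \<ge> 0" "x (3/4) \<ge> 0" and Y: "Y 0 > 0"
  shows "x (1/4) = Y (1/4)" "Y (1/4) > 0" "x (3/4) = \<sigma> * Y (3/4)" "\<sigma> * Y (3/4) > 0"
proof -
  show p: "Y (1/4) > 0" by (rule cone_curve_positive_near_0[OF c Y]) simp
  show "x (1/4) = Y (1/4)" using cone_form_eq_0[OF c cos_sin_two_pi_quarter(1)] x p by simp
  have "Y (-1/4) > 0" by (rule cone_curve_positive_near_0[OF c Y]) simp
  moreover have e: "Y (3/4) = \<sigma> * Y (-1/4)" using cone_curveD(4)[OF c, of "-1/4"] by simp
  ultimately show p: "\<sigma> * Y (3/4) > 0" using \<sigma> by (auto simp: abs_if split: if_splits)
  have "\<bar>Y (3/4)\<bar> = \<sigma> * Y (3/4)" using p \<sigma> by (auto simp: abs_if split: if_splits)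
  then show "x (3/4) = \<sigma> * Y (3/4)" using cone_form_eq_0[OF c cos_sin_two_pi_quarter(3)] x by simp
qed

text \<open>
  Where \<open>Y > 0\<close>, being inside the cone means \<open>\<bar>x\<bar> < Y\<close>; where \<open>x > 0\<close>, being outside means
  \<open>\<bar>Y\<bar> < x\<close>; these conditions are convex. At the times \<open>1/4\<close> and \<open>3/4\<close> the two
  sides are equal, up to the sign \<open>\<sigma>\<close> in the second case, and transversality becomes an inequality between the derivatives of
  \<open>x\<close> and \<open>Y\<close>, again convex.
\<close>

lemma cone_curve_convex:
  assumes \<sigma>: "\<bar>\<sigma>\<bar> = 1" and u: "0 \<le> u" "u \<le> 1"
    and c: "cone_curve \<sigma> (\<lambda>s. of_real (x s)) Y" "\<And>s. s \<in> {1/4..3/4} \<Longrightarrow> x s \<ge> 0" "Y 0 > 0"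
    and c': "cone_curve \<sigma> (\<lambda>s. of_real (x' s)) Y'" "\<And>s. s \<in> {1/4..3/4} \<Longrightarrow> x' s \<ge> 0" "Y' 0 > 0"
  shows "cone_curve \<sigma> (\<lambda>s. of_real ((1 - u) * x s + u * x' s)) (\<lambda>s. (1 - u) * Y s + u * Y' s)"
proof -
  have convex_less: "(1 - u) * a + u * b < (1 - u) * d + u * e" if "a < d" "b < e" for a b d e
  proof (cases "u = 0")
    case False
    then have "u * b < u * e" using that u by simp
    moreover have "(1 - u) * a \<le> (1 - u) * d" using that u by (intro mult_left_mono) auto
    ultimately show ?thesis by linarith
  qed (use that in simp)
  have deriv: "\<exists>x' Y'. (x has_real_derivative x') (at s) \<and> (Y has_real_derivative Y') (at s) \<and>
      (cone_form (\<lambda>s. of_real (x s)) Y has_real_derivative 2 * (x s * x' - Y s * Y')) (at s)"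
    if c: "cone_curve \<sigma> (\<lambda>s. of_real (x s)) Y" for x Y s
  proof -
    obtain X' where X': "((\<lambda>s. complex_of_real (x s)) has_vector_derivative X') (at s)"
      using cone_curveD(1)[OF c] by (rule C1_on_realE) auto
    obtain D where D: "(Y has_vector_derivative D) (at s)"
      using cone_curveD(2)[OF c] by (rule C1_on_realE) auto
    have "((\<lambda>s. Re (complex_of_real (x s))) has_vector_derivative Re X') (at s)"
      by (rule bounded_linear.has_vector_derivative[OF bounded_linear_Re X'])
    then have "(x has_real_derivative Re X') (at s)" by (simp add: has_real_derivative_iff_has_vector_derivative)
    moreover have "(Y has_real_derivative D) (at s)" using D by (simp add: has_real_derivative_iff_has_vector_derivative)
    moreover have "(cone_form (\<lambda>s. of_real (x s)) Y has_real_derivative 2 * (x s * Re X' - Y s * D)) (at s)"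
      using cone_form_derivative[OF X' \<open>(Y has_real_derivative D) (at s)\<close>] by (simp add: inner_complex_def)
    ultimately show ?thesis by blast
  qed
  have form: "(cone_form (\<lambda>s. of_real (x s)) Y has_real_derivative 2 * (x s * x' - Y s * Y')) (at s)"
    if "(x has_real_derivative x') (at s)" "(Y has_real_derivative Y') (at s)" for x Y x' Y' s
  proof -
    have "((\<lambda>s. complex_of_real (x s)) has_vector_derivative of_real x') (at s)"
      using that(1) by (simp add: has_vector_derivative_of_real has_real_derivative_iff_has_vector_derivative)
    from cone_form_derivative[OF this that(2)] show ?thesis by (simp add: inner_complex_def)
  qed
  let ?x = "\<lambda>s. (1 - u) * x s + u * x' s" and ?Y = "\<lambda>s. (1 - u) * Y s + u * Y' s"
  have Cx: "C1_on UNIV x" if "C1_on UNIV (\<lambda>s. complex_of_real (x s))" for x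
    using C1_on_linear[OF bounded_linear_Re that] by simp
  have per: "x (s + 1) = \<sigma> * x s" if "cone_curve \<sigma> (\<lambda>s. of_real (x s)) Y" for x Y s
    using cone_curveD(3)[OF that, of s] by (simp add: scaleR_conv_of_real flip: of_real_mult)
  note b = real_cone_curve_boundary[OF \<sigma> c(1) c(2) c(2) c(3)]
  note b' = real_cone_curve_boundary[OF \<sigma> c'(1) c'(2) c'(2) c'(3)]
  have b1: "x (1/4) = Y (1/4)" "Y (1/4) > 0" "x' (1/4) = Y' (1/4)" "Y' (1/4) > 0"
    and b2: "x (3/4) = \<sigma> * Y (3/4)" "\<sigma> * Y (3/4) > 0" "x' (3/4) = \<sigma> * Y' (3/4)" "\<sigma> * Y' (3/4) > 0"
    using b b' by simp_all
  have pos: "0 < ?Y s" if "\<bar>s\<bar> \<le> 1/4" for s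
    using convex_less[of 0 "Y s" 0 "Y' s"] cone_curve_positive_near_0[OF c(1,3) that] cone_curve_positive_near_0[OF c'(1,3) that] by simp
  have \<sigma>2: "\<sigma> * \<sigma> = 1" using \<sigma> by (metis abs_mult_self_eq mult_1)
  obtain v w where vw: "(x has_real_derivative v) (at (1/4))" "(Y has_real_derivative w) (at (1/4))"
    "(cone_form (\<lambda>s. of_real (x s)) Y has_real_derivative 2 * (x (1/4) * v - Y (1/4) * w)) (at (1/4))"
    using deriv[OF c(1), of "1/4"] by blast
  obtain v' w' where vw': "(x' has_real_derivative v') (at (1/4))" "(Y' has_real_derivative w') (at (1/4))"
    "(cone_form (\<lambda>s. of_real (x' s)) Y' has_real_derivative 2 * (x' (1/4) * v' - Y' (1/4) * w')) (at (1/4))"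
    using deriv[OF c'(1), of "1/4"] by blast
  have "2 * (x (1/4) * v - Y (1/4) * w) > 0"
    using cone_curveD(6)[OF c(1) cos_sin_two_pi_quarter(1)] DERIV_unique[OF vw(3)] 
    unfolding cos_sin_two_pi_quarter by force
  then have "w < v" using b1 by (simp add: right_diff_distrib[symmetric] zero_less_mult_iff)
  have "2 * (x' (1/4) * v' - Y' (1/4) * w') > 0"
    using cone_curveD(6)[OF c'(1) cos_sin_two_pi_quarter(1)] DERIV_unique[OF vw'(3)] 
    unfolding cos_sin_two_pi_quarter by force
  then have "w' < v'" using b1 by (simp add: right_diff_distrib[symmetric] zero_less_mult_iff)
  obtain p r where pr: "(x has_real_derivative p) (at (3/4))" "(Y has_real_derivative r) (at (3/4))"
    "(cone_form (\<lambda>s. of_real (x s)) Y has_real_derivative 2 * (x (3/4) * p - Y (3/4) * r)) (at (3/4))"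
    using deriv[OF c(1), of "3/4"] by blast
  obtain p' r' where pr': "(x' has_real_derivative p') (at (3/4))" "(Y' has_real_derivative r') (at (3/4))"
    "(cone_form (\<lambda>s. of_real (x' s)) Y' has_real_derivative 2 * (x' (3/4) * p' - Y' (3/4) * r')) (at (3/4))"
    using deriv[OF c'(1), of "3/4"] by blast
  have f: "\<sigma> * y * p - y * r = (\<sigma> * y) * (p - \<sigma> * r)" for y p r
    using \<sigma>2 by (simp add: right_diff_distrib mult_ac)
  have nf: "b < 0" if "2 * (a * b) < 0" "a > 0" for a b :: real
    using that by (auto simp: mult_less_0_iff)
  have "2 * (x (3/4) * p - Y (3/4) * r) < 0"
    using cone_curveD(6)[OF c(1) cos_sin_two_pi_quarter(3)] DERIV_unique[OF pr(3)] 
    unfolding cos_sin_two_pi_quarter by force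
  then have "p - \<sigma> * r < 0" unfolding b2(1) f by (rule nf) (rule b2(2))
  then have "p < \<sigma> * r" by simp
  have "2 * (x' (3/4) * p' - Y' (3/4) * r') < 0"
    using cone_curveD(6)[OF c'(1) cos_sin_two_pi_quarter(3)] DERIV_unique[OF pr'(3)] 
    unfolding cos_sin_two_pi_quarter by force
  then have "p' - \<sigma> * r' < 0" unfolding b2(3) f by (rule nf) (rule b2(4))
  then have "p' < \<sigma> * r'" by simp
  show ?thesis
  proof (rule cone_curveI_fundamental[OF \<sigma>])
    show "C1_on UNIV (\<lambda>s. complex_of_real (?x s))" "C1_on UNIV ?Y"
      by (intro C1_intros Cx[OF cone_curveD(1)[OF c(1)]] Cx[OF cone_curveD(1)[OF c'(1)]] cone_curveD(2)[OF c(1)] cone_curveD(2)[OF c'(1)])+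
    show "complex_of_real (?x (s + 1)) = \<sigma> *\<^sub>R complex_of_real (?x s)" for s
      unfolding per[OF c(1)] per[OF c'(1)] by (simp add: scaleR_conv_of_real algebra_simps)
    show "?Y (s + 1) = \<sigma> * ?Y s" for s
      unfolding cone_curveD(4)[OF c(1)] cone_curveD(4)[OF c'(1)] by (simp add: algebra_simps)
    show "cmod (complex_of_real (?x s)) < \<bar>?Y s\<bar>" if "\<bar>s\<bar> < 1/4" for s
    proof -
      have "\<bar>x s\<bar> < Y s" "\<bar>x' s\<bar> < Y' s"
        using cone_form_neg[OF c(1) cos_two_pi_pos[OF that]] cone_form_neg[OF c'(1) cos_two_pi_pos[OF that]]
          cone_curve_positive_near_0[OF c(1,3), of s] cone_curve_positive_near_0[OF c'(1,3), of s] that by simp_all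
      then have "?x s < ?Y s" "(1 - u) * - x s + u * - x' s < ?Y s" by (intro convex_less; simp)+
      then have "\<bar>?x s\<bar> < ?Y s" by (simp add: abs_less_iff)
      then show ?thesis by (simp only: norm_of_real)
    qed
    show "\<bar>?Y s\<bar> < cmod (complex_of_real (?x s))" if "1/4 < s" "s < 3/4" for s
    proof -
      have "\<bar>Y s\<bar> < x s" "\<bar>Y' s\<bar> < x' s"
        using cone_form_pos[OF c(1) cos_two_pi_neg[OF that]] cone_form_pos[OF c'(1) cos_two_pi_neg[OF that]]
          c(2)[of s] c'(2)[of s] that by simp_all
      then have "?Y s < ?x s" "(1 - u) * - Y s + u * - Y' s < ?x s" by (intro convex_less; simp)+
      then have "\<bar>?Y s\<bar> < ?x s" by (simp add: abs_less_iff)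
      then show ?thesis by (simp only: norm_of_real)
    qed
    show "cmod (complex_of_real (?x (1/4))) = \<bar>?Y (1/4)\<bar>" unfolding b1 by (simp only: norm_of_real)
    have "(?x has_real_derivative (1 - u) * v + u * v') (at (1/4))" "(?Y has_real_derivative (1 - u) * w + u * w') (at (1/4))"
      by (intro DERIV_add DERIV_cmult vw(1,2) vw'(1,2))+
    from form[OF this] show "(cone_form (\<lambda>s. complex_of_real (?x s)) ?Y has_real_derivative 
       2 * (?x (1/4) * ((1 - u) * v + u * v') - ?Y (1/4) * ((1 - u) * w + u * w'))) (at (1/4))" .
    have "?x (1/4) = ?Y (1/4)" using b1 by simp
    moreover have "?Y (1/4) > 0" by (rule pos) simp
    moreover have "(1 - u) * w + u * w' < (1 - u) * v + u * v'" by (rule convex_less) fact+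
    ultimately show "0 < 2 * (?x (1/4) * ((1 - u) * v + u * v') - ?Y (1/4) * ((1 - u) * w + u * w'))" 
      by (simp only: right_diff_distrib[symmetric] zero_less_mult_iff) simp
    have e: "?x (3/4) = \<sigma> * ?Y (3/4)" using b2 by (simp add: algebra_simps)
    have p: "\<sigma> * ?Y (3/4) > 0" using convex_less[of 0 "\<sigma> * Y (3/4)" 0 "\<sigma> * Y' (3/4)"] b2 by (simp add: algebra_simps)
    show "cmod (complex_of_real (?x (3/4))) = \<bar>?Y (3/4)\<bar>" unfolding e norm_of_real by (simp only: abs_mult \<sigma> mult_1)
    have "(?x has_real_derivative (1 - u) * p + u * p') (at (3/4))" "(?Y has_real_derivative (1 - u) * r + u * r') (at (3/4))"
      by (intro DERIV_add DERIV_cmult pr(1,2) pr'(1,2))+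
    from form[OF this] show "(cone_form (\<lambda>s. complex_of_real (?x s)) ?Y has_real_derivative 
       2 * (?x (3/4) * ((1 - u) * p + u * p') - ?Y (3/4) * ((1 - u) * r + u * r'))) (at (3/4))" .
    have "(1 - u) * p + u * p' < (1 - u) * (\<sigma> * r) + u * (\<sigma> * r')" by (rule convex_less) fact+
    then have "((1 - u) * p + u * p') - \<sigma> * ((1 - u) * r + u * r') < 0" by (simp add: algebra_simps)
    with p show "2 * (?x (3/4) * ((1 - u) * p + u * p') - ?Y (3/4) * ((1 - u) * r + u * r')) < 0"
      unfolding e f by (intro mult_pos_neg) simp_all
  qed
qed

lemma isotopic_curves_convex:
  assumes \<sigma>: "\<bar>\<sigma>\<bar> = 1"
    and c: "cone_curve \<sigma> (\<lambda>s. of_real (x s)) Y" "\<And>s. s \<in> {1/4..3/4} \<Longrightarrow> x s \<ge> 0" "Y 0 > 0"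
    and c': "cone_curve \<sigma> (\<lambda>s. of_real (x' s)) Y'" "\<And>s. s \<in> {1/4..3/4} \<Longrightarrow> x' s \<ge> 0" "Y' 0 > 0"
  shows "isotopic_curves \<sigma> (cone_knot \<sigma> (\<lambda>s. of_real (x s)) Y) (cone_knot \<sigma> (\<lambda>s. of_real (x' s)) Y')"
proof -
  have Cx: "C1_on UNIV x" if "C1_on UNIV (\<lambda>s. complex_of_real (x s))" for x
    using C1_on_linear[OF bounded_linear_Re that] by simp
  note C = C1_intros C1_compose[OF Cx[OF cone_curveD(1)[OF c(1)]]] C1_compose[OF Cx[OF cone_curveD(1)[OF c'(1)]]]
     C1_compose[OF cone_curveD(2)[OF c(1)]] C1_compose[OF cone_curveD(2)[OF c'(1)]] 
  have "isotopic_curves \<sigma> (cone_knot \<sigma> (\<lambda>s. of_real ((1 - 0) * x s + 0 * x' s)) (\<lambda>s. (1 - 0) * Y s + 0 * Y' s))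
    (cone_knot \<sigma> (\<lambda>s. of_real ((1 - 1) * x s + 1 * x' s)) (\<lambda>s. (1 - 1) * Y s + 1 * Y' s))"
    by (rule isotopic_curves_cone_knot[OF \<sigma>, where X="\<lambda>s u. of_real ((1 - u) * x s + u * x' s)" and Y="\<lambda>s u. (1 - u) * Y s + u * Y' s"])
      (intro C | rule cone_curve_convex[OF \<sigma> _ _ c c']; assumption)+
  then show ?thesis by simp
qed

section \<open>The two standard knots\<close>

lemma r4_scaleR_eq: "((a::complex, b::real), c::real) = l *\<^sub>R ((a', b'), c') \<longleftrightarrow> a = l *\<^sub>R a' \<and> b = l * b' \<and> c = l * c'"
  by auto

lemma sin_pi_eq_0_iff: "sin (pi * s) = 0 \<longleftrightarrow> s \<in> \<int>"
proof -
  have "sin (pi * s) = 0 \<longleftrightarrow> (\<exists>i::int. pi * s = of_int i * pi)" by (rule sin_zero_iff_int2)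
  also have "\<dots> \<longleftrightarrow> (\<exists>i::int. s = of_int i)" by (simp add: mult.commute)
  also have "\<dots> \<longleftrightarrow> s \<in> \<int>" by (auto elim: Ints_cases)
  finally show ?thesis .
qed

lemma sin_cos_not_both_0: "sin x = 0 \<Longrightarrow> cos (x::real) \<noteq> 0"
  using sin_zero_abs_cos_one[of x] by auto

text \<open>
  The shadow is a projective line, which is embedded; so the height \<open>z\<close> is arbitrary.
\<close>

lemma embedded_over_projective_line:
  assumes z: "C1_on UNIV z" "\<And>s. z (s + 1) = - z s"
  shows "embedded_curve (-1) (\<lambda>s. ((of_real (sin (pi * s)), z s), cos (pi * s)) :: r4)"
  unfolding embedded_curve_def
proof (intro conjI allI impI)
  show "C1_on UNIV (\<lambda>s. ((of_real (sin (pi * s)), z s), cos (pi * s)) :: r4)"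
    by (intro C1_intros z(1))
  have e: "pi * (s + 1) = pi * s + pi" for s by (simp add: algebra_simps)
  show "((of_real (sin (pi * (s + 1))), z (s + 1)), cos (pi * (s + 1))) = 
     -1 *\<^sub>R (((of_real (sin (pi * s)), z s), cos (pi * s)) :: r4)" for s
    unfolding e by (simp add: z(2))
  show "((of_real (sin (pi * s)), z s), cos (pi * s)) \<noteq> (0 :: r4)" for s
    using sin_cos_not_both_0[of "pi * s"] by (auto simp: zero_prod_def)
  show "s - t \<in> \<int>" if "((of_real (sin (pi * s)), z s), cos (pi * s)) = 
     l *\<^sub>R (((of_real (sin (pi * t)), z t), cos (pi * t)) :: r4)" for s t l
  proof -
    have "complex_of_real (sin (pi * s)) = l *\<^sub>R of_real (sin (pi * t))" and c: "cos (pi * s) = l * cos (pi * t)"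
      using that unfolding r4_scaleR_eq by blast+
    then have s: "sin (pi * s) = l * sin (pi * t)" 
      by (simp add: scaleR_conv_of_real flip: of_real_mult)
    have "sin (pi * (s - t)) = 0"
      unfolding right_diff_distrib sin_diff s c by simp
    then show ?thesis by (simp only: sin_pi_eq_0_iff)
  qed
  show "v \<noteq> l *\<^sub>R (((of_real (sin (pi * s)), z s), cos (pi * s)) :: r4)" 
    if v: "((\<lambda>s. ((of_real (sin (pi * s)), z s), cos (pi * s)) :: r4) has_vector_derivative v) (at s)" for s v l
  proof
    assume veq: "v = l *\<^sub>R (((of_real (sin (pi * s)), z s), cos (pi * s)) :: r4)"
    have 1: "((\<lambda>s. complex_of_real (sin (pi * s))) has_vector_derivative l *\<^sub>R of_real (sin (pi * s))) (at s)"
      and 2: "((\<lambda>s. cos (pi * s)) has_real_derivative l * cos (pi * s)) (at s)"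
      using has_vector_derivative_r4D[OF v] unfolding veq by simp_all
    have "((\<lambda>s. sin (pi * s)) has_real_derivative l * sin (pi * s)) (at s)"
      using bounded_linear.has_vector_derivative[OF bounded_linear_Re 1] 
      by (simp add: has_real_derivative_iff_has_vector_derivative)
    moreover have "((\<lambda>s. sin (pi * s)) has_real_derivative cos (pi * s) * pi) (at s)"
      by (auto intro!: derivative_eq_intros)
    ultimately have a: "l * sin (pi * s) = cos (pi * s) * pi" by (rule DERIV_unique)
    have "((\<lambda>s. cos (pi * s)) has_real_derivative - sin (pi * s) * pi) (at s)"
      by (auto intro!: derivative_eq_intros)
    with 2 have b: "l * cos (pi * s) = - sin (pi * s) * pi" by (rule DERIV_unique)
    have "pi * ((cos (pi * s))\<^sup>2 + (sin (pi * s))\<^sup>2) = cos (pi * s) * (cos (pi * s) * pi) - sin (pi * s) * (- sin (pi * s) * pi)"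
      by algebra
    also have "\<dots> = 0" unfolding a[symmetric] b[symmetric] by simp
    finally show False by simp
  qed
qed

lemma cone_curve_line: "cone_curve (-1) (\<lambda>s. of_real (sin (pi * s))) (\<lambda>s. cos (pi * s))"
  unfolding cone_curve_def
proof (intro conjI allI impI)
  have e: "pi * (s + 1) = pi * s + pi" for s by (simp add: algebra_simps)
  show "complex_of_real (sin (pi * (s + 1))) = - 1 *\<^sub>R complex_of_real (sin (pi * s))"
   "cos (pi * (s + 1)) = -1 * cos (pi * s)" for s unfolding e by simp_all
  have q: "cone_form (\<lambda>s. of_real (sin (pi * s))) (\<lambda>s. cos (pi * s)) = (\<lambda>s. - cos (2 * pi * s))"
    using cos_double[of "pi * s" for s] by (simp add: cone_form_def fun_eq_iff mult.assoc)
  show "sgn (cone_form (\<lambda>s. of_real (sin (pi * s))) (\<lambda>s. cos (pi * s)) s) = - sgn (cos (2 * pi * s))" for s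
    unfolding q by (simp add: sgn_minus)
  show "\<exists>d. (cone_form (\<lambda>s. of_real (sin (pi * s))) (\<lambda>s. cos (pi * s)) has_real_derivative d) (at s) \<and>
       0 < d * sin (2 * pi * s)" if "cos (2 * pi * s) = 0" for s
  proof (intro exI conjI)
    show "(cone_form (\<lambda>s. of_real (sin (pi * s))) (\<lambda>s. cos (pi * s)) has_real_derivative 
      sin (2 * pi * s) * (2 * pi)) (at s)"
      unfolding q by (auto intro!: derivative_eq_intros)
    have "sin (2 * pi * s) * sin (2 * pi * s) = 1" 
      using sin_cos_squared_add[of "2 * pi * s"] that by (simp add: power2_eq_square)
    then have "sin (2 * pi * s) * (2 * pi) * sin (2 * pi * s) = 2 * pi" by (simp add: mult_ac)
    then show "0 < sin (2 * pi * s) * (2 * pi) * sin (2 * pi * s)" by simp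
  qed
qed (intro C1_intros)+

text \<open>
  With \<open>s = 2 * arctan r / pi\<close>, stereographic projection yields the point \<open>r\<close> of the diameter.
\<close>

lemma knot_of_line: "knot_of (\<lambda>s. ((of_real (sin (pi * s)), 0), cos (pi * s))) = projective_line"
proof -
  have n: "norm (((complex_of_real (sin (pi * s)), 0::real), cos (pi * s))) = 1" for s
    by (simp add: norm_Pair)
  have sg: "sgn (((complex_of_real (sin (pi * s)), 0::real), cos (pi * s))) = ((of_real (sin (pi * s)), 0), cos (pi * s))" for s
    unfolding sgn_div_norm n by simp
  have le: "\<bar>sin (pi * s) / (1 + \<bar>cos (pi * s)\<bar>)\<bar> \<le> 1" for s
  proof -
    have "\<bar>sin (pi * s)\<bar> \<le> 1 + \<bar>cos (pi * s)\<bar>" using abs_sin_le_one[of "pi * s"] by linarith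
    then show ?thesis by (simp add: divide_simps)
  qed
  have st: "stereo (((complex_of_real (sin (pi * s)), 0::real), cos (pi * s))) = 
     (of_real ((if cos (pi * s) \<ge> 0 then 1 else -1) * (sin (pi * s) / (1 + \<bar>cos (pi * s)\<bar>))), 0)" for s
    by (auto simp: stereo_def scaleR_conv_of_real divide_inverse)
  show ?thesis
  proof
    show "knot_of (\<lambda>s. ((of_real (sin (pi * s)), 0), cos (pi * s))) \<subseteq> projective_line"
      unfolding knot_of_def projective_line_def sg cover_eq st
    proof (rule image_subsetI, rule imageI)
      show "(if cos (pi * s) \<ge> 0 then 1 else -1) * (sin (pi * s) / (1 + \<bar>cos (pi * s)\<bar>)) \<in> {-1..1}" for s
      proof -
        have "\<bar>(if cos (pi * s) \<ge> 0 then 1 else -1) * (sin (pi * s) / (1 + \<bar>cos (pi * s)\<bar>))\<bar> \<le> 1"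
        proof -
          have "\<bar>if cos (pi * s) \<ge> 0 then 1 else -1 :: real\<bar> = 1" by simp
          then show ?thesis using le[of s] by (simp only: abs_mult mult_1)
        qed
        then show ?thesis unfolding abs_le_iff atLeastAtMost_iff by linarith
      qed
    qed
    show "projective_line \<subseteq> knot_of (\<lambda>s. ((of_real (sin (pi * s)), 0), cos (pi * s)))"
    proof
      fix x assume "x \<in> projective_line"
      then obtain r where r: "r \<in> {-1..1}" "x = abs_rp (complex_of_real r, 0)"
        unfolding projective_line_def by blast
      define s where "s = 2 * arctan r / pi"
      have e: "pi * s = 2 * arctan r" by (simp add: s_def)
      have p: "1 + r\<^sup>2 > 0" by (simp add: add_pos_nonneg)
      have c: "cos (pi * s) = (1 - r\<^sup>2) / (1 + r\<^sup>2)"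
      proof -
        have "cos (2 * arctan r) = 2 * (cos (arctan r))\<^sup>2 - 1" by (rule cos_double_cos)
        then show ?thesis unfolding e cos_arctan using p by (simp add: power_divide field_simps)
      qed
      have s: "sin (pi * s) = 2 * r / (1 + r\<^sup>2)"
      proof -
        have "sin (2 * arctan r) = 2 * (r / sqrt (1 + r\<^sup>2)) * (1 / sqrt (1 + r\<^sup>2))"
          by (simp only: sin_double sin_arctan cos_arctan)
        also have "\<dots> = 2 * r / (1 + r\<^sup>2)" using p by simp
        finally show ?thesis unfolding e .
      qed
      have "r\<^sup>2 \<le> 1" using r(1) abs_square_le_1[of r] by (auto simp: abs_le_iff)
      then have "cos (pi * s) \<ge> 0" unfolding c using p by simp
      moreover have "sin (pi * s) / (1 + cos (pi * s)) = r" unfolding c s using p by (simp add: field_simps)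
      ultimately have "stereo (((complex_of_real (sin (pi * s)), 0::real), cos (pi * s))) = (of_real r, 0)"
        unfolding st by simp
      then have "x = cover (sgn (((complex_of_real (sin (pi * s)), 0::real), cos (pi * s))))"
        unfolding sg cover_eq r(2) by simp
      then show "x \<in> knot_of (\<lambda>s. ((of_real (sin (pi * s)), 0), cos (pi * s)))"
        unfolding knot_of_def by blast
    qed
  qed
qed

text \<open>
  A curve in the affine plane with coordinates \<open>1 - cos (2 * pi * s)\<close> and \<open>z s\<close>. The first coordinate
  distinguishes \<open>s\<close> from all times but \<open>- s\<close>, and is critical only where \<open>sin (2 * pi * s) = 0\<close>.
\<close>

lemma embedded_planar_curve:
  assumes z: "C1_on UNIV z" "\<And>s. z (s + 1) = z s"
    and refl: "\<And>s. sin (2 * pi * s) \<noteq> 0 \<Longrightarrow> z s \<noteq> z (- s)"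
    and imm: "\<And>s. sin (2 * pi * s) = 0 \<Longrightarrow> \<not> (z has_real_derivative 0) (at s)"
  shows "embedded_curve 1 (\<lambda>s. ((of_real (1 - cos (2 * pi * s)), z s), 1) :: r4)"
  unfolding embedded_curve_def
proof (intro conjI allI impI)
  let ?c = "\<lambda>s. ((of_real (1 - cos (2 * pi * s)), z s), 1) :: r4"
  show "C1_on UNIV ?c" by (intro C1_intros z(1))
  show "?c (s + 1) = 1 *\<^sub>R ?c s" for s
    using cos_two_pi_shift(1)[of s 1] by (simp add: z(2))
  show "?c s \<noteq> 0" for s by (simp add: zero_prod_def)
  show "s - t \<in> \<int>" if "?c s = l *\<^sub>R ?c t" for s t l
  proof -
    have l: "l = 1" and a: "complex_of_real (1 - cos (2 * pi * s)) = l *\<^sub>R of_real (1 - cos (2 * pi * t))" and b: "z s = l * z t"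
      using that unfolding r4_scaleR_eq by simp_all
    have "cos (2 * pi * s) - cos (2 * pi * t) = 0" using a unfolding l by (simp flip: of_real_diff)
    then have "2 * (sin ((2 * pi * s + 2 * pi * t) / 2) * sin ((2 * pi * t - 2 * pi * s) / 2)) = 0"
      unfolding cos_diff_cos by (simp add: mult.assoc)
    moreover have "(2 * pi * s + 2 * pi * t) / 2 = pi * (s + t)" "(2 * pi * t - 2 * pi * s) / 2 = pi * (t - s)"
      by (simp_all add: field_simps)
    ultimately have "sin (pi * (s + t)) = 0 \<or> sin (pi * (t - s)) = 0" by simp
    then have "s + t \<in> \<int> \<or> t - s \<in> \<int>" unfolding sin_pi_eq_0_iff .
    then show ?thesis
    proof
      assume "t - s \<in> \<int>"
      then have "- (t - s) \<in> \<int>" by (rule Ints_minus)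
      then show ?thesis by simp
    next
      assume st: "s + t \<in> \<int>"
      then obtain k where k: "s + t = of_int k" by (rule Ints_cases)
      have "z (- s + of_int k) = z (- s)"
      proof -
        have "\<forall>s. z (s + of_int k) = z s"
        proof (induction k rule: int_induct[where k=0])
          case (step1 i)
          then show ?case using z(2)[of "s + of_int i" for s] by (simp add: algebra_simps)
        next
          case (step2 i)
          then show ?case using z(2)[of "s + of_int (i - 1)" for s] by (simp add: algebra_simps)
        qed simp
        then show ?thesis by blast
      qed
      moreover have "t = - s + of_int k" using k by simp
      ultimately have "z s = z (- s)" using b l by simp
      then have "sin (2 * pi * s) = 0" using refl by blast
      then have "sin (pi * (2 * s)) = 0" by (simp add: mult_ac)
      then have "2 * s \<in> \<int>" unfolding sin_pi_eq_0_iff .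
      then have "2 * s - (s + t) \<in> \<int>" using st by (rule Ints_diff)
      then show ?thesis by simp
    qed
  qed
  show "v \<noteq> l *\<^sub>R ?c s" if v: "(?c has_vector_derivative v) (at s)" for s v l
  proof
    assume veq: "v = l *\<^sub>R ?c s"
    have "((\<lambda>s. 1::real) has_real_derivative l) (at s)"
      using has_vector_derivative_r4D(3)[OF v] unfolding veq by simp
    then have l: "l = 0" by (metis DERIV_const DERIV_unique)
    have 1: "((\<lambda>s. complex_of_real (1 - cos (2 * pi * s))) has_vector_derivative 0) (at s)"
      and 2: "(z has_real_derivative 0) (at s)"
      using has_vector_derivative_r4D[OF v] unfolding veq l by simp_all
    have "((\<lambda>s. 1 - cos (2 * pi * s)) has_real_derivative 0) (at s)"
      using bounded_linear.has_vector_derivative[OF bounded_linear_Re 1] 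
      by (simp add: has_real_derivative_iff_has_vector_derivative)
    moreover have "((\<lambda>s. 1 - cos (2 * pi * s)) has_real_derivative sin (2 * pi * s) * (2 * pi)) (at s)"
      by (auto intro!: derivative_eq_intros)
    ultimately have "0 = sin (2 * pi * s) * (2 * pi)" by (rule DERIV_unique)
    then show False using imm 2 by simp
  qed
qed

lemma cone_curve_circle: "cone_curve 1 (\<lambda>s. of_real (1 - cos (2 * pi * s))) (\<lambda>s. 1)"
  unfolding cone_curve_def
proof (intro conjI allI impI)
  let ?X = "\<lambda>s. complex_of_real (1 - cos (2 * pi * s))"
  show "?X (s + 1) = 1 *\<^sub>R ?X s" for s using cos_two_pi_shift(1)[of s 1] by simp
  have q: "cone_form ?X (\<lambda>s. 1) = (\<lambda>s. - (cos (2 * pi * s) * (2 - cos (2 * pi * s))))"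
    unfolding cone_form_def norm_of_real by (simp add: fun_eq_iff power2_eq_square algebra_simps)
  show "sgn (cone_form ?X (\<lambda>s. 1) s) = - sgn (cos (2 * pi * s))" for s
  proof -
    have "2 - cos (2 * pi * s) > 0" using cos_le_one[of "2 * pi * s"] by linarith
    then show ?thesis unfolding q by (simp add: sgn_minus sgn_mult)
  qed
  show "\<exists>d. (cone_form ?X (\<lambda>s. 1) has_real_derivative d) (at s) \<and> 0 < d * sin (2 * pi * s)" 
    if z: "cos (2 * pi * s) = 0" for s
  proof (intro exI conjI)
    show "(cone_form ?X (\<lambda>s. 1) has_real_derivative sin (2 * pi * s) * (4 * pi)) (at s)"
      unfolding q by (auto intro!: derivative_eq_intros simp: z)
    have "sin (2 * pi * s) * sin (2 * pi * s) = 1" 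
      using sin_cos_squared_add[of "2 * pi * s"] that by (simp add: power2_eq_square)
    then have "sin (2 * pi * s) * (4 * pi) * sin (2 * pi * s) = 4 * pi" by (simp add: mult_ac)
    then show "0 < sin (2 * pi * s) * (4 * pi) * sin (2 * pi * s)" by simp
  qed
qed (auto intro!: C1_intros)

text \<open>
  Replacing the height by \<open>sin (2 * pi * s)\<close>. Each height used here exceeds its mirror image
  under \<open>s \<mapsto> - s\<close> by a positive multiple of \<open>sin (2 * pi * s)\<close>, so
  \<open>embedded_planar_curve\<close> applies throughout.
\<close>

lemma isotopic_curves_flatten_circle:
  "isotopic_curves 1 (cone_knot 1 (\<lambda>s. of_real (1 - cos (2 * pi * s))) (\<lambda>s. 1))
     (\<lambda>s. ((of_real (1 - cos (2 * pi * s)), sin (2 * pi * s)), 1))"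
proof -
  define N where "N s = norm (complex_of_real (1 - cos (2 * pi * s)), 1::real)" for s
  define z where "z s u = (1 - u) * (height 1 s * N s) + u * sin (2 * pi * s)" for s u
  have Npos: "N s > 0" for s by (simp add: N_def zero_prod_def)
  have CN: "C1_on UNIV N" unfolding N_def[abs_def] by (intro C1_intros) (simp add: zero_prod_def)
  have sh: "cos (2 * pi * (s + 1)) = cos (2 * pi * s)" "sin (2 * pi * (s + 1)) = sin (2 * pi * s)" for s
    using cos_two_pi_shift[of s 1] by simp_all
  show ?thesis
  proof (rule isotopic_curvesI[where K="\<lambda>s u. ((of_real (1 - cos (2 * pi * s)), z s u), 1)"])
    show "C1_on UNIV (\<lambda>x. ((of_real (1 - cos (2 * pi * fst x)), z (fst x) (step (snd x))), 1) :: r4)"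
      unfolding z_def by (intro C1_intros C1_compose[OF CN])
    show "embedded_curve 1 (\<lambda>s. ((of_real (1 - cos (2 * pi * s)), z s u), 1) :: r4)" if u: "0 \<le> u" "u \<le> 1" for u
    proof (rule embedded_planar_curve)
      have pos: "(1 - u) * N s + u > 0" for s
        using Npos[of s] u by (cases "u = 0") (simp_all add: add_nonneg_pos)
      show "C1_on UNIV (\<lambda>s. z s u)" unfolding z_def by (intro C1_intros CN)
      show "z (s + 1) u = z s u" for s
        by (simp add: z_def height_def N_def sh)
      show "z s u \<noteq> z (- s) u" if "sin (2 * pi * s) \<noteq> 0" for s
      proof
        assume "z s u = z (- s) u"
        moreover have "N (- s) = N s" by (simp add: N_def)
        ultimately have "2 * sin (2 * pi * s) * ((1 - u) * N s + u) = 0"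
          by (simp add: z_def height_def algebra_simps)
        then show False using that pos[of s] by simp
      qed
      show "\<not> ((\<lambda>s. z s u) has_real_derivative 0) (at s)" if s: "sin (2 * pi * s) = 0" for s
      proof
        assume d0: "((\<lambda>s. z s u) has_real_derivative 0) (at s)"
        have "((\<lambda>s. complex_of_real (1 - cos (2 * pi * s))) has_vector_derivative 0) (at s)"
        proof -
          have "((\<lambda>s. 1 - cos (2 * pi * s)) has_real_derivative 0) (at s)"
            by (auto intro!: derivative_eq_intros simp: s)
          then show ?thesis using has_vector_derivative_of_real by fastforce
        qed
        then have "(N has_real_derivative 0 * N s) (at s)"
          unfolding N_def[abs_def]
          by (intro norm_Pair_derivative) (simp_all add: zero_prod_def)
        then have dN: "(N has_real_derivative 0) (at s)" by simp
        have "((\<lambda>s. z s u) has_real_derivative 2 * pi * cos (2 * pi * s) * ((1 - u) * N s + u)) (at s)"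
          unfolding z_def height_def by (auto intro!: derivative_eq_intros dN simp: algebra_simps)
        with d0 have "2 * pi * cos (2 * pi * s) * ((1 - u) * N s + u) = 0" using DERIV_unique by fastforce
        then have "cos (2 * pi * s) = 0" using pos[of s] by simp
        then show False using s sin_cos_not_both_0 by blast
      qed
    qed
  qed (simp_all add: z_def cone_knot_def N_def)
qed

text \<open>
  The circle, lying in the vertical plane \<open>Im h = 0\<close>, is turned into the equatorial plane \<open>z = 0\<close>, centred at the
  origin and scaled by \<open>4/3\<close>, the ratio \<open>h / w\<close> that corresponds to distance \<open>1/2\<close> from the centre of the ball.
\<close>

lemma isotopic_curves_turn_circle:
  "isotopic_curves 1 (\<lambda>s. ((of_real (1 - cos (2 * pi * s)), sin (2 * pi * s)), 1))
     (\<lambda>s. ((Complex (- 4 / 3 * cos (2 * pi * s)) (4 / 3 * sin (2 * pi * s)), 0), 1))"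
proof (rule isotopic_curvesI[where K="\<lambda>s u. ((Complex ((1 + u / 3) * (1 - u - cos (2 * pi * s))) ((1 + u / 3) * u * sin (2 * pi * s)),
     (1 - u) * sin (2 * pi * s)), 1)"])
  show "C1_on UNIV (\<lambda>x. ((Complex ((1 + step (snd x) / 3) * (1 - step (snd x) - cos (2 * pi * fst x))) 
      ((1 + step (snd x) / 3) * step (snd x) * sin (2 * pi * fst x)),
     (1 - step (snd x)) * sin (2 * pi * fst x)), 1) :: r4)"
    unfolding Complex_eq by (intro C1_intros) simp_all
  fix u :: real assume u: "0 \<le> u" "u \<le> 1"
  let ?c = "\<lambda>s. ((Complex ((1 + u / 3) * (1 - u - cos (2 * pi * s))) ((1 + u / 3) * u * sin (2 * pi * s)),
     (1 - u) * sin (2 * pi * s)), 1) :: r4"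
  have u': "1 + u / 3 \<noteq> 0" using u by simp
  show "embedded_curve 1 ?c"
    unfolding embedded_curve_def
  proof (intro conjI allI impI)
    show "C1_on UNIV ?c" unfolding Complex_eq by (intro C1_intros) simp_all
    show "?c (s + 1) = 1 *\<^sub>R ?c s" for s
      using cos_two_pi_shift[of s 1] by simp
    show "?c s \<noteq> 0" for s by (simp add: zero_prod_def)
    show "s - t \<in> \<int>" if "?c s = l *\<^sub>R ?c t" for s t l
    proof -
      have l: "l = 1" using that unfolding r4_scaleR_eq by simp
      have c: "cos (2 * pi * s) = cos (2 * pi * t)" and b: "u * sin (2 * pi * s) = u * sin (2 * pi * t)"
        "(1 - u) * sin (2 * pi * s) = (1 - u) * sin (2 * pi * t)"
        using that u' unfolding r4_scaleR_eq l by simp_all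
      have s: "sin (2 * pi * s) = sin (2 * pi * t)" 
      proof -
        have "u * sin (2 * pi * s) + (1 - u) * sin (2 * pi * s) = u * sin (2 * pi * t) + (1 - u) * sin (2 * pi * t)"
          unfolding b ..
        then show ?thesis unfolding distrib_right[symmetric] by simp
      qed
      have "cos (2 * pi * s - 2 * pi * t) = 1" unfolding cos_diff c s
        using sin_cos_squared_add2[of "2 * pi * t"] by simp
      then obtain n :: int where "2 * pi * s - 2 * pi * t = of_int n * 2 * pi"
        using cos_one_2pi_int by blast
      then have "2 * pi * (s - t) = 2 * pi * of_int n" by (simp add: algebra_simps)
      then show ?thesis by simp
    qed
    show "v \<noteq> l *\<^sub>R ?c s" if v: "(?c has_vector_derivative v) (at s)" for s v l
    proof
      assume veq: "v = l *\<^sub>R ?c s"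
      have "((\<lambda>s. 1::real) has_real_derivative l) (at s)"
        using has_vector_derivative_r4D(3)[OF v] unfolding veq by simp
      then have l: "l = 0" by (metis DERIV_const DERIV_unique)
      have 1: "((\<lambda>s. Complex ((1 + u / 3) * (1 - u - cos (2 * pi * s))) ((1 + u / 3) * u * sin (2 * pi * s))) 
           has_vector_derivative 0) (at s)"
        and 2: "((\<lambda>s. (1 - u) * sin (2 * pi * s)) has_real_derivative 0) (at s)"
        using has_vector_derivative_r4D[OF v] unfolding veq l by simp_all
      have 3: "((\<lambda>s. (1 + u / 3) * (1 - u - cos (2 * pi * s))) has_real_derivative 0) (at s)"
        and 4: "((\<lambda>s. (1 + u / 3) * u * sin (2 * pi * s)) has_real_derivative 0) (at s)"
        using bounded_linear.has_vector_derivative[OF bounded_linear_Re 1] bounded_linear.has_vector_derivative[OF bounded_linear_Im 1] 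
        by (simp_all add: has_real_derivative_iff_has_vector_derivative)
      have "((\<lambda>s. (1 + u / 3) * (1 - u - cos (2 * pi * s))) has_real_derivative (1 + u / 3) * (sin (2 * pi * s) * (2 * pi))) (at s)"
        by (auto intro!: derivative_eq_intros)
      with 3 have s: "sin (2 * pi * s) = 0" using DERIV_unique u' by fastforce
      have "((\<lambda>s. (1 + u / 3) * u * sin (2 * pi * s)) has_real_derivative (1 + u / 3) * u * (cos (2 * pi * s) * (2 * pi))) (at s)"
        by (auto intro!: derivative_eq_intros)
      with 4 have c1: "u * cos (2 * pi * s) = 0" using DERIV_unique u' by fastforce
      have "((\<lambda>s. (1 - u) * sin (2 * pi * s)) has_real_derivative (1 - u) * (cos (2 * pi * s) * (2 * pi))) (at s)"
        by (auto intro!: derivative_eq_intros)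
      with 2 have c2: "(1 - u) * cos (2 * pi * s) = 0" using DERIV_unique by fastforce
      have "cos (2 * pi * s) = 0" 
      proof -
        have "u * cos (2 * pi * s) + (1 - u) * cos (2 * pi * s) = 0" unfolding c1 c2 by simp
        then show ?thesis unfolding distrib_right[symmetric] by simp
      qed
      then show False using s sin_cos_not_both_0 by blast
    qed
  qed
qed (simp_all add: complex_of_real_def)

lemma knot_of_circle:
  "knot_of (\<lambda>s. ((Complex (- 4 / 3 * cos (2 * pi * s)) (4 / 3 * sin (2 * pi * s)), 0), 1)) = planar_circle"
proof -
  let ?d = "\<lambda>s. ((Complex (- 4 / 3 * cos (2 * pi * s)) (4 / 3 * sin (2 * pi * s)), 0), 1) :: r4"
  have n: "norm (?d s) = 5 / 3" for s
  proof (rule power2_eq_imp_eq)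
    have "(norm (?d s))\<^sup>2 = (cmod (Complex (- 4 / 3 * cos (2 * pi * s)) (4 / 3 * sin (2 * pi * s))))\<^sup>2 + 1"
      by (simp add: norm_Pair)
    also have "\<dots> = 16 / 9 * ((sin (2 * pi * s))\<^sup>2 + (cos (2 * pi * s))\<^sup>2) + 1"
      unfolding cmod_power2 complex.sel power_mult_distrib distrib_left by (simp add: power2_eq_square)
    also have "\<dots> = (5 / 3)\<^sup>2" unfolding sin_cos_squared_add by (simp add: power2_eq_square)
    finally show "(norm (?d s))\<^sup>2 = (5 / 3)\<^sup>2" .
  qed simp_all
  have st: "stereo (sgn (?d s)) = (Complex (- (1 / 2) * cos (2 * pi * s)) (1 / 2 * sin (2 * pi * s)), 0)" for s
    unfolding sgn_div_norm n by (simp add: stereo_def complex_eq_iff)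
  show ?thesis
  proof
    show "knot_of ?d \<subseteq> planar_circle"
      unfolding knot_of_def cover_eq st planar_circle_def
    proof (rule image_subsetI)
      fix s
      let ?h = "Complex (- (1 / 2) * cos (2 * pi * s)) (1 / 2 * sin (2 * pi * s))"
      have "(cmod ?h)\<^sup>2 = 1 / 4 * ((sin (2 * pi * s))\<^sup>2 + (cos (2 * pi * s))\<^sup>2)"
        unfolding cmod_power2 complex.sel power_mult_distrib distrib_left by (simp add: power2_eq_square)
      then have "(cmod ?h)\<^sup>2 = (1 / 2)\<^sup>2" unfolding sin_cos_squared_add by (simp add: power2_eq_square)
      then have "cmod ?h = 1 / 2" by (rule power2_eq_imp_eq) simp_all
      then have "?h \<in> sphere 0 (1 / 2)" by simp
      then show "abs_rp (?h, 0::real) \<in> (\<lambda>h. abs_rp (h, 0)) ` sphere 0 (1 / 2)" by blast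
    qed
    show "planar_circle \<subseteq> knot_of ?d"
    proof
      fix x assume "x \<in> planar_circle"
      then obtain h :: complex where h: "cmod h = 1 / 2" "x = abs_rp (h, 0)"
        unfolding planar_circle_def by auto
      have "h = of_real (1 / 2) * cis (Arg h)" by (metis rcis_cmod_Arg rcis_def h(1))
      then have hh: "h = Complex (1 / 2 * cos (Arg h)) (1 / 2 * sin (Arg h))"
        by (metis Im_rcis Re_rcis complex_surj h(1) rcis_cmod_Arg)
      define s where "s = (pi - Arg h) / (2 * pi)"
      have "2 * pi * s = pi - Arg h" by (simp add: s_def)
      then have "stereo (sgn (?d s)) = (h, 0)" unfolding st by (subst hh) simp
      then have "x = cover (sgn (?d s))" unfolding cover_eq h(2) by simp
      then show "x \<in> knot_of ?d" unfolding knot_of_def by blast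
    qed
  qed
qed

text \<open>
  The class \<open>\<sigma>\<close> decides which unknot arises. The model shadows are a circle through the axis, traversed
  once, if \<open>\<sigma> = 1\<close>, and a projective line if \<open>\<sigma> = -1\<close>.
\<close>

theorem unknot_cone_knot:
  assumes c: "cone_curve \<sigma> X Y" and \<sigma>: "\<bar>\<sigma>\<bar> = 1" and Y0: "Y 0 > 0"
  shows "\<exists>d. isotopic_curves \<sigma> (cone_knot \<sigma> X Y) d \<and> (knot_of d = planar_circle \<or> knot_of d = projective_line)"
proof -
  obtain x where x: "cone_curve \<sigma> (\<lambda>s. of_real (x s)) Y" 
    "isotopic_curves \<sigma> (cone_knot \<sigma> X Y) (cone_knot \<sigma> (\<lambda>s. of_real (x s)) Y)"
    "\<And>s. s \<in> {1/4..3/4} \<Longrightarrow> x s \<ge> 0"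
    using isotopic_curves_to_real_cone_curve[OF c \<sigma>] by blast
  show ?thesis
    using \<sigma>
  proof (rule abs_eq_1_cases)
    assume 1: "\<sigma> = 1"
    have "isotopic_curves \<sigma> (cone_knot \<sigma> (\<lambda>s. of_real (x s)) Y) (cone_knot \<sigma> (\<lambda>s. of_real (1 - cos (2 * pi * s))) (\<lambda>s. 1))"
      by (rule isotopic_curves_convex[OF \<sigma> x(1,3) Y0]) (use 1 cone_curve_circle in simp_all)
    then show ?thesis
      using isotopic_curves_trans[OF isotopic_curves_trans[OF isotopic_curves_trans[OF x(2)] isotopic_curves_flatten_circle[folded 1]] isotopic_curves_turn_circle[folded 1]] 
        knot_of_circle 1 by blast
  next
    assume 1: "\<sigma> = -1"
    have p: "sin (pi * s) \<ge> 0" if "s \<in> {1/4..3/4}" for s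
      using that by (intro sin_ge_zero) auto
    have "isotopic_curves \<sigma> (cone_knot \<sigma> (\<lambda>s. of_real (x s)) Y) (cone_knot \<sigma> (\<lambda>s. of_real (sin (pi * s))) (\<lambda>s. cos (pi * s)))"
      by (rule isotopic_curves_convex[OF \<sigma> x(1,3) Y0]) (use 1 cone_curve_line p in simp_all)
    moreover have "isotopic_curves \<sigma> (cone_knot \<sigma> (\<lambda>s. of_real (sin (pi * s))) (\<lambda>s. cos (pi * s)))
       (\<lambda>s. ((of_real (sin (pi * s)), 0), cos (pi * s)))"
    proof (rule isotopic_curvesI[where K="\<lambda>s u. ((of_real (sin (pi * s)), (1 - u) * height \<sigma> s), cos (pi * s))"])
      show "C1_on UNIV (\<lambda>x. ((of_real (sin (pi * fst x)), (1 - step (snd x)) * height \<sigma> (fst x)), cos (pi * fst x)) :: r4)"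
        by (intro C1_intros)
      show "embedded_curve \<sigma> (\<lambda>s. ((of_real (sin (pi * s)), (1 - u) * height \<sigma> s), cos (pi * s)) :: r4)" for u
        unfolding 1 by (rule embedded_over_projective_line) (intro C1_intros | simp add: height_plus_1)+
    qed (simp_all add: cone_knot_def norm_Pair)
    ultimately show ?thesis
      using isotopic_curves_trans[OF isotopic_curves_trans[OF x(2)]] knot_of_line by blast
  qed
qed

section \<open>Descending curves\<close>

text \<open>
  A circle diffeomorphism taking the arc \<open>[-1/4, 1/4]\<close> to a given shorter one. Before the translation it is induced by a
  Moebius transformation of the unit disk: its derivative is the Poisson kernel
  \<open>(1 - \<tau>\<^sup>2) / (1 + 2 * \<tau> * cos (2 * pi * s) + \<tau>\<^sup>2)\<close>.
\<close>

lemma circle_reparametrisation: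
  assumes l: "0 < l" "l < 1/4"
  obtains \<phi> :: "real \<Rightarrow> real" where "C1_on UNIV \<phi>" "\<And>s. \<phi> (s + 1) = \<phi> s + 1" "\<phi> (1/4) = e + l" "\<phi> (-1/4) = e - l"
    "\<And>s. \<exists>d>0. (\<phi> has_real_derivative d) (at s)"
proof -
  \<comment> \<open>This choice makes \<open>\<phi> (1/4) - e = 1/4 - arctan \<tau> / pi\<close> equal to \<open>l\<close>.\<close>
  define \<tau> where "\<tau> = tan (pi * (1/4 - l))"
  have b: "0 < pi * (1/4 - l)" "pi * (1/4 - l) < pi / 4" using l by (simp_all add: right_diff_distrib)
  have \<tau>: "0 < \<tau>" "\<tau> < 1"
    using tan_gt_zero[of "pi * (1/4 - l)"] tan_monotone[of "pi * (1/4 - l)" "pi / 4"] b by (simp_all add: \<tau>_def tan_45)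
  have at: "arctan \<tau> = pi * (1/4 - l)" unfolding \<tau>_def by (rule arctan_tan) (use b in linarith)+
  define B where "B s = 1 + \<tau> * cos (2 * pi * s)" for s
  have Bpos: "B s > 0" for s
  proof -
    have "\<tau> * - cos (2 * pi * s) \<le> \<tau> * 1" using \<tau> by (intro mult_left_mono) auto
    then show ?thesis using \<tau> by (simp add: B_def)
  qed
  define \<phi> where "\<phi> s = s - arctan (\<tau> * sin (2 * pi * s) / B s) / pi + e" for s
  show ?thesis
  proof (rule that)
    have C1B: "C1_on UNIV B" unfolding B_def[abs_def] by (intro C1_intros)
    show "C1_on UNIV \<phi>" unfolding \<phi>_def[abs_def] by (intro C1_intros C1B) (use Bpos in \<open>auto simp: less_imp_neq[symmetric]\<close>)
    show "\<phi> (s + 1) = \<phi> s + 1" for s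
      using cos_two_pi_shift[of s 1] by (simp add: \<phi>_def B_def)
    show "\<phi> (1/4) = e + l"
      unfolding \<phi>_def B_def cos_sin_two_pi_quarter by (simp add: at right_diff_distrib diff_divide_distrib)
    have "2 * pi * (-1/4) = - (2 * pi * (1/4))" by simp
    then have "sin (2 * pi * (-1/4)) = -1" "cos (2 * pi * (-1/4)) = 0"
      using cos_sin_two_pi_quarter(1,2) by (simp_all only: sin_minus cos_minus)
    then show "\<phi> (-1/4) = e - l"
      unfolding \<phi>_def B_def by (simp add: arctan_minus at right_diff_distrib diff_divide_distrib)
    show "\<exists>d>0. (\<phi> has_real_derivative d) (at s)" for s
    proof (intro exI conjI)
      let ?A = "\<tau> * sin (2 * pi * s)" and ?A' = "\<tau> * (cos (2 * pi * s) * (2 * pi))"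
        and ?B' = "\<tau> * (- sin (2 * pi * s) * (2 * pi))"
      let ?q = "(?A' * B s - ?A * ?B') / (B s * B s)"
      have dA: "((\<lambda>s. \<tau> * sin (2 * pi * s)) has_real_derivative ?A') (at s)"
        by (auto intro!: derivative_eq_intros)
      have dB: "(B has_real_derivative ?B') (at s)"
        unfolding B_def[abs_def] by (auto intro!: derivative_eq_intros)
      have "((\<lambda>s. arctan (\<tau> * sin (2 * pi * s) / B s)) has_real_derivative inverse (1 + (?A / B s)\<^sup>2) * ?q) (at s)"
        by (rule DERIV_chain2[OF DERIV_arctan DERIV_divide[OF dA dB]]) (use Bpos[of s] in simp)
      then have "(\<phi> has_real_derivative 1 - inverse (1 + (?A / B s)\<^sup>2) * ?q / pi + 0) (at s)"
        unfolding \<phi>_def[abs_def] by (intro DERIV_add DERIV_diff DERIV_cdivide DERIV_ident DERIV_const)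
      then show "(\<phi> has_real_derivative 1 - inverse (1 + (?A / B s)\<^sup>2) * ?q / pi) (at s)" by simp
      have sc: "(sin (2 * pi * s))\<^sup>2 = 1 - (cos (2 * pi * s))\<^sup>2" by (simp add: sin_squared_eq)
      have D: "(B s)\<^sup>2 + ?A\<^sup>2 = 1 + 2 * \<tau> * cos (2 * pi * s) + \<tau>\<^sup>2"
        unfolding B_def power_mult_distrib sc by (simp add: power2_eq_square algebra_simps)
      have N: "?A' * B s - ?A * ?B' = 2 * pi * (\<tau> * cos (2 * pi * s) + \<tau>\<^sup>2)"
      proof -
        have "?A' * B s - ?A * ?B' = 2 * pi * (\<tau> * cos (2 * pi * s) + \<tau>\<^sup>2 * ((cos (2 * pi * s))\<^sup>2 + (sin (2 * pi * s))\<^sup>2))"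
          unfolding B_def by algebra
        then show ?thesis by simp
      qed
      have Dpos: "(B s)\<^sup>2 + ?A\<^sup>2 > 0" using Bpos[of s] by (intro add_pos_nonneg) auto
      have "inverse (1 + (?A / B s)\<^sup>2) * ?q = (?A' * B s - ?A * ?B') / ((B s)\<^sup>2 + ?A\<^sup>2)"
      proof -
        have "1 + (?A / B s)\<^sup>2 = ((B s)\<^sup>2 + ?A\<^sup>2) / (B s * B s)"
          using Bpos[of s] by (simp add: power2_eq_square field_simps)
        then show ?thesis using Bpos[of s] by simp
      qed
      then have "inverse (1 + (?A / B s)\<^sup>2) * ?q / pi = 2 * (\<tau> * cos (2 * pi * s) + \<tau>\<^sup>2) / ((B s)\<^sup>2 + ?A\<^sup>2)"
        unfolding N by simp
      also have "\<dots> < 1"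
      proof -
        have "\<tau>\<^sup>2 < 1" using \<tau> by (simp add: abs_square_less_1)
        then have "2 * (\<tau> * cos (2 * pi * s) + \<tau>\<^sup>2) < (B s)\<^sup>2 + ?A\<^sup>2" unfolding D by simp
        then show ?thesis using Dpos by simp
      qed
      finally show "0 < 1 - inverse (1 + (?A / B s)\<^sup>2) * ?q / pi" by simp
    qed
  qed
qed

text \<open>
  The constant \<open>1/4\<close> leaves room for the three error terms: \<open>1 - 1/4 - 1/4 - 1/16 > 0\<close>.
\<close>

lemma inner_perturbed_pos:
  fixes V a b :: "'a::real_inner"
  assumes "V \<noteq> 0" "norm a \<le> norm V / 4" "norm b \<le> norm V / 4"
  shows "(V + a) \<bullet> (V + b) > 0"
proof -
  have bound: "\<bar>x \<bullet> y\<bar> \<le> A * B" if "norm x \<le> A" "norm y \<le> B" for x y :: 'a and A B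
    by (rule order_trans[OF Cauchy_Schwarz_ineq2]) (use that in \<open>auto intro!: mult_mono intro: order_trans[OF norm_ge_zero]\<close>)
  have "\<bar>V \<bullet> b\<bar> \<le> norm V * (norm V / 4)" "\<bar>a \<bullet> V\<bar> \<le> (norm V / 4) * norm V" "\<bar>a \<bullet> b\<bar> \<le> (norm V / 4) * (norm V / 4)"
    by (intro bound assms order_refl)+
  moreover have "(V + a) \<bullet> (V + b) = norm V * norm V + V \<bullet> b + a \<bullet> V + a \<bullet> b"
    by (simp add: inner_add_left inner_add_right power2_norm_eq_inner[symmetric] power2_eq_square)
  moreover have "norm V * norm V > 0" using assms by simp
  ultimately show ?thesis by simp
qed

text \<open>
  The lift of a descending diagram. Its shadow \<open>(h, w)\<close> is immersed, first passes are over
  in homogeneous coordinates, and the basepoint \<open>s = 0\<close> is neither a crossing nor at infinity.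
\<close>

locale descending_curve =
  fixes \<sigma> :: real and h :: "real \<Rightarrow> complex" and z w :: "real \<Rightarrow> real"
  assumes \<sigma>: "\<bar>\<sigma>\<bar> = 1"
    and C1_h: "C1_on UNIV h" and C1_z: "C1_on UNIV z" and C1_w: "C1_on UNIV w"
    and h_plus_1: "h (s + 1) = \<sigma> *\<^sub>R h s" and z_plus_1: "z (s + 1) = \<sigma> * z s" and w_plus_1: "w (s + 1) = \<sigma> * w s"
    and shadow_nonzero: "h s \<noteq> 0 \<or> w s \<noteq> 0"
    and shadow_immersed: "(h has_vector_derivative h') (at s) \<Longrightarrow> (w has_real_derivative w') (at s) \<Longrightarrow> 
      h' = l *\<^sub>R h s \<Longrightarrow> w' \<noteq> l * w s"
    and first_over: "0 \<le> s \<Longrightarrow> s < t \<Longrightarrow> t < 1 \<Longrightarrow> h s = l *\<^sub>R h t \<Longrightarrow> w s = l * w t \<Longrightarrow> l * z t < z s"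
    and base_simple: "0 < s \<Longrightarrow> s < 1 \<Longrightarrow> h s = l *\<^sub>R h 0 \<Longrightarrow> w s \<noteq> l * w 0"
    and w_0: "w 0 > 0"
begin

text \<open>
  The linear map \<open>(h, w) \<mapsto> (h - w * base_slope, w)\<close> takes the basepoint of the shadow to the
  \<open>w\<close>-axis. Being linear, it does not affect which times are crossings.
\<close>

definition "base_slope = h 0 /\<^sub>R w 0"
definition "sheared s = h s - w s *\<^sub>R base_slope"

lemma sheared_0: "sheared 0 = 0" using w_0 by (simp add: sheared_def base_slope_def)

lemma C1_sheared: "C1_on UNIV sheared" unfolding sheared_def[abs_def] by (intro C1_intros C1_h C1_w)

lemma sheared_plus_1: "sheared (s + 1) = \<sigma> *\<^sub>R sheared s"
  by (simp add: sheared_def h_plus_1 w_plus_1 scaleR_right_diff_distrib)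

lemma sheared_nonzero: "0 < s \<Longrightarrow> s < 1 \<Longrightarrow> sheared s \<noteq> 0"
proof
  assume s: "0 < s" "s < 1" and "sheared s = 0"
  then have "h s = (w s / w 0) *\<^sub>R h 0" by (simp add: sheared_def base_slope_def divide_inverse)
  then show False using base_simple[OF s, of "w s / w 0"] w_0 by simp
qed

text \<open>
  The shadow in the affine chart \<open>w = 1\<close>, with the basepoint at the origin.
\<close>

definition "slope s = inverse (w s) *\<^sub>R sheared s"

text \<open>
  Near the basepoint the shadow is almost a straight line with nonzero velocity \<open>V\<close>.
\<close>

lemma slope_near_base:
  obtains V v' \<delta> where "V \<noteq> 0" "0 < \<delta>" "\<delta> < 1/4" 
    "\<And>t. \<bar>t\<bar> \<le> \<delta> \<Longrightarrow> w t > 0" "\<And>t. \<bar>t\<bar> \<le> \<delta> \<Longrightarrow> (slope has_vector_derivative v' t) (at t)" 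
    "\<And>t. \<bar>t\<bar> \<le> \<delta> \<Longrightarrow> norm (v' t - V) \<le> norm V / 4"
proof -
  define S where "S = {t. w t > 0}"
  have cw: "continuous_on UNIV w" by (rule C1_on_imp_continuous_on[OF C1_w])
  have oS: "open S" unfolding S_def by (intro open_Collect_less continuous_intros cw)
  have "C1_on S slope" unfolding slope_def[abs_def]
    by (intro C1_intros C1_on_subset[OF C1_sheared] C1_on_subset[OF C1_w]) (auto simp: S_def)
  then obtain v' where v': "\<And>t. t \<in> S \<Longrightarrow> (slope has_vector_derivative v' t) (at t)" "continuous_on S v'"
    by (rule C1_on_realE) blast
  define V where "V = v' 0"
  have S0: "0 \<in> S" using w_0 by (simp add: S_def)
  have "V \<noteq> 0"
  proof
    assume "V = 0"
    obtain h' where h': "(h has_vector_derivative h') (at 0)" using C1_on_realE[OF C1_h] by (metis UNIV_I)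
    obtain w' where w': "(w has_vector_derivative w') (at 0)" using C1_on_realE[OF C1_w] by (metis UNIV_I)
    have dw: "(w has_real_derivative w') (at 0)" using w' by (simp add: has_real_derivative_iff_has_vector_derivative)
    have "((\<lambda>s. w s *\<^sub>R slope s) has_vector_derivative w 0 *\<^sub>R V + w' *\<^sub>R slope 0) (at 0)"
      unfolding V_def by (rule has_vector_derivative_scaleR[OF dw v'(1)[OF S0]])
    then have "((\<lambda>s. w s *\<^sub>R slope s) has_vector_derivative 0) (at 0)"
      using \<open>V = 0\<close> sheared_0 by (simp add: slope_def)
    then have "(sheared has_vector_derivative 0) (at 0)"
    proof (rule has_vector_derivative_transform_within_open)
      show "w s *\<^sub>R slope s = sheared s" if "s \<in> S" for s using that by (simp add: slope_def S_def)
    qed (fact oS S0)+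
    moreover have "(sheared has_vector_derivative h' - (w 0 *\<^sub>R 0 + w' *\<^sub>R base_slope)) (at 0)"
      unfolding sheared_def[abs_def] 
      by (intro has_vector_derivative_diff has_vector_derivative_scaleR h' dw has_vector_derivative_const)
    ultimately have "0 = h' - (w 0 *\<^sub>R 0 + w' *\<^sub>R base_slope)" by (rule vector_derivative_unique_at)
    then have "h' = (w' / w 0) *\<^sub>R h 0" by (simp add: base_slope_def divide_inverse)
    then show False using shadow_immersed[OF h' dw] w_0 by fastforce
  qed
  have "isCont v' 0" using v'(2) oS S0 continuous_on_eq_continuous_at by blast
  moreover have "norm V / 4 > 0" using \<open>V \<noteq> 0\<close> by simp
  ultimately obtain d1 where d1: "d1 > 0" "\<And>t. t \<noteq> 0 \<Longrightarrow> dist t 0 < d1 \<Longrightarrow> dist (v' t) (v' 0) < norm V / 4"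
    unfolding isCont_def LIM_def by blast
  obtain d2 where d2: "d2 > 0" "\<And>t. dist t 0 < d2 \<Longrightarrow> t \<in> S"
    using oS S0 unfolding open_dist by blast
  define d where "d = min d1 d2"
  have d: "d > 0" "\<And>t. dist t 0 < d \<Longrightarrow> t \<in> S \<and> dist (v' t) (v' 0) < norm V / 4"
  proof -
    show "d > 0" using d1 d2 by (simp add: d_def)
    show "t \<in> S \<and> dist (v' t) (v' 0) < norm V / 4" if "dist t 0 < d" for t
      using that d1(2)[of t] d2(2)[of t] \<open>V \<noteq> 0\<close> by (cases "t = 0") (auto simp: d_def)
  qed
  show ?thesis
  proof (rule that[of V "min (d/2) (1/8)" v'])
    show "w t > 0" "(slope has_vector_derivative v' t) (at t)" "norm (v' t - V) \<le> norm V / 4"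
      if "\<bar>t\<bar> \<le> min (d/2) (1/8)" for t
    proof -
      have "dist t 0 < d" using that d(1) by (simp add: dist_real_def)
      from d(2)[OF this] show "w t > 0" "(slope has_vector_derivative v' t) (at t)" "norm (v' t - V) \<le> norm V / 4"
        using v'(1) by (auto simp: S_def V_def dist_norm)
    qed
  qed (use \<open>V \<noteq> 0\<close> d in auto)
qed

text \<open>
  Negative inside the cone around the \<open>w\<close>-axis that meets the chart \<open>w = 1\<close> in the disk of radius \<open>sqrt r\<close>.
\<close>

definition "shadow_cone r s = (cmod (sheared s))\<^sup>2 - r * (w s)\<^sup>2"

lemma shadow_cone_plus_int: "shadow_cone r (s + of_int k) = shadow_cone r s"
proof -
  obtain e where "e \<in> {1,-1}" "\<forall>s. sheared (s + of_int k) = e *\<^sub>R sheared s"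
    using shift_by_int[where c=sheared, OF sheared_plus_1 \<sigma>] by blast
  then have "cmod (sheared (s + of_int k)) = cmod (sheared s)" by auto
  moreover obtain e where "e \<in> {1,-1}" "\<forall>s. w (s + of_int k) = e *\<^sub>R w s"
    using shift_by_int[where c=w, OF _ \<sigma>, of k] w_plus_1 by (metis real_scaleR_def)
  then have "(w (s + of_int k))\<^sup>2 = (w s)\<^sup>2" by auto
  ultimately show ?thesis by (simp add: shadow_cone_def)
qed

text \<open>
  In the chart \<open>w = 1\<close> the distance from the basepoint grows strictly along both directions in a time interval
  \<open>[-\<delta>, \<delta>]\<close>, and by compactness it is bounded below outside of it, as the
  basepoint is not a crossing. So a small disk around the basepoint meets the shadow in one
  short arc only, which enters and leaves it transversally.
\<close>

lemma separating_cone: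
  obtains r \<alpha> \<beta> a b where "0 < r" "0 < \<alpha>" "\<alpha> < 1/4" "0 < \<beta>" "\<beta> < 1/4" 
    "\<And>s. -\<alpha> < s \<Longrightarrow> s < \<beta> \<Longrightarrow> shadow_cone r s < 0" "\<And>s. \<beta> < s \<Longrightarrow> s < 1 - \<alpha> \<Longrightarrow> shadow_cone r s > 0"
    "shadow_cone r \<beta> = 0" "shadow_cone r (-\<alpha>) = 0"
    "(shadow_cone r has_real_derivative b) (at \<beta>)" "b > 0" "(shadow_cone r has_real_derivative a) (at (-\<alpha>))" "a < 0"
    "\<And>s. s \<in> {-\<alpha>..\<beta>} \<Longrightarrow> w s > 0"
    "\<And>s t l. s \<in> {-\<alpha>..\<beta>} \<Longrightarrow> t \<in> {-\<alpha>..\<beta>} \<Longrightarrow> sheared s = l *\<^sub>R sheared t \<Longrightarrow> w s = l * w t \<Longrightarrow> s = t"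
proof -
  obtain V v' \<delta> where V: "V \<noteq> 0" and \<delta>: "0 < \<delta>" "\<delta> < 1/4" 
    and wpos: "\<And>t. \<bar>t\<bar> \<le> \<delta> \<Longrightarrow> w t > 0" and v': "\<And>t. \<bar>t\<bar> \<le> \<delta> \<Longrightarrow> (slope has_vector_derivative v' t) (at t)" 
    and near: "\<And>t. \<bar>t\<bar> \<le> \<delta> \<Longrightarrow> norm (v' t - V) \<le> norm V / 4"
    using slope_near_base by metis
  have v0: "slope 0 = 0" by (simp add: slope_def sheared_0)
  have lin: "norm (slope t - t *\<^sub>R V) \<le> norm V / 4 * \<bar>t\<bar>" if "\<bar>t\<bar> \<le> \<delta>" for t
  proof -
    have "norm ((slope t - t *\<^sub>R V) - (slope 0 - 0 *\<^sub>R V)) \<le> norm V / 4 * norm (t - 0)"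
    proof (rule differentiable_bound[where S="{-\<delta>..\<delta>}" and f'="\<lambda>x y. y *\<^sub>R (v' x - V)"])
      show "((\<lambda>t. slope t - t *\<^sub>R V) has_derivative (\<lambda>y. y *\<^sub>R (v' x - V))) (at x within {-\<delta>..\<delta>})" if "x \<in> {-\<delta>..\<delta>}" for x
      proof -
        have "((\<lambda>t. t *\<^sub>R V) has_vector_derivative x *\<^sub>R 0 + 1 *\<^sub>R V) (at x)"
          by (intro has_vector_derivative_scaleR DERIV_ident has_vector_derivative_const)
        then have "((\<lambda>t. slope t - t *\<^sub>R V) has_vector_derivative v' x - (x *\<^sub>R 0 + 1 *\<^sub>R V)) (at x)"
          using v'[of x] that by (intro has_vector_derivative_diff) auto
        then show ?thesis unfolding has_vector_derivative_def by (simp add: has_derivative_at_withinI)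
      qed
      show "onorm (\<lambda>y. y *\<^sub>R (v' x - V)) \<le> norm V / 4" if "x \<in> {-\<delta>..\<delta>}" for x
      proof (rule onorm_le)
        show "norm (y *\<^sub>R (v' x - V)) \<le> norm V / 4 * norm y" for y
          using mult_left_mono[OF near[of x], of "\<bar>y\<bar>"] that by (simp add: mult.commute abs_le_iff)
      qed
    qed (use that \<delta> in auto)
    then show ?thesis by (simp add: v0)
  qed
  \<comment> \<open>The squared distance from the basepoint in the chart.\<close>
  define G where "G t = slope t \<bullet> slope t" for t
  have G': "(G has_real_derivative 2 * (slope t \<bullet> v' t)) (at t)" if "\<bar>t\<bar> \<le> \<delta>" for t
    unfolding G_def[abs_def] by (rule inner_self_derivative[OF v'[OF that]])
  have G0: "G 0 = 0" by (simp add: G_def v0)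
  have sgnG': "0 < t * (slope t \<bullet> v' t)" if t: "\<bar>t\<bar> \<le> \<delta>" "t \<noteq> 0" for t
  proof -
    define a where "a = (slope t - t *\<^sub>R V) /\<^sub>R t"
    have "norm a \<le> norm V / 4" using lin[OF t(1)] t(2) by (simp add: a_def divide_simps)
    then have "(V + a) \<bullet> (V + (v' t - V)) > 0" by (intro inner_perturbed_pos V near[OF t(1)])
    moreover have "slope t = t *\<^sub>R (V + a)" using t(2) by (simp add: a_def scaleR_right_distrib)
    ultimately have "t * (slope t \<bullet> v' t) = t\<^sup>2 * ((V + a) \<bullet> (V + (v' t - V)))"
      by (simp add: power2_eq_square)
    then show ?thesis using \<open>(V + a) \<bullet> (V + (v' t - V)) > 0\<close> t(2) by simp
  qed
  have contG: "continuous_on T G" if "T \<subseteq> {-\<delta>..\<delta>}" for T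
  proof (rule continuous_at_imp_continuous_on, rule ballI)
    show "isCont G x" if "x \<in> T" for x
      by (rule DERIV_isCont[OF G']) (use that \<open>T \<subseteq> {-\<delta>..\<delta>}\<close> in \<open>auto simp: abs_le_iff\<close>)
  qed
  have incr: "G s < G t" if "0 \<le> s" "s < t" "t \<le> \<delta>" for s t
  proof (rule DERIV_pos_imp_increasing_open[OF that(2)])
    show "\<exists>y. (G has_real_derivative y) (at x) \<and> 0 < y" if "s < x" "x < t" for x
      using G'[of x] sgnG'[of x] that \<open>0 \<le> s\<close> \<open>t \<le> \<delta>\<close> by (force simp: zero_less_mult_iff)
  qed (rule contG, use that in auto)
  have decr: "G t < G s" if "-\<delta> \<le> s" "s < t" "t \<le> 0" for s t
  proof (rule DERIV_neg_imp_decreasing_open[OF that(2)])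
    show "\<exists>y. (G has_real_derivative y) (at x) \<and> y < 0" if "s < x" "x < t" for x
      using G'[of x] sgnG'[of x] that \<open>-\<delta> \<le> s\<close> \<open>t \<le> 0\<close> by (force simp: zero_less_mult_iff)
  qed (rule contG, use that in auto)
  have cone_G: "shadow_cone r t = (w t)\<^sup>2 * (G t - r)" if "\<bar>t\<bar> \<le> \<delta>" for r t
  proof -
    have "sheared t = w t *\<^sub>R slope t" using wpos[OF that] by (simp add: slope_def)
    then have "(cmod (sheared t))\<^sup>2 = (w t)\<^sup>2 * G t" by (simp add: power_mult_distrib power2_norm_eq_inner G_def)
    then show ?thesis by (simp add: shadow_cone_def algebra_simps)
  qed
  have cu: "continuous_on T sheared" and cw: "continuous_on T w" for T
    using C1_on_imp_continuous_on[OF C1_on_subset[OF C1_sheared]] C1_on_imp_continuous_on[OF C1_on_subset[OF C1_w]] by auto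
  have ne: "{\<delta>..1-\<delta>} \<noteq> {}" using \<delta> by simp
  have "continuous_on {\<delta>..1-\<delta>} (\<lambda>x. (cmod (sheared x))\<^sup>2)" by (intro continuous_intros cu)
  from continuous_attains_inf[OF compact_Icc ne this]
  obtain x0 where x0: "x0 \<in> {\<delta>..1-\<delta>}" "\<And>y. y \<in> {\<delta>..1-\<delta>} \<Longrightarrow> (cmod (sheared x0))\<^sup>2 \<le> (cmod (sheared y))\<^sup>2" by blast
  have "continuous_on {\<delta>..1-\<delta>} (\<lambda>x. (w x)\<^sup>2)" by (intro continuous_intros cw)
  from continuous_attains_sup[OF compact_Icc ne this]
  obtain x1 where x1: "x1 \<in> {\<delta>..1-\<delta>}" "\<And>y. y \<in> {\<delta>..1-\<delta>} \<Longrightarrow> (w y)\<^sup>2 \<le> (w x1)\<^sup>2" by blast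
  define m where "m = (cmod (sheared x0))\<^sup>2"
  \<comment> \<open>Adding \<open>1\<close> keeps \<open>M\<close> positive even if \<open>w\<close> vanishes on the whole interval.\<close>
  define M where "M = (w x1)\<^sup>2 + 1"
  have m: "m > 0" using sheared_nonzero[of x0] x0(1) \<delta> by (auto simp: m_def)
  have M: "M > 0" by (simp add: M_def add_nonneg_pos)
  \<comment> \<open>The disk is so small that it misses the shadow at all times in \<open>[\<delta>, 1 - \<delta>]\<close> and that the
    shadow leaves it before the times \<open>\<delta>\<close> and \<open>-\<delta>\<close>.\<close>
  define r where "r = min (m / M) (min (G \<delta>) (G (-\<delta>))) / 2"
  have "G \<delta> > 0" "G (-\<delta>) > 0" using incr[of 0 \<delta>] decr[of "-\<delta>" 0] \<delta> G0 by auto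
  then have r: "0 < r" "r < G \<delta>" "r < G (-\<delta>)" "r < m / M"
  proof -
    let ?q = "min (m / M) (min (G \<delta>) (G (-\<delta>)))"
    have "?q \<le> m / M" "?q \<le> G \<delta>" "?q \<le> G (-\<delta>)" "?q > 0"
      using divide_pos_pos[OF m M] \<open>G \<delta> > 0\<close> \<open>G (-\<delta>) > 0\<close> by auto
    then show "0 < r" "r < G \<delta>" "r < G (-\<delta>)" "r < m / M" unfolding r_def by linarith+
  qed
  obtain \<beta> where \<beta>: "0 \<le> \<beta>" "\<beta> \<le> \<delta>" "G \<beta> = r"
    using IVT'[of G 0 r \<delta>, OF _ _ _ contG] r \<delta> G0 by force
  obtain \<gamma> where \<gamma>: "-\<delta> \<le> \<gamma>" "\<gamma> \<le> 0" "G \<gamma> = r"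
    using IVT2'[of G 0 r "-\<delta>", OF _ _ _ contG] r \<delta> G0 by force
  have \<beta>': "0 < \<beta>" using \<beta> r G0 by (cases "\<beta> = 0") auto
  have \<gamma>': "\<gamma> < 0" using \<gamma> r G0 by (cases "\<gamma> = 0") auto
  \<comment> \<open>Where \<open>G t = r\<close> the derivative of \<open>w\<close> does not contribute.\<close>
  have dcone: "(shadow_cone r has_real_derivative 2 * (w t)\<^sup>2 * (slope t \<bullet> v' t)) (at t)" if t: "\<bar>t\<bar> < \<delta>" "G t = r" for t
  proof -
    obtain w' where w': "(w has_vector_derivative w') (at t)" using C1_on_realE[OF C1_w] by (metis UNIV_I)
    have dw: "(w has_real_derivative w') (at t)" using w' by (simp add: has_real_derivative_iff_has_vector_derivative)
    have "((\<lambda>t. (w t)\<^sup>2 * (G t - r)) has_real_derivative 2 * (w t)\<^sup>2 * (slope t \<bullet> v' t)) (at t)"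
      using t by (auto intro!: derivative_eq_intros dw G')
    then show ?thesis
      by (rule has_field_derivative_transform_within_open[where S="{-\<delta><..<\<delta>}"]) (use t cone_G in \<open>auto simp: abs_less_iff\<close>)
  qed
  have \<beta>\<delta>: "\<beta> < \<delta>" using \<beta> r by (cases "\<beta> = \<delta>") auto
  have \<gamma>\<delta>: "-\<delta> < \<gamma>" using \<gamma> r by (cases "\<gamma> = -\<delta>") auto
  show ?thesis
  proof (rule that[of r "-\<gamma>" \<beta>])
    show "shadow_cone r s < 0" if "- (- \<gamma>) < s" "s < \<beta>" for s
    proof -
      have "G s < r" using incr[of s \<beta>] decr[of \<gamma> s] that \<beta> \<gamma> by (cases "s \<ge> 0") auto
      moreover have "\<bar>s\<bar> \<le> \<delta>" using that \<beta> \<gamma> by (auto simp: abs_le_iff)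
      ultimately show ?thesis using wpos[of s] by (simp add: cone_G mult_pos_neg)
    qed
    show "shadow_cone r s > 0" if "\<beta> < s" "s < 1 - (- \<gamma>)" for s
    proof -
      consider "s \<le> \<delta>" | "s \<in> {\<delta>..1-\<delta>}" | "s \<ge> 1 - \<delta>" by force
      then show ?thesis
      proof cases
        case 1
        have "G s > r" using incr[of \<beta> s] that \<beta> 1 by auto
        then show ?thesis using cone_G[of s r] wpos[of s] that \<beta> 1 by auto
      next
        case 2
        have "r * (w s)\<^sup>2 \<le> r * (w x1)\<^sup>2" using x1(2)[OF 2] r by simp
        also have "\<dots> < r * M" using r by (simp add: M_def)
        also have "\<dots> < m" using r(4) M by (simp add: field_simps)
        also have "\<dots> \<le> (cmod (sheared s))\<^sup>2" using x0(2)[OF 2] by (simp add: m_def)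
        finally show ?thesis by (simp add: shadow_cone_def)
      next
        case 3
        have "G (s - 1) > r" using decr[of "s - 1" \<gamma>] that \<gamma> 3 by auto
        then have "shadow_cone r (s - 1) > 0" using cone_G[of "s - 1" r] wpos[of "s - 1"] that \<gamma> 3 by auto
        then show ?thesis using shadow_cone_plus_int[of r s "-1"] by simp
      qed
    qed
    show "shadow_cone r \<beta> = 0" "shadow_cone r (- (- \<gamma>)) = 0" using cone_G \<beta> \<gamma> by auto
    show "(shadow_cone r has_real_derivative 2 * (w \<beta>)\<^sup>2 * (slope \<beta> \<bullet> v' \<beta>)) (at \<beta>)" by (rule dcone) (use \<beta> \<beta>' \<beta>\<delta> in auto)
    show "(shadow_cone r has_real_derivative 2 * (w \<gamma>)\<^sup>2 * (slope \<gamma> \<bullet> v' \<gamma>)) (at (- (- \<gamma>)))" unfolding minus_minus by (rule dcone) (use \<gamma> \<gamma>' \<gamma>\<delta> in auto)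
    have "slope \<beta> \<bullet> v' \<beta> > 0" using sgnG'[of \<beta>] \<beta> \<beta>' by (simp add: zero_less_mult_iff)
    then show "2 * (w \<beta>)\<^sup>2 * (slope \<beta> \<bullet> v' \<beta>) > 0" using wpos[of \<beta>] \<beta> by simp
    have "slope \<gamma> \<bullet> v' \<gamma> < 0" using sgnG'[of \<gamma>] \<gamma> \<gamma>' by (simp add: zero_less_mult_iff)
    then show "2 * (w \<gamma>)\<^sup>2 * (slope \<gamma> \<bullet> v' \<gamma>) < 0" using wpos[of \<gamma>] \<gamma> by (simp add: mult_pos_neg)
    show "w s > 0" if "s \<in> {- (- \<gamma>)..\<beta>}" for s using wpos[of s] that \<beta> \<gamma> by auto
    show "s = t" if s: "s \<in> {- (- \<gamma>)..\<beta>}" and t: "t \<in> {- (- \<gamma>)..\<beta>}" and eq: "sheared s = l *\<^sub>R sheared t" "w s = l * w t" for s t l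
    proof -
      have "w s > 0" "w t > 0" using wpos[of s] wpos[of t] s t \<beta> \<gamma> by auto
      moreover from this have "l \<noteq> 0" using eq(2) by auto
      ultimately have "slope s = slope t" using eq by (simp add: slope_def)
      define f where "f x = V \<bullet> slope x" for x
      have f': "(f has_real_derivative V \<bullet> v' x) (at x)" if "\<bar>x\<bar> \<le> \<delta>" for x
        unfolding f_def[abs_def] has_real_derivative_iff_has_vector_derivative
        by (rule bounded_linear.has_vector_derivative[OF bounded_linear_inner_right v'[OF that]])
      have f'pos: "V \<bullet> v' x > 0" if "\<bar>x\<bar> \<le> \<delta>" for x
        using inner_perturbed_pos[OF V, of 0 "v' x - V"] near[OF that] by simp
      have mono: "f x < f y" if "x < y" "-\<delta> \<le> x" "y \<le> \<delta>" for x y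
        by (rule DERIV_pos_imp_increasing[OF that(1)]) (use f' f'pos that in force)
      have "f s = f t" using \<open>slope s = slope t\<close> by (simp add: f_def)
      then show "s = t" using mono[of s t] mono[of t s] s t \<beta> \<gamma> by (cases s t rule: linorder_cases) auto
    qed
  qed (use r \<beta>' \<gamma>' \<beta> \<gamma> \<delta> in auto)
qed

end

context descending_curve begin

text \<open>
  The height is moved linearly to that of the cone knot, while the shadow undergoes linear isomorphisms. Proportional
  shadows are inside the cone together or outside together. Inside they come from the same
  time, as the arc is embedded; outside, both the old and the new height satisfy the descending condition,
  and so do their convex combinations.
\<close>

lemma isotopic_curves_cone_knot_reparametrised:
  obtains \<phi> X Y where "surj \<phi>" "cone_curve \<sigma> X Y" "Y 0 > 0"
    "isotopic_curves \<sigma> (\<lambda>s. ((h (\<phi> s), z (\<phi> s)), w (\<phi> s))) (cone_knot \<sigma> X Y)"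
proof -
  obtain r \<alpha> \<beta> a b where r: "0 < r" and \<alpha>\<beta>: "0 < \<alpha>" "\<alpha> < 1/4" "0 < \<beta>" "\<beta> < 1/4" 
    and neg: "\<And>s. -\<alpha> < s \<Longrightarrow> s < \<beta> \<Longrightarrow> shadow_cone r s < 0" and pos: "\<And>s. \<beta> < s \<Longrightarrow> s < 1 - \<alpha> \<Longrightarrow> shadow_cone r s > 0"
    and zero: "shadow_cone r \<beta> = 0" "shadow_cone r (-\<alpha>) = 0"
    and db: "(shadow_cone r has_real_derivative b) (at \<beta>)" "b > 0" 
    and da: "(shadow_cone r has_real_derivative a) (at (-\<alpha>))" "a < 0"
    and wpos: "\<And>s. s \<in> {-\<alpha>..\<beta>} \<Longrightarrow> w s > 0"
    and inj: "\<And>s t l. s \<in> {-\<alpha>..\<beta>} \<Longrightarrow> t \<in> {-\<alpha>..\<beta>} \<Longrightarrow> sheared s = l *\<^sub>R sheared t \<Longrightarrow> w s = l * w t \<Longrightarrow> s = t"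
    by (rule separating_cone) (rule that)
  obtain \<phi> where \<phi>: "C1_on UNIV \<phi>" "\<And>s. \<phi> (s + 1) = \<phi> s + 1" "\<phi> (1/4) = \<beta>" "\<phi> (-1/4) = -\<alpha>"
    "\<And>s. \<exists>d>0. (\<phi> has_real_derivative d) (at s)"
  proof (rule circle_reparametrisation[of "(\<alpha> + \<beta>) / 2" "(\<beta> - \<alpha>) / 2"])
    fix \<phi> assume "C1_on UNIV \<phi>" "\<And>s. \<phi> (s + 1) = \<phi> s + 1" "\<phi> (1/4) = (\<beta> - \<alpha>) / 2 + (\<alpha> + \<beta>) / 2"
      "\<phi> (-1/4) = (\<beta> - \<alpha>) / 2 - (\<alpha> + \<beta>) / 2" "\<And>s. \<exists>d>0. (\<phi> has_real_derivative d) (at s)"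
    then show thesis by (intro that[of \<phi>]) (simp_all add: field_simps)
  qed (use \<alpha>\<beta> in simp_all)
  have mono: "\<phi> s < \<phi> t" if "s < t" for s t
    by (rule DERIV_pos_imp_increasing[OF that]) (use \<phi>(5) in blast)
  have mono': "\<phi> s \<le> \<phi> t" if "s \<le> t" for s t using mono[of s t] that by (cases "s = t") auto
  have \<phi>_int: "\<phi> (s + of_int k) = \<phi> s + of_int k" for s k
  proof (induction k rule: int_induct[where k=0])
    case (step1 i)
    then show ?case using \<phi>(2)[of "s + of_int i"] by (simp add: algebra_simps)
  next
    case (step2 i)
    then show ?case using \<phi>(2)[of "s + of_int (i - 1)"] by (simp add: algebra_simps)
  qed simp
  have \<phi>34: "\<phi> (3/4) = 1 - \<alpha>" using \<phi>(2)[of "-1/4"] \<phi>(4) by simp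
  have surj: "surj \<phi>"
  proof -
    have "\<exists>s. \<phi> s = y" for y
    proof -
    define n where "n = \<lfloor>y - \<phi> 0\<rfloor>"
    have "\<phi> (of_int n) = \<phi> 0 + of_int n" using \<phi>_int[of 0 n] by simp
    then have "\<phi> (of_int n) \<le> y" "y \<le> \<phi> (of_int n + 1)"
      using \<phi>(2)[of "of_int n"] unfolding n_def by linarith+
    then show ?thesis
      using IVT'[of \<phi> "of_int n" y "of_int n + 1", OF _ _ _ C1_on_imp_continuous_on[OF C1_on_subset[OF \<phi>(1)]]] by auto
    qed
    then show ?thesis by (metis surjI)
  qed
  \<comment> \<open>Scaling by \<open>K\<close> turns the cone found above into the standard one.\<close>
  define K where "K = 1 / sqrt r"
  have K: "K > 0" using r by (simp add: K_def)
  define X where "X s = K *\<^sub>R sheared (\<phi> s)" for s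
  define Y where "Y s = w (\<phi> s)" for s
  have q: "cone_form X Y = (\<lambda>s. shadow_cone r (\<phi> s) / r)"
    using r by (simp add: cone_form_def X_def Y_def K_def shadow_cone_def fun_eq_iff power_mult_distrib power_divide field_simps)
  have lt_iff: "cmod (X s) < \<bar>Y s\<bar> \<longleftrightarrow> shadow_cone r (\<phi> s) < 0" "\<bar>Y s\<bar> < cmod (X s) \<longleftrightarrow> shadow_cone r (\<phi> s) > 0"
    "cmod (X s) = \<bar>Y s\<bar> \<longleftrightarrow> shadow_cone r (\<phi> s) = 0" for s
  proof -
    have *: "cmod (X s) < \<bar>Y s\<bar> \<longleftrightarrow> cone_form X Y s < 0" "\<bar>Y s\<bar> < cmod (X s) \<longleftrightarrow> cone_form X Y s > 0"
      using power_mono_iff[of "\<bar>Y s\<bar>" "cmod (X s)" 2] power_mono_iff[of "cmod (X s)" "\<bar>Y s\<bar>" 2]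
      by (auto simp: cone_form_def)
    have "cmod (X s) = \<bar>Y s\<bar> \<longleftrightarrow> \<not> cmod (X s) < \<bar>Y s\<bar> \<and> \<not> \<bar>Y s\<bar> < cmod (X s)" by linarith
    with * show "cmod (X s) < \<bar>Y s\<bar> \<longleftrightarrow> shadow_cone r (\<phi> s) < 0" "\<bar>Y s\<bar> < cmod (X s) \<longleftrightarrow> shadow_cone r (\<phi> s) > 0"
      "cmod (X s) = \<bar>Y s\<bar> \<longleftrightarrow> shadow_cone r (\<phi> s) = 0"
      using r unfolding q by (auto simp: divide_less_0_iff zero_less_divide_iff)
  qed
  have Xper: "X (s + 1) = \<sigma> *\<^sub>R X s" and Yper: "Y (s + 1) = \<sigma> * Y s" for s
    by (simp_all add: X_def Y_def \<phi>(2) sheared_plus_1 w_plus_1)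
  have C1X: "C1_on UNIV X" and C1Y: "C1_on UNIV Y"
    unfolding X_def[abs_def] Y_def[abs_def] by (intro C1_intros C1_compose[OF C1_sheared] C1_compose[OF C1_w] \<phi>(1))+
  have inner: "\<phi> s \<in> {-\<alpha>..\<beta>}" if "-1/4 \<le> s" "s \<le> 1/4" for s
    using mono'[OF that(1)] mono'[OF that(2)] \<phi> by simp
  have cone: "cone_curve \<sigma> X Y"
  proof -
    obtain d1 where d1: "d1 > 0" "(\<phi> has_real_derivative d1) (at (1/4))" using \<phi>(5) by blast
    obtain d2 where d2: "d2 > 0" "(\<phi> has_real_derivative d2) (at (3/4))" using \<phi>(5) by blast
    have da': "(shadow_cone r has_real_derivative a) (at (1 - \<alpha>))"
    proof -
      have "((\<lambda>x. shadow_cone r (x + 1)) has_real_derivative a) (at (-\<alpha>))"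
        using da(1) shadow_cone_plus_int[of r _ 1] by simp
      then show ?thesis using DERIV_shift[of "shadow_cone r" a "-\<alpha>" 1] by simp
    qed
    show ?thesis
    proof (rule cone_curveI_fundamental[OF \<sigma> C1X Xper C1Y Yper])
      show "cmod (X s) < \<bar>Y s\<bar>" if "\<bar>s\<bar> < 1/4" for s
        unfolding lt_iff by (rule neg) (use mono[of "-1/4" s] mono[of s "1/4"] that \<phi> in \<open>auto simp: abs_less_iff\<close>)
      show "\<bar>Y s\<bar> < cmod (X s)" if "1/4 < s" "s < 3/4" for s
        unfolding lt_iff by (rule pos) (use mono[of "1/4" s] mono[of s "3/4"] that \<phi>(3) \<phi>34 in auto)
      show "cmod (X (1/4)) = \<bar>Y (1/4)\<bar>" unfolding lt_iff \<phi> by (rule zero)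
      show "cmod (X (3/4)) = \<bar>Y (3/4)\<bar>" unfolding lt_iff \<phi>34 using zero(2) shadow_cone_plus_int[of r "-\<alpha>" 1] by simp
      show "(cone_form X Y has_real_derivative b * d1 / r) (at (1/4))"
        unfolding q by (intro DERIV_cdivide DERIV_chain2[OF _ d1(2)]) (simp add: \<phi> db)
      show "(cone_form X Y has_real_derivative a * d2 / r) (at (3/4))"
        unfolding q by (intro DERIV_cdivide DERIV_chain2[OF _ d2(2)]) (simp add: \<phi>34 da')
      show "b * d1 / r > 0" using db d1 r by simp
      show "a * d2 / r < 0" using da d2 r by (simp add: divide_neg_pos mult_neg_pos)
    qed
  qed
  define N where "N s = norm (X s, Y s)" for s
  have Npos: "N s > 0" for s using cone_curve_nonzero[OF cone, of s] by (simp add: N_def)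
  have C1N: "C1_on UNIV N" unfolding N_def[abs_def] by (intro C1_intros C1X C1Y cone_curve_nonzero[OF cone])
  have N_scale: "N s = \<bar>l\<bar> * N t" if "X s = l *\<^sub>R X t" "Y s = l * Y t" for s t l
    unfolding N_def that using norm_scaleR[of l "(X t, Y t)"] by simp
  define k where "k c = 1 - c + c * K" for c
  define c where "c s v = ((k v *\<^sub>R (h (\<phi> s) - (v * w (\<phi> s)) *\<^sub>R base_slope), (1 - v) * z (\<phi> s) + v * (height \<sigma> s * N s)), w (\<phi> s))" for s v
  have kpos: "k v > 0" if "0 \<le> v" "v \<le> 1" for v
    using that K unfolding k_def by (cases "v = 0") (simp_all add: add_nonneg_pos)
  have parallel: "h (\<phi> s) = l *\<^sub>R h (\<phi> t) \<and> w (\<phi> s) = l * w (\<phi> t) \<and> 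
     (1 - v) * z (\<phi> s) + v * (height \<sigma> s * N s) = l * ((1 - v) * z (\<phi> t) + v * (height \<sigma> t * N t))"
    if eq: "c s v = l *\<^sub>R c t v" and v: "0 \<le> v" "v \<le> 1" for s t v l
  proof -
    have a: "k v *\<^sub>R (h (\<phi> s) - (v * w (\<phi> s)) *\<^sub>R base_slope) = l *\<^sub>R k v *\<^sub>R (h (\<phi> t) - (v * w (\<phi> t)) *\<^sub>R base_slope)"
      and b: "(1 - v) * z (\<phi> s) + v * (height \<sigma> s * N s) = l * ((1 - v) * z (\<phi> t) + v * (height \<sigma> t * N t))"
      and w: "w (\<phi> s) = l * w (\<phi> t)"
      using eq unfolding c_def r4_scaleR_eq by blast+
    from a have "k v *\<^sub>R (h (\<phi> s) - (v * w (\<phi> s)) *\<^sub>R base_slope) = k v *\<^sub>R (l *\<^sub>R (h (\<phi> t) - (v * w (\<phi> t)) *\<^sub>R base_slope))"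
      by (simp add: mult.commute)
    then have "h (\<phi> s) - (v * w (\<phi> s)) *\<^sub>R base_slope = l *\<^sub>R (h (\<phi> t) - (v * w (\<phi> t)) *\<^sub>R base_slope)"
      using kpos[OF v] by (simp only: scaleR_cancel_left) simp
    then have "h (\<phi> s) = l *\<^sub>R h (\<phi> t)" unfolding w by (simp add: algebra_simps)
    then show ?thesis using w b by blast
  qed
  have embedded: "embedded_curve \<sigma> (\<lambda>s. c s v)" if v: "0 \<le> v" "v \<le> 1" for v
    unfolding embedded_curve_def
  proof (intro conjI allI impI)
    show "C1_on UNIV (\<lambda>s. c s v)"
      unfolding c_def by (intro C1_intros C1_compose[OF C1_h] C1_compose[OF C1_w] C1_compose[OF C1_z] \<phi>(1) C1N)
    have Nper: "N (s + 1) = N s" for s using N_scale[OF Xper Yper, of s] \<sigma> by simp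
    show per: "c (s + 1) v = \<sigma> *\<^sub>R c s v" for s
      unfolding c_def r4_scaleR_eq \<phi>(2) h_plus_1 w_plus_1 z_plus_1 height_plus_1[OF \<sigma>] Nper
      by (simp add: algebra_simps)
    show nz: "c s v \<noteq> 0" for s
    proof
      assume "c s v = 0"
      then have "c s v = 0 *\<^sub>R c s v" by simp
      from parallel[OF this v] show False using shadow_nonzero[of "\<phi> s"] by simp
    qed
    \<comment> \<open>Injectivity on the fundamental domain \<open>[-1/4, 3/4)\<close>. Its half outside the cone corresponds to times
      of the descending curve in \<open>[0, 1)\<close>, where \<open>first_over\<close> applies.\<close>
    have fund: "\<not> s < t" if eq: "c s v = l *\<^sub>R c t v" and r: "-1/4 \<le> s" "t < 3/4" for s t l
    proof
      assume st: "s < t"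
      have h: "h (\<phi> s) = l *\<^sub>R h (\<phi> t)" and w: "w (\<phi> s) = l * w (\<phi> t)"
        and e: "(1 - v) * z (\<phi> s) + v * (height \<sigma> s * N s) = l * ((1 - v) * z (\<phi> t) + v * (height \<sigma> t * N t))"
        using parallel[OF eq v] by blast+
      have sheared: "sheared (\<phi> s) = l *\<^sub>R sheared (\<phi> t)" unfolding sheared_def h w by (simp add: scaleR_right_diff_distrib)
      have X: "X s = l *\<^sub>R X t" and Y: "Y s = l * Y t" using sheared w by (simp_all add: X_def Y_def)
      have l: "l \<noteq> 0" using X Y cone_curve_nonzero[OF cone, of s] by (auto simp: zero_prod_def)
      consider "t \<le> 1/4" | "1/4 \<le> s" | "s < 1/4" "1/4 < t" by linarith
      then show False
      proof cases
        case 1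
        then have "\<phi> s = \<phi> t" using inj[OF inner inner sheared w] r st by simp
        then show False using mono[OF st] by simp
      next
        case 2
        have "0 \<le> \<phi> s" "\<phi> t < 1" 
          using mono'[OF 2] \<phi>(3) \<alpha>\<beta> mono[OF r(2)] \<phi>34 by simp_all
        from first_over[OF this(1) mono[OF st] this(2) h w] have zz: "l * z (\<phi> t) < z (\<phi> s)" .
        have "l * (height \<sigma> t * N t) \<le> \<bar>height \<sigma> t\<bar> * N s"
        proof -
          have "l * (height \<sigma> t * N t) \<le> \<bar>l * (height \<sigma> t * N t)\<bar>" by simp
          also have "\<dots> = \<bar>height \<sigma> t\<bar> * N s" unfolding N_scale[OF X Y] using Npos[of t] by (simp add: abs_mult)
          finally show ?thesis .
        qed
        also have "\<dots> < height \<sigma> s * N s"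
          using height_descends[OF 2 st _ \<sigma>] r Npos[of s] by simp
        finally have hh: "l * (height \<sigma> t * N t) < height \<sigma> s * N s" .
        have "(1 - v) * (z (\<phi> s) - l * z (\<phi> t)) + v * (height \<sigma> s * N s - l * (height \<sigma> t * N t)) > 0"
        proof (cases "v = 0")
          case False
          then have "v * (height \<sigma> s * N s - l * (height \<sigma> t * N t)) > 0" using hh v by simp
          moreover have "(1 - v) * (z (\<phi> s) - l * z (\<phi> t)) \<ge> 0" using zz v by simp
          ultimately show ?thesis by linarith
        qed (use zz in simp)
        then show False using e by (simp add: algebra_simps)
      next
        case 3
        have "cos (2 * pi * t) < 0" using cos_two_pi_neg[of t] 3 r by simp
        from cone_form_pos[OF cone this] have "\<bar>Y s\<bar> < cmod (X s)" unfolding X Y using l by (simp add: abs_mult)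
        then have "shadow_cone r (\<phi> s) > 0" unfolding lt_iff .
        moreover have "shadow_cone r (\<phi> s) \<le> 0"
          using neg[of "\<phi> s"] zero(2) mono[of "-1/4" s] mono[OF 3(1)] \<phi>(3,4) r by (cases "s = -1/4") auto
        ultimately show False by simp
      qed
    qed
    show "s - t \<in> \<int>" if eq: "c s v = l *\<^sub>R c t v" for s t l
    proof -
      obtain i where i: "-1/4 \<le> s - of_int i" "s - of_int i < 3/4" by (rule ex_shift_quarters)
      obtain j where j: "-1/4 \<le> t - of_int j" "t - of_int j < 3/4" by (rule ex_shift_quarters)
      obtain e where e: "e \<in> {1,-1}" "\<forall>s. c (s + of_int (- i)) v = e *\<^sub>R c s v"
        using shift_by_int[where c="\<lambda>s. c s v", OF per \<sigma>] by blast
      obtain e' where e': "e' \<in> {1,-1}" "\<forall>s. c (s + of_int (- j)) v = e' *\<^sub>R c s v"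
        using shift_by_int[where c="\<lambda>s. c s v", OF per \<sigma>] by blast
      have "l \<noteq> 0" using eq nz[of s] by auto
      have e'2: "e' * e' = 1" "e * e = 1" using e(1) e'(1) by auto
      have cs: "c (s - of_int i) v = e *\<^sub>R c s v" and ct: "c (t - of_int j) v = e' *\<^sub>R c t v"
        using e(2)[rule_format, of s] e'(2)[rule_format, of t] by simp_all
      have ct': "c t v = e' *\<^sub>R c (t - of_int j) v" unfolding ct using e'2 by simp
      have 1: "c (s - of_int i) v = (e * l * e') *\<^sub>R c (t - of_int j) v"
        unfolding cs eq by (subst ct') simp
      have nz3: "e * l * e' \<noteq> 0" using \<open>l \<noteq> 0\<close> e(1) e'(1) by auto
      have 2: "c (t - of_int j) v = inverse (e * l * e') *\<^sub>R c (s - of_int i) v"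
        unfolding 1 scaleR_scaleR left_inverse[OF nz3] by simp
      have "s - of_int i = t - of_int j"
        using fund[OF 1 i(1) j(2)] fund[OF 2 j(1) i(2)] by linarith
      then have "s - t = of_int (i - j)" by simp
      then show ?thesis by (metis Ints_of_int)
    qed
    show "d \<noteq> l *\<^sub>R c s v" if d: "((\<lambda>s. c s v) has_vector_derivative d) (at s)" for s d l
    proof
      assume deq: "d = l *\<^sub>R c s v"
      have d1: "((\<lambda>s. k v *\<^sub>R (h (\<phi> s) - (v * w (\<phi> s)) *\<^sub>R base_slope)) has_vector_derivative l *\<^sub>R k v *\<^sub>R (h (\<phi> s) - (v * w (\<phi> s)) *\<^sub>R base_slope)) (at s)"
        and d2: "((\<lambda>s. w (\<phi> s)) has_real_derivative l * w (\<phi> s)) (at s)"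
        using has_vector_derivative_r4D[OF d] unfolding deq by (simp_all add: c_def)
      obtain p where p: "p > 0" "(\<phi> has_real_derivative p) (at s)" using \<phi>(5) by blast
      have p': "(\<phi> has_vector_derivative p) (at s)" using p(2) by (simp add: has_real_derivative_iff_has_vector_derivative)
      obtain h' where h': "(h has_vector_derivative h') (at (\<phi> s))" using C1_on_realE[OF C1_h] by (metis UNIV_I)
      obtain w' where "(w has_vector_derivative w') (at (\<phi> s))" using C1_on_realE[OF C1_w] by (metis UNIV_I)
      then have w': "(w has_real_derivative w') (at (\<phi> s))" by (simp add: has_real_derivative_iff_has_vector_derivative)
      have "((\<lambda>s. w (\<phi> s)) has_real_derivative w' * p) (at s)" by (rule DERIV_chain2[OF w' p(2)])
      with d2 have ew: "l * w (\<phi> s) = w' * p" by (rule DERIV_unique)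
      have dh: "((\<lambda>s. h (\<phi> s)) has_vector_derivative p *\<^sub>R h') (at s)"
        using vector_diff_chain_at[OF p' h'] by (simp add: o_def)
      have d2': "((\<lambda>s. v * w (\<phi> s)) has_real_derivative v * (l * w (\<phi> s))) (at s)" by (rule DERIV_cmult[OF d2])
      have "((\<lambda>s. k v *\<^sub>R (h (\<phi> s) - (v * w (\<phi> s)) *\<^sub>R base_slope)) has_vector_derivative 
          k v *\<^sub>R (p *\<^sub>R h' - (v * (l * w (\<phi> s))) *\<^sub>R base_slope)) (at s)"
      proof -
        have "((\<lambda>s. (v * w (\<phi> s)) *\<^sub>R base_slope) has_vector_derivative (v * w (\<phi> s)) *\<^sub>R 0 + (v * (l * w (\<phi> s))) *\<^sub>R base_slope) (at s)"
          by (rule has_vector_derivative_scaleR[OF d2' has_vector_derivative_const])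
        then have "((\<lambda>s. h (\<phi> s) - (v * w (\<phi> s)) *\<^sub>R base_slope) has_vector_derivative p *\<^sub>R h' - (v * (l * w (\<phi> s))) *\<^sub>R base_slope) (at s)"
          using has_vector_derivative_diff[OF dh] by simp
        then show ?thesis
          by (rule bounded_linear.has_vector_derivative[OF bounded_linear_scaleR_right])
      qed
      with d1 have "l *\<^sub>R k v *\<^sub>R (h (\<phi> s) - (v * w (\<phi> s)) *\<^sub>R base_slope) = k v *\<^sub>R (p *\<^sub>R h' - (v * (l * w (\<phi> s))) *\<^sub>R base_slope)"
        by (rule vector_derivative_unique_at)
      then have "k v *\<^sub>R (l *\<^sub>R (h (\<phi> s) - (v * w (\<phi> s)) *\<^sub>R base_slope)) = k v *\<^sub>R (p *\<^sub>R h' - (v * (l * w (\<phi> s))) *\<^sub>R base_slope)"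
        by (simp add: mult.commute)
      then have "l *\<^sub>R (h (\<phi> s) - (v * w (\<phi> s)) *\<^sub>R base_slope) = p *\<^sub>R h' - (v * (l * w (\<phi> s))) *\<^sub>R base_slope"
        using kpos[OF v] by (simp only: scaleR_cancel_left) simp
      then have eh: "p *\<^sub>R h' = l *\<^sub>R h (\<phi> s)" by (simp add: algebra_simps)
      have "h' = (inverse p * p) *\<^sub>R h'" using p(1) by simp
      also have "\<dots> = (l / p) *\<^sub>R h (\<phi> s)" unfolding scaleR_scaleR[symmetric] eh by (simp add: divide_inverse mult.commute)
      finally have "h' = (l / p) *\<^sub>R h (\<phi> s)" .
      moreover have "w' = (l / p) * w (\<phi> s)" using ew p(1) by (simp add: field_simps)
      ultimately show False using shadow_immersed[OF h' w'] by blast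
    qed
  qed
  have "isotopic_curves \<sigma> (\<lambda>s. ((h (\<phi> s), z (\<phi> s)), w (\<phi> s))) (cone_knot \<sigma> X Y)"
  proof (rule isotopic_curvesI[where K=c])
    show "C1_on UNIV (\<lambda>x. c (fst x) (step (snd x)))"
      unfolding c_def k_def 
      by (intro C1_intros C1_compose[OF C1_h] C1_compose[OF C1_w] C1_compose[OF C1_z] C1_compose[OF \<phi>(1)] C1_compose[OF C1N])
    show "c s 0 = ((h (\<phi> s), z (\<phi> s)), w (\<phi> s))" for s by (simp add: c_def k_def)
    show "c s 1 = cone_knot \<sigma> X Y s" for s
      by (simp add: c_def k_def cone_knot_def N_def X_def Y_def sheared_def)
  qed (rule embedded)
  moreover have "Y 0 > 0" unfolding Y_def by (rule wpos) (rule inner, simp_all)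
  ultimately show ?thesis using that[OF surj cone] by blast
qed

text \<open>
  The reparametrisation changes the curve but not its range, hence not the knot.
\<close>

theorem unknot_descending_curve: "unknot (knot_of (\<lambda>s. ((h s, z s), w s)))"
proof -
  obtain \<phi> X Y where \<phi>: "surj \<phi>" "cone_curve \<sigma> X Y" "Y 0 > 0"
    "isotopic_curves \<sigma> (\<lambda>s. ((h (\<phi> s), z (\<phi> s)), w (\<phi> s))) (cone_knot \<sigma> X Y)"
    by (rule isotopic_curves_cone_knot_reparametrised)
  obtain d where d: "isotopic_curves \<sigma> (cone_knot \<sigma> X Y) d" "knot_of d = planar_circle \<or> knot_of d = projective_line"
    using unknot_cone_knot[OF \<phi>(2) \<sigma> \<phi>(3)] by blast
  have "knot_of (\<lambda>s. ((h (\<phi> s), z (\<phi> s)), w (\<phi> s))) = (\<lambda>s. cover (sgn ((h s, z s), w s))) ` range \<phi>"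
    unfolding knot_of_def image_image ..
  then have "knot_of (\<lambda>s. ((h (\<phi> s), z (\<phi> s)), w (\<phi> s))) = knot_of (\<lambda>s. ((h s, z s), w s))"
    unfolding \<phi>(1) knot_of_def .
  then show ?thesis
    using isotopic_knot_of[OF isotopic_curves_trans[OF \<phi>(4) d(1)] \<sigma>] d(2) unfolding unknot_def by metis
qed

end

section \<open>The projection in homogeneous coordinates\<close>

text \<open>
  A metric circle through both poles and a point \<open>(l *\<^sub>R q, 0)\<close>, \<open>l \<noteq> 0\<close>, lies in the plane spanned by
  \<open>(q, 0)\<close> and the axis.
\<close>

lemma span_meridian: "span {(q, 0), north} = {x. \<exists>t. fst x = t *\<^sub>R q}"
proof -
  have "x \<in> span {(q, 0), north} \<longleftrightarrow> (\<exists>t. fst x = t *\<^sub>R q)" for x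
  proof -
    have "x \<in> span {(q, 0), north} \<longleftrightarrow> (\<exists>k m. x - k *\<^sub>R (q, 0) = m *\<^sub>R north)"
      by (subst span_insert, subst span_singleton) auto
    also have "\<dots> \<longleftrightarrow> (\<exists>t. fst x = t *\<^sub>R q)"
      by (cases x) (simp add: north_def)
    finally show ?thesis .
  qed
  then show ?thesis by blast
qed

lemma dim_meridian: 
  assumes "q \<noteq> 0" shows "dim (span {(q, 0), north}) = 2"
proof -
  have "(q, 0) \<notin> span {north}" using assms by (auto simp: span_singleton north_def)
  moreover have "independent {north}" by (simp add: north_def zero_prod_def)
  ultimately have "independent {(q, 0), north}" by (simp add: independent_insert)
  moreover have "(q, 0) \<noteq> north" using assms by (simp add: north_def)
  ultimately show ?thesis using dim_span_eq_card_independent[of "{(q, 0), north}"] by simp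
qed

lemma dist_r3_power2: "(dist (a, b) (c, d))\<^sup>2 = (dist a c)\<^sup>2 + (b - d :: real)\<^sup>2"
  by (simp add: dist_Pair_Pair dist_real_def)

lemma dist_scaleR_power2: "(dist (t *\<^sub>R q) (l *\<^sub>R q))\<^sup>2 = (t - l)\<^sup>2 * (norm (q :: 'a::real_normed_vector))\<^sup>2"
  by (simp add: dist_norm scaleR_left_diff_distrib[symmetric] power_mult_distrib)

text \<open>
  The centre of the circle has equal distance from both poles, so it is \<open>(t *\<^sub>R q, 0)\<close> for some \<open>t\<close>. Equating the
  squared distances to \<open>(q, z)\<close>, to \<open>(l *\<^sub>R q, 0)\<close> and to the poles and eliminating \<open>t\<close> gives the equation.
\<close>

lemma metric_circle_through_poles:
  assumes q: "q \<noteq> 0" and l: "l \<noteq> 0" and C: "metric_circle C" "{north, south, (q, z), (l *\<^sub>R q, 0)} \<subseteq> C"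
  shows "l\<^sup>2 * (norm q)\<^sup>2 - 1 = l * ((norm q)\<^sup>2 + z\<^sup>2 - 1)"
proof -
  obtain P a r where P: "affine P" "aff_dim P = 2" "a \<in> P" "C = P \<inter> sphere a r"
    using C(1) unfolding metric_circle_def by blast
  have mem: "north \<in> P" "south \<in> P" "(l *\<^sub>R q, 0) \<in> P" 
    and d: "dist a north = r" "dist a south = r" "dist a (q, z) = r" "dist a (l *\<^sub>R q, 0) = r"
    using C(2) unfolding P(4) by auto
  have "(1/2) *\<^sub>R north + (1/2) *\<^sub>R south \<in> P" using mem P(1) by (intro mem_affine) auto
  then have "0 \<in> P" by (simp add: north_def south_def zero_prod_def)
  then have sP: "subspace P" using P(1) by (simp add: subspace_affine)
  have "inverse l *\<^sub>R (l *\<^sub>R q, 0) \<in> P" by (rule subspace_scale[OF sP mem(3)])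
  then have "(q, 0) \<in> P" using l by simp
  then have sub: "span {(q, 0), north} \<subseteq> P" using mem sP by (intro span_minimal) auto
  have "dim P = 2" using P(2) aff_dim_subspace[OF sP] by simp
  then have "span {(q, 0), north} = P"
    using subspace_dim_equal[OF subspace_span sP sub] dim_meridian[OF q] by simp
  then obtain t where t: "fst a = t *\<^sub>R q" using P(3) unfolding span_meridian by blast
  define b where "b = snd a"
  have a: "a = (t *\<^sub>R q, b)" using t by (simp add: b_def prod_eq_iff)
  have d2: "(dist a north)\<^sup>2 = (dist a south)\<^sup>2" "(dist a north)\<^sup>2 = (dist a (q, z))\<^sup>2" "(dist a north)\<^sup>2 = (dist a (l *\<^sub>R q, 0))\<^sup>2"
    using d by simp_all
  have "b = 0" using d2(1) unfolding a north_def south_def dist_r3_power2 by (simp add: power2_eq_square algebra_simps)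
  have e1: "t\<^sup>2 * (norm q)\<^sup>2 + 1 = (t - 1)\<^sup>2 * (norm q)\<^sup>2 + z\<^sup>2"
    using d2(2) dist_scaleR_power2[of t q 1] unfolding a north_def dist_r3_power2 \<open>b = 0\<close> 
    by (simp add: power_mult_distrib)
  have e2: "t\<^sup>2 * (norm q)\<^sup>2 + 1 = (t - l)\<^sup>2 * (norm q)\<^sup>2"
    using d2(3) unfolding a north_def dist_r3_power2 \<open>b = 0\<close> dist_scaleR_power2
    by (simp add: power_mult_distrib)
  have "2 * t * (norm q)\<^sup>2 = (norm q)\<^sup>2 + z\<^sup>2 - 1" using e1 by (simp add: power2_diff algebra_simps)
  moreover have "l\<^sup>2 * (norm q)\<^sup>2 - 1 = l * (2 * t * (norm q)\<^sup>2)" using e2 by (simp add: power2_diff algebra_simps)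
  ultimately show ?thesis by simp
qed

lemma ex_metric_circle_through_poles:
  assumes q: "q \<noteq> 0" and l: "l\<^sup>2 * (norm q)\<^sup>2 - 1 = l * ((norm q)\<^sup>2 + z\<^sup>2 - 1)"
  shows "\<exists>C. metric_circle C \<and> {north, south, (q, z), (l *\<^sub>R q, 0)} \<subseteq> C"
proof -
  define t where "t = ((norm q)\<^sup>2 + z\<^sup>2 - 1) / (2 * (norm q)\<^sup>2)"
  have t: "2 * t * (norm q)\<^sup>2 = (norm q)\<^sup>2 + z\<^sup>2 - 1" using q by (simp add: t_def)
  define r where "r = sqrt (t\<^sup>2 * (norm q)\<^sup>2 + 1)"
  have r2: "r\<^sup>2 = t\<^sup>2 * (norm q)\<^sup>2 + 1" by (simp add: r_def)
  have r: "r > 0" by (simp add: r_def add_nonneg_pos)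
  let ?P = "span {(q, 0), north}" and ?a = "(t *\<^sub>R q, 0::real)"
  have eqr: "dist x y = r" if "(dist x y)\<^sup>2 = r\<^sup>2" for x y :: "complex \<times> real"
    by (rule power2_eq_imp_eq[OF that]) (use r in simp_all)
  have "dist ?a north = r" "dist ?a south = r"
    by (rule eqr; simp add: north_def south_def dist_r3_power2 r2 power_mult_distrib)+
  moreover have "dist ?a (q, z) = r"
    using dist_scaleR_power2[of t q 1] t by (intro eqr) (simp add: dist_r3_power2 r2 power2_diff algebra_simps)
  moreover have "dist ?a (l *\<^sub>R q, 0) = r"
  proof (rule eqr)
    have "l\<^sup>2 * (norm q)\<^sup>2 - 1 = l * (2 * t * (norm q)\<^sup>2)" using l t by simp
    then show "(dist ?a (l *\<^sub>R q, 0))\<^sup>2 = r\<^sup>2"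
      unfolding dist_r3_power2 dist_scaleR_power2 r2 by (simp add: power2_diff algebra_simps)
  qed
  moreover have "north \<in> ?P" "south \<in> ?P" "(q, z) \<in> ?P" "(l *\<^sub>R q, 0) \<in> ?P" "?a \<in> ?P"
    unfolding span_meridian by (auto simp: north_def south_def intro: exI[of _ 0] exI[of _ 1])
  moreover have "metric_circle (?P \<inter> sphere ?a r)"
    unfolding metric_circle_def
  proof (intro exI conjI)
    show "affine ?P" by (rule subspace_imp_affine[OF subspace_span])
    show "aff_dim ?P = 2" unfolding aff_dim_subspace[OF subspace_span] dim_meridian[OF q] by simp
  qed (use r \<open>?a \<in> ?P\<close> in auto)
  ultimately show ?thesis by (intro exI[of _ "?P \<inter> sphere ?a r"]) auto
qed

text \<open>
  The image is \<open>m *\<^sub>R q\<close> with \<open>m\<close> the positive root of the quadratic equation in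
  \<open>metric_circle_through_poles\<close>, whose roots have negative product.
\<close>

lemma proj_eq:
  assumes q: "q \<noteq> 0" and le: "norm (q, z) \<le> 1"
    and s: "s \<ge> 0" "s\<^sup>2 = 4 * (norm q)\<^sup>2 + (1 - (norm (q, z))\<^sup>2)\<^sup>2"
  shows "proj (q, z) = (2 / (s + (1 - (norm (q, z))\<^sup>2))) *\<^sub>R q"
proof -
  define k where "k = 1 - (norm (q, z))\<^sup>2"
  define m where "m = 2 / (s + k)"
  have n: "(norm (q, z))\<^sup>2 = (norm q)\<^sup>2 + z\<^sup>2" by (simp add: norm_Pair)
  have k: "k \<ge> 0" using le abs_square_le_1[of "norm (q, z)"] by (simp add: k_def)
  have q2: "(norm q)\<^sup>2 > 0" using q by simp
  have s2: "s\<^sup>2 = 4 * (norm q)\<^sup>2 + k\<^sup>2" using s by (simp add: k_def)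
  have "2 * norm q \<le> s" by (rule power2_le_imp_le) (use s2 s in \<open>simp_all add: power_mult_distrib\<close>)
  then have spos: "s + k > 0" using q k by (smt (verit) zero_less_norm_iff)
  have m: "m > 0" using spos by (simp add: m_def)
  have mq: "m\<^sup>2 * (norm q)\<^sup>2 + m * k = 1"
  proof -
    have "m * (s + k) = 2" using spos nonzero_eq_divide_eq[of "s + k" m 2] m_def by auto
    moreover have "(s + k)\<^sup>2 * (m\<^sup>2 * (norm q)\<^sup>2 + m * k) = (m * (s + k))\<^sup>2 * (norm q)\<^sup>2 + (m * (s + k)) * (k * (s + k))"
      by algebra
    ultimately have "(s + k)\<^sup>2 * (m\<^sup>2 * (norm q)\<^sup>2 + m * k) = 4 * (norm q)\<^sup>2 + 2 * (k * (s + k))" by simp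
    also have "\<dots> = (s + k)\<^sup>2 * 1" using s2 by (simp add: power2_eq_square algebra_simps)
    finally have "(s + k)\<^sup>2 * (m\<^sup>2 * (norm q)\<^sup>2 + m * k) = (s + k)\<^sup>2 * 1" .
    then show ?thesis using spos by (simp only: mult_cancel_left) simp
  qed
  have "(THE y. y \<in> cball 0 1 \<and> (\<exists>l>0. y = l *\<^sub>R q) \<and> (\<exists>C. metric_circle C \<and> {north, south, (q, z), (y, 0)} \<subseteq> C)) = m *\<^sub>R q"
  proof (rule the_equality)
    show "m *\<^sub>R q \<in> cball 0 1 \<and> (\<exists>l>0. m *\<^sub>R q = l *\<^sub>R q) \<and> (\<exists>C. metric_circle C \<and> {north, south, (q, z), (m *\<^sub>R q, 0)} \<subseteq> C)"
    proof (intro conjI)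
      show "m *\<^sub>R q \<in> cball 0 1" using \<open>2 * norm q \<le> s\<close> spos k m by (simp add: m_def divide_simps)
      show "\<exists>l>0. m *\<^sub>R q = l *\<^sub>R q" using m by blast
      show "\<exists>C. metric_circle C \<and> {north, south, (q, z), (m *\<^sub>R q, 0)} \<subseteq> C"
        by (rule ex_metric_circle_through_poles[OF q]) (use mq n in \<open>simp add: k_def algebra_simps\<close>)
    qed
    fix y assume "y \<in> cball 0 1 \<and> (\<exists>l>0. y = l *\<^sub>R q) \<and> (\<exists>C. metric_circle C \<and> {north, south, (q, z), (y, 0)} \<subseteq> C)"
    then obtain l C where l: "l > 0" "y = l *\<^sub>R q" and C: "metric_circle C" "{north, south, (q, z), (l *\<^sub>R q, 0)} \<subseteq> C" by blast
    have "l\<^sup>2 * (norm q)\<^sup>2 + l * k = 1"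
      using metric_circle_through_poles[OF q _ C] l(1) n by (simp add: k_def algebra_simps)
    with mq have "(l - m) * ((norm q)\<^sup>2 * (l + m) + k) = 0" by (simp add: power2_eq_square algebra_simps)
    moreover have "(norm q)\<^sup>2 * (l + m) + k > 0" using q2 l m k by (simp add: add_pos_nonneg)
    ultimately have "l = m" by simp
    then show "y = m *\<^sub>R q" using l by simp
  qed
  then show ?thesis using q by (simp add: proj_def m_def k_def)
qed

lemma stereo_formula: "stereo ((h, z), w) = (((if w \<ge> 0 then 1 else -1) / (1 + \<bar>w\<bar>)) *\<^sub>R h, (if w \<ge> 0 then 1 else -1) / (1 + \<bar>w\<bar>) * z)"
  by (simp add: stereo_def divide_inverse)

lemma stereo_formula2: "stereo (h, w) = ((if w \<ge> 0 then 1 else -1) / (1 + \<bar>w\<bar>)) *\<^sub>R h"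
  by (simp add: stereo_def divide_inverse)

lemma shadow_nonzero_of_not_pole:
  assumes "norm (((h, z), w) :: r4) = 1" "stereo ((h, z), w) \<notin> {north, south}"
  shows "h \<noteq> 0 \<or> w \<noteq> 0"
proof (rule ccontr)
  assume "\<not> ?thesis"
  then have "h = 0" "w = 0" by auto
  then have "\<bar>z\<bar> = 1" using assms(1) by (simp add: norm_Pair)
  then have "z = 1 \<or> z = -1" by linarith
  then show False using assms(2) \<open>h = 0\<close> \<open>w = 0\<close> by (auto simp: stereo_def north_def south_def)
qed

text \<open>
  Circles through the poles are the images of great circles through the point \<open>((0, 1), 0)\<close> of the sphere, and on such
  a circle \<open>h\<close> and \<open>w\<close> keep their ratio.
\<close>

lemma proj_stereo:
  assumes n1: "norm (((h, z), w) :: r4) = 1"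
  shows "proj (stereo ((h, z), w)) = stereo (sgn (h, w))"
proof (cases "h = 0")
  case True
  then show ?thesis by (simp add: proj_def stereo_formula stereo_def sgn_div_norm)
next
  case False
  define e :: real where "e = (if w \<ge> 0 then 1 else -1)"
  define W where "W = \<bar>w\<bar>"
  define n where "n = norm (h, w)"
  have e: "\<bar>e\<bar> = 1" "e * e = 1" by (simp_all add: e_def)
  have W: "W \<ge> 0" by (simp add: W_def)
  have n: "n > 0" using False by (simp add: n_def zero_prod_def)
  have n2: "n\<^sup>2 = (norm h)\<^sup>2 + W\<^sup>2" by (simp add: n_def norm_Pair W_def)
  have st: "stereo ((h, z), w) = ((e / (1 + W)) *\<^sub>R h, e / (1 + W) * z)" by (simp add: stereo_formula e_def W_def)
  have \<rho>: "(norm ((e / (1 + W)) *\<^sub>R h, e / (1 + W) * z))\<^sup>2 = (1 - W) / (1 + W)"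
    using norm_stereo_power2[OF n1] unfolding st by (simp add: W_def)
  have k: "1 - (norm ((e / (1 + W)) *\<^sub>R h, e / (1 + W) * z))\<^sup>2 = 2 * W / (1 + W)"
    unfolding \<rho> using W by (simp add: field_simps)
  have "proj ((e / (1 + W)) *\<^sub>R h, e / (1 + W) * z) = 
     (2 / (2 * n / (1 + W) + (1 - (norm ((e / (1 + W)) *\<^sub>R h, e / (1 + W) * z))\<^sup>2))) *\<^sub>R ((e / (1 + W)) *\<^sub>R h)"
  proof (rule proj_eq)
    show "(e / (1 + W)) *\<^sub>R h \<noteq> 0" using False e W by (auto simp: e_def)
    show "norm ((e / (1 + W)) *\<^sub>R h, e / (1 + W) * z) \<le> 1" using norm_stereo_le[OF n1] unfolding st .
    show "0 \<le> 2 * n / (1 + W)" using n W by simp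
    show "(2 * n / (1 + W))\<^sup>2 = 4 * (norm ((e / (1 + W)) *\<^sub>R h))\<^sup>2 + (1 - (norm ((e / (1 + W)) *\<^sub>R h, e / (1 + W) * z))\<^sup>2)\<^sup>2"
    proof -
      have "(norm ((e / (1 + W)) *\<^sub>R h))\<^sup>2 = (norm h)\<^sup>2 / (1 + W)\<^sup>2" using e by (simp add: power_mult_distrib power_divide)
      moreover have "(2 * n / (1 + W))\<^sup>2 = 4 * ((norm h)\<^sup>2 / (1 + W)\<^sup>2) + (2 * W / (1 + W))\<^sup>2"
        unfolding power_divide power_mult_distrib n2 by (simp add: add_divide_distrib)
      ultimately show ?thesis unfolding k by simp
    qed
  qed
  also have "\<dots> = (e / (n + W)) *\<^sub>R h"
  proof -
    have "2 / (2 * n / (1 + W) + 2 * W / (1 + W)) * (e / (1 + W)) = e / (n + W)"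
      using n W by (simp add: divide_simps) (simp add: algebra_simps)
    then show ?thesis unfolding k by simp
  qed
  also have "\<dots> = stereo (sgn (h, w))"
  proof -
    have an: "\<bar>w / n\<bar> = W / n" and wn: "w / n \<ge> 0 \<longleftrightarrow> w \<ge> 0" using n by (simp_all add: W_def zero_le_divide_iff)
    have sg: "sgn (h, w) = ((1 / n) *\<^sub>R h, w / n)" by (simp add: sgn_div_norm n_def divide_inverse mult.commute)
    have "stereo (sgn (h, w)) = (e / (1 + W / n)) *\<^sub>R ((1 / n) *\<^sub>R h)"
      unfolding sg stereo_formula2 an wn e_def ..
    moreover have "e / (1 + W / n) * (1 / n) = e / (n + W)"
    proof -
      have "(1 + W / n) * n = n + W" using n by (simp add: field_simps)
      then show ?thesis by simp
    qed
    ultimately show ?thesis by (simp only: scaleR_scaleR)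
  qed
  finally show ?thesis unfolding st .
qed

lemma dist_stereo_north:
  assumes n1: "norm (((h, z), w) :: r4) = 1"
  shows "(dist (stereo ((h, z), w)) north)\<^sup>2 = 2 * (1 - (if w \<ge> 0 then 1 else -1) * z) / (1 + \<bar>w\<bar>)"
proof -
  have "(dist x north)\<^sup>2 = (norm x)\<^sup>2 + 1 - 2 * snd x" for x :: "complex \<times> real"
  proof (cases x)
    case (Pair a b)
    then show ?thesis by (simp add: north_def dist_r3_power2 norm_Pair power2_diff)
  qed
  then have "(dist (stereo ((h, z), w)) north)\<^sup>2 = (1 - \<bar>w\<bar>) / (1 + \<bar>w\<bar>) + 1 - 2 * ((if w \<ge> 0 then 1 else -1) / (1 + \<bar>w\<bar>) * z)"
    using norm_stereo_power2[OF n1] unfolding stereo_formula by simp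
  also have "\<dots> = 2 * (1 - (if w \<ge> 0 then 1 else -1) * z) / (1 + \<bar>w\<bar>)"
  proof -
    have "(1 - W) / (1 + W) + 1 - 2 * (e / (1 + W) * z) = 2 * (1 - e * z) / (1 + W)" if "W \<ge> 0" for W e :: real
    proof -
      have "(1 - W) / (1 + W) + 1 = 2 / (1 + W)" using that by (simp add: field_simps)
      then show ?thesis by (simp add: diff_divide_distrib right_diff_distrib)
    qed
    then show ?thesis by simp
  qed
  finally show ?thesis .
qed

text \<open>
  At a crossing the two points of the sphere have the same ratio \<open>\<omega>\<close> of \<open>\<bar>w\<bar>\<close> to the norm of the shadow, and
  the quotients in the hypothesis are half the squared distances from the north pole. Both sides
  are monotone in \<open>u = (1 - \<zeta>) / n\<close>, the tangent of half the angle to the \<open>z\<close>-axis.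
\<close>

lemma slope_mono:
  fixes \<zeta> n \<zeta>' n' \<omega> :: real
  assumes n: "n > 0" "n' > 0" and \<omega>: "\<omega> \<ge> 0" and s: "\<zeta>\<^sup>2 + n\<^sup>2 = 1" "\<zeta>'\<^sup>2 + n'\<^sup>2 = 1"
    and less: "(1 - \<zeta>) / (1 + \<omega> * n) < (1 - \<zeta>') / (1 + \<omega> * n')"
  shows "\<zeta>' / n' < \<zeta> / n"
proof (rule ccontr)
  assume "\<not> ?thesis"
  then have le: "\<zeta> / n \<le> \<zeta>' / n'" by simp
  define u where "u = (1 - \<zeta>) / n"
  define u' where "u' = (1 - \<zeta>') / n'"
  have pos: "u > 0" "u' > 0"
  proof -
    have "x < 1" if "x\<^sup>2 + y\<^sup>2 = 1" "y > 0" for x y :: real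
    proof -
      have "x\<^sup>2 < 1" using that zero_less_power[of y 2] by linarith
      then show ?thesis by (simp add: abs_square_less_1)
    qed
    then show "u > 0" "u' > 0" using s n by (simp_all add: u_def u'_def)
  qed
  have par: "n = 2 * u / (1 + u\<^sup>2) \<and> \<zeta> = (1 - u\<^sup>2) / (1 + u\<^sup>2)" if "n > 0" "\<zeta>\<^sup>2 + n\<^sup>2 = 1" "u = (1 - \<zeta>) / n" for n \<zeta> u :: real
  proof -
    have un: "\<zeta> = 1 - u * n" using that by simp
    have "(1 - u * n)\<^sup>2 + n\<^sup>2 = 1" using that(2) unfolding un .
    then have "n * (n * (1 + u\<^sup>2) - 2 * u) = 0" by (simp add: power2_eq_square algebra_simps)
    then have "n * (1 + u\<^sup>2) = 2 * u" using that(1) by simp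
    moreover have "1 + u\<^sup>2 > 0" by (simp add: add_pos_nonneg)
    ultimately have nn: "n = 2 * u / (1 + u\<^sup>2)" by (simp add: eq_divide_eq)
    moreover have "\<zeta> = (1 - u\<^sup>2) / (1 + u\<^sup>2)" unfolding un nn using \<open>1 + u\<^sup>2 > 0\<close> by (simp add: power2_eq_square field_simps)
    ultimately show ?thesis by blast
  qed
  note p = par[OF n(1) s(1) u_def] and p' = par[OF n(2) s(2) u'_def]
  have sl: "((1 - u\<^sup>2) / (1 + u\<^sup>2)) / (2 * u / (1 + u\<^sup>2)) = (1 / u - u) / 2" if "u > 0" for u :: real
  proof -
    have "1 + u\<^sup>2 > 0" by (simp add: add_pos_nonneg)
    then have "((1 - u\<^sup>2) / (1 + u\<^sup>2)) / (2 * u / (1 + u\<^sup>2)) = (1 - u\<^sup>2) / (2 * u)" by simp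
    also have "\<dots> = (1 / u - u) / 2" using that by (simp add: power2_eq_square field_simps)
    finally show ?thesis .
  qed
  have "u' \<le> u"
  proof (rule ccontr)
    assume "\<not> u' \<le> u"
    then have "1 / u' < 1 / u" using pos by (simp add: frac_less2)
    then have "(1 / u' - u') / 2 < (1 / u - u) / 2" using \<open>\<not> u' \<le> u\<close> by simp
    moreover have "\<zeta> / n = (1 / u - u) / 2" "\<zeta>' / n' = (1 / u' - u') / 2" using p p' sl pos by simp_all
    ultimately show False using le by simp
  qed
  have F: "(1 - \<zeta>) / (1 + \<omega> * n) = 2 / (1 + 2 * \<omega> / u + 1 / u\<^sup>2)" 
    if "u > 0" "n = 2 * u / (1 + u\<^sup>2) \<and> \<zeta> = (1 - u\<^sup>2) / (1 + u\<^sup>2)" for n \<zeta> u :: real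
  proof -
    have a: "1 + u\<^sup>2 > 0" by (simp add: add_pos_nonneg)
    have b: "1 + u\<^sup>2 + 2 * \<omega> * u > 0" using a that(1) \<omega> by (simp add: add_pos_nonneg)
    have "1 - \<zeta> = 2 * u\<^sup>2 / (1 + u\<^sup>2)" using that a by (simp add: field_simps)
    moreover have "1 + \<omega> * (2 * u / (1 + u\<^sup>2)) = (1 + u\<^sup>2 + 2 * \<omega> * u) / (1 + u\<^sup>2)" using a by (simp add: field_simps)
    then have "1 + \<omega> * n = (1 + u\<^sup>2 + 2 * \<omega> * u) / (1 + u\<^sup>2)" using that by simp
    ultimately have "(1 - \<zeta>) / (1 + \<omega> * n) = 2 * u\<^sup>2 / (1 + u\<^sup>2 + 2 * \<omega> * u)" using a by simp
    also have "1 + u\<^sup>2 + 2 * \<omega> * u = u\<^sup>2 * (1 + 2 * \<omega> / u + 1 / u\<^sup>2)"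
      using that(1) by (simp add: power2_eq_square field_simps)
    finally show ?thesis using that(1) by simp
  qed
  have "1 + 2 * \<omega> / u + 1 / u\<^sup>2 \<le> 1 + 2 * \<omega> / u' + 1 / u'\<^sup>2"
    using \<open>u' \<le> u\<close> pos \<omega> by (intro add_mono divide_left_mono) (auto intro: power_mono)
  moreover have "1 + 2 * \<omega> / u + 1 / u\<^sup>2 > 0" using pos \<omega> by (simp add: add_pos_nonneg)
  ultimately have "2 / (1 + 2 * \<omega> / u' + 1 / u'\<^sup>2) \<le> 2 / (1 + 2 * \<omega> / u + 1 / u\<^sup>2)"
    by (intro divide_left_mono) auto
  then show False using less F[OF pos(1) p] F[OF pos(2) p'] by simp
qed

section \<open>From descending diagrams to descending curves\<close>

text \<open>
  Two lifts to the sphere of the same curve of lines differ by a global sign.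
\<close>

lemma continuous_sign_constant:
  fixes a b :: "real \<Rightarrow> 'a::real_inner"
  assumes a: "continuous_on UNIV a" and b: "continuous_on UNIV b" 
    and ab: "\<And>s. b s = a s \<or> b s = - a s" and nz: "\<And>s. a s \<noteq> 0"
  obtains e where "e = 1 \<or> e = -1" "\<And>s. b s = e *\<^sub>R a s"
proof -
  define f where "f s = (a s \<bullet> b s) / (a s \<bullet> a s)" for s
  have f: "f s = 1 \<and> b s = a s \<or> f s = -1 \<and> b s = - a s" for s
    using ab[of s] nz[of s] by (auto simp: f_def)
  have "continuous_on UNIV f" unfolding f_def by (intro continuous_intros a b) (simp add: nz)
  moreover have "range f \<subseteq> {1, -1}" using f by blast
  then have "finite (range f)" using finite_subset by blast
  ultimately have "f constant_on UNIV" by (intro continuous_finite_range_constant) auto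
  then obtain e where e: "\<And>s. f s = e" unfolding constant_on_def by blast
  show thesis
  proof (rule that)
    show "e = 1 \<or> e = -1" using f[of 0] e by auto
    show "b s = e *\<^sub>R a s" for s using f[of s] e[of s] by auto
  qed
qed

lemma transverse_zero_sign_change:
  fixes w :: "real \<Rightarrow> real"
  assumes "(w has_real_derivative w') (at z)" "w z = 0" "w' \<noteq> 0"
  obtains d where "d > 0" "\<And>k. 0 < k \<Longrightarrow> k < d \<Longrightarrow> sgn w' * w (z - k) < 0" "\<And>k. 0 < k \<Longrightarrow> k < d \<Longrightarrow> sgn w' * w (z + k) > 0"
proof -
  have d: "((\<lambda>x. sgn w' * w x) has_real_derivative sgn w' * w') (at z)" by (rule DERIV_cmult[OF assms(1)])
  have p: "sgn w' * w' > 0" using assms(3) by (simp add: sgn_if)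
  obtain d1 where d1: "d1 > 0" "\<And>k. 0 < k \<Longrightarrow> k < d1 \<Longrightarrow> sgn w' * w z < sgn w' * w (z + k)"
    using DERIV_pos_inc_right[OF d p] by blast
  obtain d2 where d2: "d2 > 0" "\<And>k. 0 < k \<Longrightarrow> k < d2 \<Longrightarrow> sgn w' * w (z - k) < sgn w' * w z"
    using DERIV_pos_inc_left[OF d p] by blast
  show thesis by (rule that[of "min d1 d2"]) (use d1 d2 assms(2) in auto)
qed

lemma finite_transverse_zeros:
  fixes w :: "real \<Rightarrow> real"
  assumes w: "\<And>t. (w has_real_derivative w' t) (at t)" and tr: "\<And>t. w t = 0 \<Longrightarrow> w' t \<noteq> 0"
  shows "finite {t. a < t \<and> t < b \<and> w t = 0}"
proof -
  have "finite ({a..b} \<inter> {t. w t = 0})"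
  proof (rule finite_not_islimpt_in_compact)
    show "\<not> x islimpt {t. w t = 0}" for x
    proof (cases "w x = 0")
      case False
      have "open {t. w t \<noteq> 0}"
      proof (rule open_Collect_neq[OF _ continuous_on_const])
        show "continuous_on UNIV w"
          by (rule continuous_at_imp_continuous_on) (simp add: DERIV_isCont[OF w])
      qed
      then show ?thesis using False by (auto intro!: exI[of _ "{t. w t \<noteq> 0}"] simp: islimpt_def)
    next
      case True
      obtain d where d: "d > 0" "\<And>k. 0 < k \<Longrightarrow> k < d \<Longrightarrow> sgn (w' x) * w (x - k) < 0" "\<And>k. 0 < k \<Longrightarrow> k < d \<Longrightarrow> sgn (w' x) * w (x + k) > 0"
        by (rule transverse_zero_sign_change[OF w True tr[OF True]]) (rule that)
      have "w y \<noteq> 0" if "y \<in> {x-d<..<x+d}" "y \<noteq> x" for y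
        using d(2)[of "x - y"] d(3)[of "y - x"] that by (cases "y < x") auto
      then have "\<forall>y\<in>{t. w t = 0}. y \<in> {x-d<..<x+d} \<longrightarrow> y = x" by blast
      moreover have "x \<in> {x-d<..<x+d}" using d(1) by simp
      ultimately show ?thesis unfolding islimpt_def using open_greaterThanLessThan by meson
    qed
  qed simp
  then show ?thesis by (rule rev_finite_subset) auto
qed

text \<open>
  Each transverse zero reverses the sign. The induction removes the last zero \<open>z\<close> and moves the end of the interval
  to a point just before \<open>z\<close>.
\<close>

lemma parity_of_transverse_zeros:
  fixes w :: "real \<Rightarrow> real"
  assumes w: "\<And>t. (w has_real_derivative w' t) (at t)" and tr: "\<And>t. w t = 0 \<Longrightarrow> w' t \<noteq> 0"
    and a: "w a > 0" and s: "a \<le> s" "w s \<noteq> 0"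
  shows "even (card {t. a < t \<and> t < s \<and> w t = 0}) \<longleftrightarrow> w s > 0"
  using s
proof (induction "card {t. a < t \<and> t < s \<and> w t = 0}" arbitrary: s)
  case 0
  have cont: "continuous_on T w" for T
    by (rule continuous_at_imp_continuous_on) (simp add: DERIV_isCont[OF w])
  have empty: "{t. a < t \<and> t < s \<and> w t = 0} = {}"
    using 0(1) finite_transverse_zeros[where w=w, OF w tr] by simp
  have "w s > 0"
  proof (rule ccontr)
    assume "\<not> w s > 0"
    then have "w s \<le> 0" by simp
    then obtain t where t: "a \<le> t" "t \<le> s" "w t = 0" using IVT2'[of w s 0 a, OF _ _ _ cont] a 0 by auto
    then have "a < t" "t < s" using a 0 by (auto simp: le_less)
    then show False using empty t by blast
  qed
  then show ?case unfolding empty by simp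
next
  case (Suc n)
  let ?Z = "{t. a < t \<and> t < s \<and> w t = 0}"
  have cont: "continuous_on T w" for T
    by (rule continuous_at_imp_continuous_on) (simp add: DERIV_isCont[OF w])
  have fin: "finite ?Z" by (rule finite_transverse_zeros[where w=w, OF w tr])
  have ne: "?Z \<noteq> {}" using Suc(2) by (metis card.empty nat.distinct(1))
  define z where "z = Max ?Z"
  have z: "z \<in> ?Z" unfolding z_def by (rule Max_in[OF fin ne])
  then have wz: "w z = 0" "a < z" "z < s" by auto
  have zmax: "t \<le> z" if "t \<in> ?Z" for t unfolding z_def using fin that by simp
  obtain d where d: "d > 0" "\<And>k. 0 < k \<Longrightarrow> k < d \<Longrightarrow> sgn (w' z) * w (z - k) < 0" "\<And>k. 0 < k \<Longrightarrow> k < d \<Longrightarrow> sgn (w' z) * w (z + k) > 0"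
    by (rule transverse_zero_sign_change[OF w wz(1) tr[OF wz(1)]]) (rule that)
  define M where "M = Max (insert a (?Z - {z}))"
  have fin': "finite (insert a (?Z - {z}))" using fin by simp
  have M: "M < z" 
  proof -
    have "M \<in> insert a (?Z - {z})" unfolding M_def by (rule Max_in[OF fin']) simp
    then show ?thesis
    proof
      assume "M \<in> ?Z - {z}"
      then have "M \<le> z" "M \<noteq> z" using zmax[of M] by auto
      then show ?thesis by simp
    qed (use wz in simp)
  qed
  have Mge: "t \<le> M" if "t \<in> insert a (?Z - {z})" for t
    unfolding M_def by (rule Max_ge[OF fin' that])
  \<comment> \<open>A point before \<open>z\<close>, after all other zeros and after \<open>a\<close>, where the sign is known.\<close>
  define s1 where "s1 = max ((M + z) / 2) (z - d / 2)"
  have s1: "M < s1" "s1 < z" "z - s1 < d"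
  proof -
    have "(M + z) / 2 \<le> s1" "z - d / 2 \<le> s1" by (simp_all add: s1_def)
    then show "M < s1" "z - s1 < d" using M d(1) by simp_all
    show "s1 < z" using M d(1) by (simp add: s1_def)
  qed
  have sgn1: "sgn (w' z) * w s1 < 0" using d(2)[of "z - s1"] s1 by simp
  have "a \<le> s1" using Mge[of a] s1 by simp
  have "w s1 \<noteq> 0" using sgn1 by auto
  have "{t. a < t \<and> t < s1 \<and> w t = 0} = ?Z - {z}"
    using Mge s1 wz by force
  then have nn: "n = card {t. a < t \<and> t < s1 \<and> w t = 0}"
    using Suc(2) z fin by (simp add: card_Diff_singleton)
  have IH: "even n \<longleftrightarrow> w s1 > 0" using Suc(1)[OF nn \<open>a \<le> s1\<close> \<open>w s1 \<noteq> 0\<close>] nn by simp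
  have sgn2: "sgn (w' z) * w s > 0"
  proof (rule ccontr)
    assume "\<not> sgn (w' z) * w s > 0"
    define s2 where "s2 = min ((z + s) / 2) (z + d / 2)"
    have s2: "z < s2" "s2 < s" "s2 - z < d"
    proof -
      have "s2 \<le> (z + s) / 2" "s2 \<le> z + d / 2" by (simp_all only: s2_def min.cobounded1 min.cobounded2)
      then show "s2 < s" "s2 - z < d" using wz d(1) by simp_all
      show "z < s2" using wz d(1) by (simp add: s2_def)
    qed
    have "sgn (w' z) * w s2 > 0" using d(3)[of "s2 - z"] s2 by simp
    moreover have "continuous_on {s2..s} (\<lambda>t. sgn (w' z) * w t)" by (intro continuous_intros cont)
    ultimately obtain t where t: "s2 \<le> t" "t \<le> s" "sgn (w' z) * w t = 0"
      using IVT2'[of "\<lambda>t. sgn (w' z) * w t" s 0 s2] \<open>\<not> sgn (w' z) * w s > 0\<close> s2 by fastforce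
    have "w t = 0" using t(3) tr[OF wz(1)] by (simp add: sgn_0_0)
    moreover from this have "t \<noteq> s" using Suc(4) by auto
    ultimately have "t \<in> ?Z" using t s2 wz by auto
    then show False using zmax[of t] t s2 by simp
  qed
  have "w s > 0 \<longleftrightarrow> \<not> w s1 > 0"
    using sgn1 sgn2 by (auto simp: sgn_if mult_less_0_iff zero_less_mult_iff split: if_splits)
  then show ?case using IH Suc(2) by (metis even_Suc)
qed

lemma cover_uminus: 
  fixes x :: "'a::real_normed_vector \<times> real"
  shows "norm x = 1 \<Longrightarrow> cover (- x) = cover x"
  by (subst cover_eq_iff) auto

text \<open>
  What the projection of a point of the knot looks like in homogeneous coordinates. On the boundary sphere the representative
  in the ball is determined only up to sign.
\<close>

lemma lift_of_diagram:
  fixes h :: complex and z w :: real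
  assumes n1: "norm ((h, z), w) = 1" and g: "g \<in> cball 0 1 - {north, south}" and eq: "abs_rp g = cover ((h, z), w)"
  shows "h \<noteq> 0 \<or> w \<noteq> 0" "abs_rp (proj g) = cover (sgn (h, w))" "norm (proj g) = 1 \<longleftrightarrow> w = 0"
    "w \<noteq> 0 \<Longrightarrow> g = stereo ((h, z), w)"
proof -
  have ng: "norm g \<le> 1" using g by simp
  have "g = stereo ((h, z), w) \<or> norm (stereo ((h, z), w)) = 1 \<and> g = - stereo ((h, z), w)"
    using eq abs_rp_eq_iff[OF norm_stereo_le[OF n1] ng] unfolding cover_eq by auto
  then have cases: "g = stereo ((h, z), w) \<or> w = 0 \<and> g = stereo ((- h, - z), - w)"
    using norm_stereo_eq_1[OF n1] by (auto simp: stereo_def)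
  have n1': "norm ((- h, - z), - w) = 1" using n1 norm_minus_cancel[of "((h, z), w)"] by simp
  show nz: "h \<noteq> 0 \<or> w \<noteq> 0"
    using cases shadow_nonzero_of_not_pole[OF n1] shadow_nonzero_of_not_pole[OF n1'] g by auto
  then have nsgn: "norm (sgn (h, w)) = 1" by (auto simp: norm_sgn zero_prod_def)
  have sgnm: "sgn (- h, - w) = - sgn (h, w)" using sgn_minus[of "(h, w)"] by simp
  have pr: "proj g = stereo (sgn (h, w)) \<or> w = 0 \<and> proj g = stereo (- sgn (h, w))"
    using cases proj_stereo[OF n1] proj_stereo[OF n1'] sgnm by auto
  have "norm (- sgn (h, w)) = 1" using nsgn by simp
  have snd0: "snd (sgn (h, w)) = 0 \<longleftrightarrow> w = 0" using nz by (auto simp: sgn_div_norm zero_prod_def)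
  show "abs_rp (proj g) = cover (sgn (h, w))"
    using pr cover_uminus[OF nsgn] by (auto simp: cover_eq)
  show "norm (proj g) = 1 \<longleftrightarrow> w = 0"
    using pr norm_stereo_eq_1[OF nsgn] norm_stereo_eq_1[OF \<open>norm (- sgn (h, w)) = 1\<close>] snd0 by auto
  show "g = stereo ((h, z), w)" if "w \<noteq> 0" using cases that by blast
qed

text \<open>
  Where \<open>w < 0\<close>, stereographic projection reverses the direction of height; the hypothesis \<open>near\<close> exchanges
  over and under there. The two reversals cancel.
\<close>

lemma first_over_lift:
  fixes h h' :: complex and z z' w w' l :: real
  assumes n1: "norm ((h, z), w) = 1" "norm ((h', z'), w') = 1" 
    and p: "h = l *\<^sub>R h'" "w = l * w'" and w: "w \<noteq> 0"
    and near: "if w > 0 then dist (stereo ((h, z), w)) north < dist (stereo ((h', z'), w')) north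
       else dist (stereo ((h', z'), w')) north < dist (stereo ((h, z), w)) north"
  shows "l * z' < z"
proof -
  have l: "l \<noteq> 0" and w': "w' \<noteq> 0" using p w by auto
  define n where "n = norm (h', w')"
  have n: "n > 0" using w' by (simp add: n_def zero_prod_def)
  have nl: "norm (h, w) = \<bar>l\<bar> * n" using norm_scaleR[of l "(h', w')"] p by (simp add: n_def)
  define \<omega> where "\<omega> = \<bar>w'\<bar> / n"
  have \<omega>: "\<omega> \<ge> 0" "\<omega> * n = \<bar>w'\<bar>" "\<omega> * (\<bar>l\<bar> * n) = \<bar>w\<bar>" using n by (simp_all add: \<omega>_def p abs_mult)
  define \<epsilon> :: real where "\<epsilon> = (if w \<ge> 0 then 1 else -1)"
  define \<epsilon>' :: real where "\<epsilon>' = (if w' \<ge> 0 then 1 else -1)"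
  have e2: "\<epsilon>\<^sup>2 = 1" "\<epsilon>'\<^sup>2 = 1" by (simp_all add: \<epsilon>_def \<epsilon>'_def)
  have norms: "(\<epsilon> * z)\<^sup>2 + (\<bar>l\<bar> * n)\<^sup>2 = 1" "(\<epsilon>' * z')\<^sup>2 + n\<^sup>2 = 1"
  proof -
    have "z\<^sup>2 + (norm (h, w))\<^sup>2 = (norm ((h, z), w))\<^sup>2" "z'\<^sup>2 + (norm (h', w'))\<^sup>2 = (norm ((h', z'), w'))\<^sup>2"
      by (simp_all add: norm_Pair)
    then show "(\<epsilon> * z)\<^sup>2 + (\<bar>l\<bar> * n)\<^sup>2 = 1" "(\<epsilon>' * z')\<^sup>2 + n\<^sup>2 = 1"
      unfolding n1 nl power_mult_distrib e2 n_def[symmetric] by simp_all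
  qed
  have sq: "(dist (stereo ((h, z), w)) north)\<^sup>2 = 2 * ((1 - \<epsilon> * z) / (1 + \<omega> * (\<bar>l\<bar> * n)))"
    "(dist (stereo ((h', z'), w')) north)\<^sup>2 = 2 * ((1 - \<epsilon>' * z') / (1 + \<omega> * n))"
    unfolding dist_stereo_north[OF n1(1)] dist_stereo_north[OF n1(2)] \<omega> \<epsilon>_def \<epsilon>'_def by simp_all
  have ln: "\<bar>l\<bar> * n > 0" using l n by simp
  have mono: "A < B" if "dist a north < dist b north" "(dist a north)\<^sup>2 = 2 * A" "(dist b north)\<^sup>2 = 2 * B" for a b A B
  proof -
    have "(dist a north)\<^sup>2 < (dist b north)\<^sup>2" using that(1) by (intro power_strict_mono) auto
    then show ?thesis using that by simp
  qed
  have ll: "\<bar>l\<bar> = l * \<epsilon> * \<epsilon>'" 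
    using w w' l unfolding \<epsilon>_def \<epsilon>'_def p(2) by (auto simp: abs_if zero_le_mult_iff mult_le_0_iff)
  show ?thesis
  proof (cases "w > 0")
    case True
    then have "\<epsilon>' * z' / n < \<epsilon> * z / (\<bar>l\<bar> * n)"
      using near by (intro slope_mono[OF ln n \<omega>(1) norms] mono[OF _ sq]) simp
    then have "\<bar>l\<bar> * (\<epsilon>' * z') < \<epsilon> * z" using n l by (simp add: field_simps)
    moreover have "\<epsilon> = 1" using True by (simp add: \<epsilon>_def)
    ultimately show ?thesis using ll e2(2) by (simp add: power2_eq_square mult_ac) (metis mult.assoc mult.commute mult_1)
  next
    case False
    then have "\<epsilon> * z / (\<bar>l\<bar> * n) < \<epsilon>' * z' / n"
      using near by (intro slope_mono[OF n ln \<omega>(1) norms(2,1)] mono[OF _ sq(2,1)]) simp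
    then have "\<epsilon> * z < \<bar>l\<bar> * (\<epsilon>' * z')" using n l by (simp add: field_simps)
    moreover have e: "\<epsilon> = -1" using False w by (simp add: \<epsilon>_def)
    moreover have "\<bar>l\<bar> * (\<epsilon>' * z') = \<epsilon> * (l * z') * \<epsilon>'\<^sup>2" unfolding ll by (simp add: power2_eq_square)
    ultimately show ?thesis using e2 by simp
  qed
qed

lemma immersed_liftD:
  assumes "immersed_lift c f"
  shows "norm (c s) = 1" "f s = cover (c s)" "C1_on UNIV c"
    "(c has_vector_derivative vector_derivative c (at s)) (at s)" "vector_derivative c (at s) \<noteq> 0"
proof -
  have d: "c C1_differentiable_on UNIV" using assms by (simp add: immersed_lift_def)
  show "norm (c s) = 1" "f s = cover (c s)" "vector_derivative c (at s) \<noteq> 0"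
    using assms by (simp_all add: immersed_lift_def)
  show "C1_on UNIV c" using d unfolding C1_differentiable_on_def by (metis C1_on_realI)
  then show "(c has_vector_derivative vector_derivative c (at s)) (at s)"
    by (metis C1_on_realE UNIV_I vector_derivative_at)
qed

text \<open>
  The normalised shadow lifts the net, so up to a global sign it is the lift that generic immersion refers to. This
  makes the shadow immersed and the zeros of \<open>w\<close> transverse; the arc distance counts these zeros, so it
  is even exactly where \<open>w > 0\<close>. The first pass of a crossing is the earlier of its two times, because there are no
  triple points.
\<close>

lemma descending_curve_of_descending_diagram:
  fixes c :: "real \<Rightarrow> r4"
  assumes D: "based_oriented_diagram D" and desc: "descending D"
    and g: "\<And>s. g s \<in> cball 0 1 - {north, south}" and traj: "\<And>s. traj D s = proj (g s)"
    and inj: "\<And>s t. abs_rp (g s) = abs_rp (g t) \<longleftrightarrow> s - t \<in> \<int>"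
    and over: "\<And>s t. s - t \<notin> \<int> \<Longrightarrow> traj D s = traj D t \<Longrightarrow> over D s \<longleftrightarrow> dist (g s) north < dist (g t) north"
    and c: "\<And>s. norm (c s) = 1" "\<And>s. abs_rp (g s) = cover (c s)" "C1_on UNIV c" and c0: "snd (c 0) > 0"
  shows "\<exists>\<sigma>. descending_curve \<sigma> (\<lambda>s. fst (fst (c s))) (\<lambda>s. snd (fst (c s))) (\<lambda>s. snd (c s))"
proof -
  define h where "h s = fst (fst (c s))" for s
  define z where "z s = snd (fst (c s))" for s
  define w where "w s = snd (c s)" for s
  have ceq: "c s = ((h s, z s), w s)" for s by (simp add: h_def z_def w_def)
  have w0: "w 0 > 0" using c0 by (simp add: w_def)
  have n1: "norm ((h s, z s), w s) = 1" for s using c(1)[of s] unfolding ceq .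
  have eq: "abs_rp (g s) = cover ((h s, z s), w s)" for s using c(2)[of s] unfolding ceq .
  note lift = lift_of_diagram[OF n1 g eq]
  have C1: "C1_on UNIV h" "C1_on UNIV z" "C1_on UNIV w"
    unfolding h_def[abs_def] z_def[abs_def] w_def[abs_def] by (intro C1_intros c(3))+
  have p0: "(h s, w s) \<noteq> 0" for s using lift(1)[of s] by (auto simp: zero_prod_def)
  have net: "net D s = cover (sgn (h s, w s))" for s
    unfolding net_def traj by (rule lift(2))
  have norm_traj: "norm (traj D s) = 1 \<longleftrightarrow> w s = 0" for s unfolding traj by (rule lift(3))
  have norm_traj_le: "norm (traj D s) \<le> 1" for s using D by (simp add: based_oriented_diagram_def)
  have generic: "generic_immersion D" using D by (simp add: based_oriented_diagram_def)
  have triple: "r - s \<in> \<int> \<or> s - t \<in> \<int> \<or> r - t \<in> \<int>" if "net D r = net D s" "net D s = net D t" for r s t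
    using generic that unfolding generic_immersion_def by blast
  obtain b where b: "immersed_lift b (net D)"
    and trans: "\<And>s. norm (traj D s) = 1 \<Longrightarrow> snd (vector_derivative b (at s)) \<noteq> 0"
    and double: "\<And>s t. net D s = net D t \<Longrightarrow> s - t \<notin> \<int> \<Longrightarrow> norm (traj D s) < 1"
    using generic unfolding generic_immersion_def by blast
  have C1N: "C1_on UNIV (\<lambda>s. norm (h s, w s))" by (intro C1_intros C1 p0)
  have C1p: "C1_on UNIV (\<lambda>s. sgn (h s, w s))"
    unfolding sgn_div_norm by (intro C1_intros C1 C1N) (use p0 in simp)
  have nsgn: "norm (sgn (h s, w s)) = 1" for s using p0 by (simp add: norm_sgn)
  have bs: "b s = sgn (h s, w s) \<or> b s = - sgn (h s, w s)" for s
    using cover_eq_iff[OF immersed_liftD(1)[OF b, of s] nsgn[of s]] immersed_liftD(2)[OF b, of s] net[of s] by simp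
  have sgn_nz: "sgn (h s, w s) \<noteq> 0" for s using p0[of s] by (simp add: sgn_zero_iff)
  obtain e where e: "e = 1 \<or> e = -1" "\<And>s. b s = e *\<^sub>R sgn (h s, w s)"
    by (rule continuous_sign_constant[OF C1_on_imp_continuous_on[OF C1p]
      C1_on_imp_continuous_on[OF immersed_liftD(3)[OF b]] bs sgn_nz]) (rule that)
  have e2: "e * e = 1" using e(1) by auto
  have sgn_b: "sgn (h s, w s) = e *\<^sub>R b s" for s using e2 by (simp add: e(2))
  have p_b: "h s = (norm (h s, w s) * e) *\<^sub>R fst (b s)" "w s = (norm (h s, w s) * e) * snd (b s)" for s
  proof -
    have "(h s, w s) = norm (h s, w s) *\<^sub>R sgn (h s, w s)" using p0[of s] by (simp add: sgn_div_norm)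
    then have "(h s, w s) = norm (h s, w s) *\<^sub>R (e *\<^sub>R b s)" unfolding sgn_b .
    then show "h s = (norm (h s, w s) * e) *\<^sub>R fst (b s)" "w s = (norm (h s, w s) * e) * snd (b s)"
      by (metis fst_conv fst_scaleR scaleR_scaleR, metis snd_conv snd_scaleR scaleR_scaleR real_scaleR_def)
  qed
  \<comment> \<open>If the derivative of \<open>(h, w)\<close> is parallel to \<open>(h, w)\<close>, then the normalised curve,
    hence the lift \<open>b\<close> of the net, is stationary.\<close>
  have immersed: False if h': "(h has_vector_derivative h') (at s)" and w': "(w has_real_derivative w') (at s)"
      and par: "h' = l *\<^sub>R h s" "w' = l * w s" for h' w' s l
  proof -
    have w'v: "(w has_vector_derivative w') (at s)" using w' by (simp add: has_real_derivative_iff_has_vector_derivative)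
    have dN: "((\<lambda>s. norm (h s, w s)) has_real_derivative l * norm (h s, w s)) (at s)"
      by (rule norm_Pair_derivative) (use h' w' par p0 in simp_all)
    have "((\<lambda>s. inverse (norm (h s, w s))) has_real_derivative - (inverse (norm (h s, w s)) * (l * norm (h s, w s)) * inverse (norm (h s, w s)))) (at s)"
      by (rule DERIV_inverse'[OF dN]) (use p0 in simp)
    then have "((\<lambda>s. inverse (norm (h s, w s))) has_real_derivative - (l * inverse (norm (h s, w s)))) (at s)"
      using p0[of s] by (simp add: field_simps)
    from has_vector_derivative_scaleR[OF this has_vector_derivative_Pair[OF h' w'v]]
    have "((\<lambda>s. inverse (norm (h s, w s)) *\<^sub>R (h s, w s)) has_vector_derivative 
      inverse (norm (h s, w s)) *\<^sub>R (h', w') + (- (l * inverse (norm (h s, w s)))) *\<^sub>R (h s, w s)) (at s)" .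
    moreover have "inverse (norm (h s, w s)) *\<^sub>R (h', w') + (- (l * inverse (norm (h s, w s)))) *\<^sub>R (h s, w s) = 0"
      by (simp add: par mult.commute zero_prod_def)
    ultimately have "((\<lambda>s. sgn (h s, w s)) has_vector_derivative 0) (at s)" unfolding sgn_div_norm by simp
    then have "((\<lambda>s. e *\<^sub>R sgn (h s, w s)) has_vector_derivative e *\<^sub>R 0) (at s)"
      by (rule bounded_linear.has_vector_derivative[OF bounded_linear_scaleR_right])
    then have "(b has_vector_derivative 0) (at s)" unfolding e(2)[symmetric] by simp
    then show False using immersed_liftD(5)[OF b] vector_derivative_at by blast
  qed
  obtain w' where w': "\<And>t. (w has_real_derivative w' t) (at t)"
    using C1_on_realE[OF C1(3)] by (metis UNIV_I has_real_derivative_iff_has_vector_derivative)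
  have transverse: "w' t \<noteq> 0" if "w t = 0" for t
  proof
    assume "w' t = 0"
    have nz: "norm (h t, w t) * e \<noteq> 0" using p0[of t] e(1) unfolding mult_eq_0_iff norm_eq_zero by linarith
    have "(norm (h t, w t) * e) * snd (b t) = 0" using p_b(2)[of t] that by argo
    then have sb: "snd (b t) = 0" using nz unfolding mult_eq_0_iff[of "norm (h t, w t) * e"] by blast
    obtain n' where n': "((\<lambda>s. norm (h s, w s)) has_vector_derivative n') (at t)"
      using C1_on_realE[OF C1N] by (metis UNIV_I)
    have "((\<lambda>s. snd (b s)) has_vector_derivative snd (vector_derivative b (at t))) (at t)"
      by (rule bounded_linear.has_vector_derivative[OF bounded_linear_snd immersed_liftD(4)[OF b]])
    then have "((\<lambda>s. (norm (h s, w s) * e) * snd (b s)) has_real_derivative 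
       (n' * e) * snd (b t) + snd (vector_derivative b (at t)) * (norm (h t, w t) * e)) (at t)"
      using n' unfolding has_real_derivative_iff_has_vector_derivative[symmetric]
      by (intro DERIV_mult DERIV_cmult_right)
    then have "(w has_real_derivative snd (vector_derivative b (at t)) * (norm (h t, w t) * e)) (at t)"
      unfolding p_b(2)[symmetric] sb by simp
    then have "snd (vector_derivative b (at t)) * (norm (h t, w t) * e) = 0"
      using DERIV_unique[OF w'[of t]] \<open>w' t = 0\<close> by metis
    then have "snd (vector_derivative b (at t)) = 0"
      using nz unfolding mult_eq_0_iff[of "snd (vector_derivative b (at t))"] by blast
    then show False using trans[of t] norm_traj[of t] that by blast
  qed
  have parallel_net: "net D s = net D t" if "h s = l *\<^sub>R h t" "w s = l * w t" for s t l
  proof -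
    have "(h s, w s) = l *\<^sub>R (h t, w t)" using that by simp
    then have "sgn (h s, w s) = sgn l *\<^sub>R sgn (h t, w t)" by (simp only: sgn_scaleR)
    moreover have "l \<noteq> 0" using that p0[of s] by (auto simp: zero_prod_def)
    ultimately have "sgn (h s, w s) = sgn (h t, w t) \<or> sgn (h s, w s) = - sgn (h t, w t)" by (auto simp: sgn_if split: if_splits)
    then show ?thesis unfolding net using cover_eq_iff[OF nsgn nsgn] by blast
  qed
  have not_int: "s - t \<notin> \<int>" "t - s \<notin> \<int>" if "0 \<le> s" "s < t" "t < 1" for s t :: real
  proof -
    have "t - s \<in> \<int> \<Longrightarrow> False"
    proof (elim Ints_cases)
      fix k assume "t - s = of_int k"
      then have "0 < real_of_int k" "real_of_int k < 1" using that by linarith+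
      then have "0 < k" "k < 1" by simp_all
      then show False by simp
    qed
    then show "t - s \<notin> \<int>" by blast
    then show "s - t \<notin> \<int>" using Ints_minus[of "s - t"] by auto
  qed
  have crossing: "norm (traj D s) < 1 \<and> traj D s = traj D t" 
    if "s - t \<notin> \<int>" "h s = l *\<^sub>R h t" "w s = l * w t" for s t l
  proof -
    have eqn: "net D s = net D t" by (rule parallel_net[OF that(2,3)])
    have lt: "norm (traj D s) < 1" by (rule double[OF eqn that(1)])
    have "abs_rp (traj D s) = abs_rp (traj D t)" using eqn by (simp add: net_def)
    then show ?thesis using abs_rp_eq_iff[OF norm_traj_le norm_traj_le, of s t] lt by auto
  qed
  have cs: "c (s + 1) = c s \<or> c (s + 1) = - c s" for s
  proof -
    have "abs_rp (g (s + 1)) = abs_rp (g s)" unfolding inj by simp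
    then have "cover (c (s + 1)) = cover (c s)" by (simp add: c(2))
    then show ?thesis using cover_eq_iff[OF c(1)[of "s + 1"] c(1)[of s]] by blast
  qed
  have cont1: "continuous_on UNIV (\<lambda>s. c (s + 1))"
    by (rule continuous_on_compose2[OF C1_on_imp_continuous_on[OF c(3)]]) (intro continuous_intros, simp)
  have c_nz: "c s \<noteq> 0" for s using c(1)[of s] by force
  obtain \<sigma> where \<sigma>: "\<sigma> = 1 \<or> \<sigma> = -1" "\<And>s. c (s + 1) = \<sigma> *\<^sub>R c s"
    by (rule continuous_sign_constant[OF C1_on_imp_continuous_on[OF c(3)] cont1 cs c_nz]) (rule that)
  have "descending_curve \<sigma> h z w"
  proof
    show "\<bar>\<sigma>\<bar> = 1" using \<sigma>(1) by auto
    show "h (s + 1) = \<sigma> *\<^sub>R h s" "z (s + 1) = \<sigma> * z s" "w (s + 1) = \<sigma> * w s" for s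
      by (simp_all add: h_def z_def w_def \<sigma>(2))
    show "h s \<noteq> 0 \<or> w s \<noteq> 0" for s by (rule lift(1))
    show "w'' \<noteq> l * w s" if "(h has_vector_derivative h') (at s)" "(w has_real_derivative w'') (at s)" "h' = l *\<^sub>R h s"
      for h' w'' s l using immersed[OF that] by blast
    show "w 0 > 0" by (rule w0)
    show "w s \<noteq> l * w 0" if s: "0 < s" "s < 1" "h s = l *\<^sub>R h 0" for s l
    proof
      assume ws: "w s = l * w 0"
      have ni: "s - 0 \<notin> \<int>" using not_int[of 0 s] s by simp
      from crossing[OF ni s(3) ws] have "crossing D (traj D 0)" unfolding crossing_def using ni by blast
      then show False using D by (simp add: based_oriented_diagram_def)
    qed
    show "l * z t < z s" if st: "0 \<le> s" "s < t" "t < 1" and p: "h s = l *\<^sub>R h t" "w s = l * w t" for s t l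
    proof -
      note ni = not_int[OF st]
      have cr: "norm (traj D s) < 1" "traj D s = traj D t" using crossing[OF ni(1) p] by auto
      have ws: "w s \<noteq> 0" using cr(1) norm_traj[of s] by auto
      have wt: "w t \<noteq> 0" using ws p by auto
      have X: "Defs.crossing D (traj D s)" unfolding crossing_def using ni(1) cr(2) by metis
      have fp: "first_pass D 0 (traj D s) = s"
        unfolding first_pass_def
      proof (rule Least_equality)
        show "0 \<le> s \<and> traj D s = traj D s" using st by simp
        fix r assume r: "0 \<le> r \<and> traj D r = traj D s"
        show "s \<le> r"
        proof (rule ccontr)
          assume "\<not> s \<le> r"
          then have "0 \<le> r" "r < s" "s < 1" "r < t" using r st by auto
          moreover have "net D r = net D s" "net D s = net D t" using r cr by (simp_all add: net_def)
          ultimately show False using triple[of r s t] not_int(1)[of r s] not_int(1)[of r t] ni st by auto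
        qed
      qed
      have "over D s \<longleftrightarrow> even (arc_distance D 0 s)"
        using desc[unfolded descending_def, rule_format, OF X] unfolding fp .
      also have "\<dots> \<longleftrightarrow> even (card {x. 0 < x \<and> x < s \<and> w x = 0})"
        unfolding arc_distance_def norm_traj ..
      also have "\<dots> \<longleftrightarrow> w s > 0"
        by (rule parity_of_transverse_zeros[OF w' transverse w0 st(1) ws])
      finally have os: "over D s \<longleftrightarrow> w s > 0" .
      have "over D s \<noteq> over D t" using D ni(1) cr(2) by (auto simp: based_oriented_diagram_def)
      then have ot: "over D t \<longleftrightarrow> \<not> w s > 0" using os by blast
      have gs: "g s = stereo ((h s, z s), w s)" "g t = stereo ((h t, z t), w t)" by (rule lift(4), rule ws, rule lift(4), rule wt)
      show ?thesis
      proof (rule first_over_lift[OF n1 n1 p ws])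
        show "if 0 < w s then dist (stereo ((h s, z s), w s)) north < dist (stereo ((h t, z t), w t)) north
          else dist (stereo ((h t, z t), w t)) north < dist (stereo ((h s, z s), w s)) north"
          using over[OF ni(1) cr(2)] over[OF ni(2) cr(2)[symmetric]] os ot unfolding gs by simp
      qed
    qed
  qed (rule C1)+
  then show ?thesis unfolding h_def z_def w_def by blast
qed

text \<open>
  A lift of the knot to the sphere, with the sign chosen so that \<open>w > 0\<close> at the basepoint, is a
  descending curve.
\<close>

theorem theorem2:
  fixes D :: diagram and K :: "rp3 set"
  assumes "knot K" and "is_diagram_of D K" and "descending D"
  shows "unknot K"
proof -
  have D: "based_oriented_diagram D" using assms(2) by (simp add: is_diagram_of_def)
  obtain g where g: "\<And>s. g s \<in> cball 0 1 - {north, south}" "\<And>s. traj D s = proj (g s)"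
    and kp: "knot_param (\<lambda>s. abs_rp (g s))" and K: "K = range (\<lambda>s. abs_rp (g s))"
    and over: "\<And>s t. s - t \<notin> \<int> \<Longrightarrow> traj D s = traj D t \<Longrightarrow> over D s \<longleftrightarrow> dist (g s) north < dist (g t) north"
    using assms(2) unfolding is_diagram_of_def by blast
  have inj: "\<And>s t. abs_rp (g s) = abs_rp (g t) \<longleftrightarrow> s - t \<in> \<int>"
    using kp unfolding knot_param_def by blast
  obtain c where c: "immersed_lift c (\<lambda>s. abs_rp (g s))" using kp unfolding knot_param_def by blast
  define e where "e = sgn (snd (c 0))"
  have "snd (c 0) \<noteq> 0"
  proof
    assume z: "snd (c 0) = 0"
    have "norm (proj (g 0)) = 1"
      using lift_of_diagram(3)[of "fst (fst (c 0))" "snd (fst (c 0))" "snd (c 0)" "g 0", unfolded prod.collapse,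
          OF immersed_liftD(1)[OF c] g(1) immersed_liftD(2)[OF c]] z by simp
    then show False using D g(2)[of 0] by (simp add: based_oriented_diagram_def)
  qed
  then have e: "e = 1 \<or> e = -1" "e * snd (c 0) > 0" by (auto simp: e_def sgn_if)
  define c' where "c' s = e *\<^sub>R c s" for s
  have n: "norm (c' s) = 1" for s using e(1) immersed_liftD(1)[OF c, of s] by (auto simp: c'_def)
  have cov: "abs_rp (g s) = cover (c' s)" for s
    using e(1) immersed_liftD(2)[OF c, of s] cover_uminus[OF immersed_liftD(1)[OF c, of s]] by (auto simp: c'_def)
  have C: "C1_on UNIV c'" unfolding c'_def[abs_def] by (intro C1_intros immersed_liftD(3)[OF c])
  have c'0: "snd (c' 0) > 0" using e(2) by (simp add: c'_def)
  obtain \<sigma> where "descending_curve \<sigma> (\<lambda>s. fst (fst (c' s))) (\<lambda>s. snd (fst (c' s))) (\<lambda>s. snd (c' s))"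
    using descending_curve_of_descending_diagram[OF D assms(3) g inj over n cov C c'0] by blast
  then interpret descending_curve \<sigma> "\<lambda>s. fst (fst (c' s))" "\<lambda>s. snd (fst (c' s))" "\<lambda>s. snd (c' s)" .
  have "K = knot_of c'"
    unfolding K knot_of_def cov using n by (simp add: sgn_div_norm)
  then show ?thesis using unknot_descending_curve by simp
qed

end
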